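(* Let $\mathcal{G}$ be a compact metric graph and let $(D(A),A)$ be a self-adjoint realisation on $L^2(\mathcal{G})$ of the Laplacian on $\mathcal{G}$, acting as $u\mapsto -u''$ on every edge. Let $f\in C(\mathbb{R},\mathbb{R})$ and $F(s):=\int_0^s f(t)\,dt$. Assume that: (i) the function $s\mapsto \frac{f(s)}{|s|}$ is strictly increasing on $\mathbb{R}\setminus\{0\}$, with $\lim_{s\to 0}\frac{f(s)}{|s|}=0$, $\lim_{s\to+\infty}\frac{f(s)}{|s|}=+\infty$ and $\lim_{s\to-\infty}\frac{f(s)}{|s|}=-\infty$; (ii) there exist $s_0>0$ and $\kappa_0>1$ such that $F\bigl(\frac{s}{\kappa_0}\bigr)\le F(-s)\le F(\kappa_0 s)$ for all $s\ge s_0$. Then, for any $\mu>0$, the nonlinear Schrödinger equation $-u''=\lambda u+f(u)$ coupled with the vertex conditions from $D(A)$ has infinitely many normalized solutions of mass $\mu$, associated to a sequence of parameters $\lambda$ converging to $+\infty$; that is, there are a sequence of real numbers $(\Lambda_j)_{j\ge1}$ with $\Lambda_j\to+\infty$ and functions $u_j\in D(A)$ with $Au_j=\Lambda_j u_j+f(u_j)$ and $\|u_j\|_{L^2(\mathcal{G})}^2=\mu$ for all $j$. Moreover, if $A$ admits one eigenfunction which is positive almost everywhere in $\mathcal{G}$, then these solutions are sign-changing for $\lambda$ large (i.e. $u_j$ is sign-changing for all sufficiently large $j$).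
   Context: A compact metric graph consists of a finite number of edges, identified with compact intervals of $\mathbb{R}$ (of positive length), joined together at vertices. All functions are real-valued. A self-adjoint realisation $(D(A),A)$ of the Laplacian is a self-adjoint operator on $L^2(\mathcal{G})$ acting as $u\mapsto -u''$ on every edge, whose domain $D(A)$ is a vector space of functions that are $H^2$ on each edge and satisfy vertex conditions making $A$ self-adjoint (for instance continuity/Kirchhoff, Dirichlet or $\delta$-conditions, but any self-adjoint vertex conditions are allowed). A solution of the equation coupled with the vertex conditions from $D(A)$ is a function $u\in D(A)$ satisfying $-u''=\lambda u+f(u)$ on each edge. The mass of $u$ is $\|u\|_{L^2(\mathcal{G})}^2$. A function is sign-changing if both its positive and its negative part are nontrivial. *)

theory Defs
  imports "HOL-Analysis.Analysis" "Graph_Theory.Digraph"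
begin

section \<open>Compact metric graphs and functions on them\<close>

text \<open>
  The underlying combinatorial graph is a finite digraph in which loops and multiple arcs are
  allowed. The arc \<open>e\<close> is identified with the interval \<open>[0, len e]\<close>, the point \<open>0\<close> being glued to
  \<open>tail G e\<close> and the point \<open>len e\<close> to \<open>head G e\<close>; the orientation of an arc only records this
  parametrisation. A graph without edges is excluded, connectedness is not assumed.
\<close>

definition compact_metric_graph :: "('v, 'e) pre_digraph \<Rightarrow> ('e \<Rightarrow> real) \<Rightarrow> bool" where
  "compact_metric_graph G len \<longleftrightarrow>
     fin_digraph G \<and> arcs G \<noteq> {} \<and> (\<forall>e\<in>arcs G. 0 < len e)"

text \<open>
  A function on the graph is given edgewise, \<open>u e x\<close> being its value at the point \<open>x\<close> of the
  edge \<open>e\<close>; values with \<open>e \<notin> arcs G\<close> or \<open>x \<notin> {0..len e}\<close> are irrelevant.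
\<close>

type_synonym 'e graph_fun = "'e \<Rightarrow> real \<Rightarrow> real"

definition ae_on_graph ::
  "('v, 'e) pre_digraph \<Rightarrow> ('e \<Rightarrow> real) \<Rightarrow> ('e \<Rightarrow> real \<Rightarrow> bool) \<Rightarrow> bool" where
  "ae_on_graph G len P \<longleftrightarrow> (\<forall>e\<in>arcs G. AE x\<in>{0..len e} in lborel. P e x)"

definition ae_equal ::
  "('v, 'e) pre_digraph \<Rightarrow> ('e \<Rightarrow> real) \<Rightarrow> 'e graph_fun \<Rightarrow> 'e graph_fun \<Rightarrow> bool" where
  "ae_equal G len u v \<longleftrightarrow> ae_on_graph G len (\<lambda>e x. u e x = v e x)"

definition sign_changing ::
  "('v, 'e) pre_digraph \<Rightarrow> ('e \<Rightarrow> real) \<Rightarrow> 'e graph_fun \<Rightarrow> bool" where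
  "sign_changing G len u \<longleftrightarrow>
     \<not> ae_equal G len (\<lambda>e x. max (u e x) 0) (\<lambda>e x. 0) \<and>
     \<not> ae_equal G len (\<lambda>e x. max (- u e x) 0) (\<lambda>e x. 0)"


section \<open>The Hilbert space of square integrable functions\<close>

text \<open>Elements are representatives; equality in the space is equality almost everywhere.\<close>

definition L2_interval :: "real \<Rightarrow> (real \<Rightarrow> real) set" where
  "L2_interval l = {u. set_borel_measurable lborel {0..l} u \<and>
                       set_integrable lborel {0..l} (\<lambda>x. (u x)\<^sup>2)}"

definition L2_graph :: "('v, 'e) pre_digraph \<Rightarrow> ('e \<Rightarrow> real) \<Rightarrow> 'e graph_fun set" where
  "L2_graph G len = {u. \<forall>e\<in>arcs G. u e \<in> L2_interval (len e)}"

definition L2_inner ::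
  "('v, 'e) pre_digraph \<Rightarrow> ('e \<Rightarrow> real) \<Rightarrow> 'e graph_fun \<Rightarrow> 'e graph_fun \<Rightarrow> real" where
  "L2_inner G len u v = (\<Sum>e\<in>arcs G. LBINT x:{0..len e}. u e x * v e x)"

definition L2_norm :: "('v, 'e) pre_digraph \<Rightarrow> ('e \<Rightarrow> real) \<Rightarrow> 'e graph_fun \<Rightarrow> real" where
  "L2_norm G len u = sqrt (L2_inner G len u u)"

text \<open>
  Self-adjointness of the operator \<open>A\<close> with domain \<open>D\<close>: it is densely defined and coincides with
  its adjoint. The left-hand side of the equivalence says that \<open>v\<close> lies in the domain of the
  adjoint and is mapped to \<open>w\<close>, the right-hand side that \<open>v\<close> lies in \<open>D\<close> and \<open>A v = w\<close>.
\<close>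

definition selfadjoint_operator ::
  "('v, 'e) pre_digraph \<Rightarrow> ('e \<Rightarrow> real) \<Rightarrow> 'e graph_fun set \<Rightarrow> ('e graph_fun \<Rightarrow> 'e graph_fun) \<Rightarrow> bool"
where
  "selfadjoint_operator G len D A \<longleftrightarrow>
     D \<subseteq> L2_graph G len \<and> A ` D \<subseteq> L2_graph G len \<and>
     (\<forall>v\<in>L2_graph G len. \<forall>\<epsilon>>0. \<exists>u\<in>D. L2_norm G len (\<lambda>e x. u e x - v e x) < \<epsilon>) \<and>
     (\<forall>v\<in>L2_graph G len. \<forall>w\<in>L2_graph G len.
        (\<forall>u\<in>D. L2_inner G len (A u) v = L2_inner G len u w) \<longleftrightarrow>
        (\<exists>u\<in>D. ae_equal G len u v \<and> ae_equal G len (A u) w))"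


section \<open>Sobolev functions on the edges\<close>

text \<open>Continuously differentiable functions with compact support in the open interval \<open>(0, l)\<close>,
  extended by zero to the real line.\<close>

definition test_functions :: "real \<Rightarrow> (real \<Rightarrow> real) set" where
  "test_functions l =
     {\<phi>. (\<forall>x. \<phi> differentiable (at x)) \<and> continuous_on UNIV (deriv \<phi>) \<and>
         (\<exists>a b. 0 < a \<and> b < l \<and> (\<forall>x. x \<notin> {a..b} \<longrightarrow> \<phi> x = 0))}"

definition weak_deriv :: "real \<Rightarrow> (real \<Rightarrow> real) \<Rightarrow> (real \<Rightarrow> real) \<Rightarrow> bool" where
  "weak_deriv l u g \<longleftrightarrow>
     (\<forall>\<phi>\<in>test_functions l.
        (LBINT x:{0..l}. u x * deriv \<phi> x) = - (LBINT x:{0..l}. g x * \<phi> x))"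

definition weak_deriv2 :: "real \<Rightarrow> (real \<Rightarrow> real) \<Rightarrow> (real \<Rightarrow> real) \<Rightarrow> bool" where
  "weak_deriv2 l u h \<longleftrightarrow> (\<exists>g\<in>L2_interval l. weak_deriv l u g \<and> weak_deriv l g h)"

text \<open>
  Every \<open>H\<^sup>2\<close> function is represented by its continuous version on the closed edge, which is then
  automatically \<open>C\<^sup>1\<close> up to the endpoints. Hence boundary values are plain point values and
  boundary derivatives are one-sided classical derivatives.
\<close>

definition H2_interval :: "real \<Rightarrow> (real \<Rightarrow> real) set" where
  "H2_interval l =
     {u\<in>L2_interval l. continuous_on {0..l} u \<and> (\<exists>h\<in>L2_interval l. weak_deriv2 l u h)}"

definition H2_graph :: "('v, 'e) pre_digraph \<Rightarrow> ('e \<Rightarrow> real) \<Rightarrow> 'e graph_fun set" where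
  "H2_graph G len = {u. \<forall>e\<in>arcs G. u e \<in> H2_interval (len e)}"


section \<open>Vertex conditions and self-adjoint realisations of the Laplacian\<close>

text \<open>
  An edge end is a pair \<open>(e, b)\<close>: the point \<open>0\<close> of \<open>e\<close> if \<open>b\<close> is false, the point \<open>len e\<close> if \<open>b\<close> is
  true. A loop contributes two ends to its vertex.
\<close>

definition ends_at :: "('v, 'e) pre_digraph \<Rightarrow> 'v \<Rightarrow> ('e \<times> bool) set" where
  "ends_at G v = {(e, b). e \<in> arcs G \<and> (if b then head G e else tail G e) = v}"

fun end_value :: "('e \<Rightarrow> real) \<Rightarrow> 'e graph_fun \<Rightarrow> 'e \<times> bool \<Rightarrow> real" where
  "end_value len u (e, b) = u e (if b then len e else 0)"

text \<open>The derivative at an edge end is taken in the direction from the vertex into the edge.\<close>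

fun end_deriv :: "('e \<Rightarrow> real) \<Rightarrow> 'e graph_fun \<Rightarrow> 'e \<times> bool \<Rightarrow> real" where
  "end_deriv len u (e, b) =
     (if b then - vector_derivative (u e) (at (len e) within {0..len e})
      else vector_derivative (u e) (at 0 within {0..len e}))"

text \<open>
  Vertex conditions are homogeneous linear relations between the values and the derivatives at the
  edge ends meeting in a common vertex. Each \<open>(\<alpha>, \<beta>) \<in> C v\<close> encodes one equation at \<open>v\<close>, that is,
  one row of the matrices \<open>A\<^sub>v, B\<^sub>v\<close> in the usual form \<open>A\<^sub>v U(v) + B\<^sub>v U'(v) = 0\<close>.
\<close>

type_synonym ('v, 'e) vertex_conditions = "'v \<Rightarrow> (('e \<times> bool \<Rightarrow> real) \<times> ('e \<times> bool \<Rightarrow> real)) set"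

definition vertex_conditions_domain ::
  "('v, 'e) pre_digraph \<Rightarrow> ('e \<Rightarrow> real) \<Rightarrow> ('v, 'e) vertex_conditions \<Rightarrow> 'e graph_fun set" where
  "vertex_conditions_domain G len C =
     {u\<in>H2_graph G len. \<forall>v\<in>verts G. \<forall>(\<alpha>, \<beta>)\<in>C v.
        (\<Sum>p\<in>ends_at G v. \<alpha> p * end_value len u p + \<beta> p * end_deriv len u p) = 0}"

definition selfadjoint_laplacian ::
  "('v, 'e) pre_digraph \<Rightarrow> ('e \<Rightarrow> real) \<Rightarrow> 'e graph_fun set \<Rightarrow> ('e graph_fun \<Rightarrow> 'e graph_fun) \<Rightarrow> bool"
where
  "selfadjoint_laplacian G len D A \<longleftrightarrow>
     (\<exists>C. D = vertex_conditions_domain G len C) \<and>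
     (\<forall>u\<in>D. \<forall>e\<in>arcs G. weak_deriv2 (len e) (u e) (\<lambda>x. - A u e x)) \<and>
     selfadjoint_operator G len D A"

definition eigenfunction ::
  "('v, 'e) pre_digraph \<Rightarrow> ('e \<Rightarrow> real) \<Rightarrow> 'e graph_fun set \<Rightarrow> ('e graph_fun \<Rightarrow> 'e graph_fun) \<Rightarrow>
   'e graph_fun \<Rightarrow> bool" where
  "eigenfunction G len D A \<phi> \<longleftrightarrow>
     \<phi> \<in> D \<and> \<not> ae_equal G len \<phi> (\<lambda>e x. 0) \<and>
     (\<exists>\<nu>::real. ae_equal G len (A \<phi>) (\<lambda>e x. \<nu> * \<phi> e x))"

end

theory Submission
  imports Defs "HOL-Complex_Analysis.Great_Picard" "HOL-Library.Function_Algebras"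
begin

text \<open>
  For a fixed mass \<open>\<mu>\<close> and large \<open>\<lambda>\<close> the nonlinearity is a bounded perturbation of the linear
  problem. Along an edge the quantity \<open>u'\<^sup>2 + \<lambda> u\<^sup>2 + 2 F(u)\<close> is conserved, and when \<open>\<lambda> u\<^sup>2\<close> dominates
  \<open>F(u)\<close> this makes \<open>u\<close> oscillate with an amplitude comparable to its quadratic mean. Hence every
  solution of mass \<open>\<mu>\<close> is bounded by a constant \<open>M\<close> that depends on \<open>\<mu>\<close> and on the shortest edge
  alone, as soon as \<open>\<lambda>\<close> is large compared with the size of the nonlinearity
  (\<open>ode_sup_bound\<close>, \<open>solution_sup_bound\<close>). It therefore suffices to treat \<open>g\<close>, the composition of
  \<open>f\<close> with the projection of the real line onto \<open>[-M, M]\<close>: a solution for \<open>g\<close> with large \<open>\<lambda>\<close> is a solution for \<open>f\<close>. The function \<open>g\<close>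
  is bounded, and it is increasing because \<open>f s / \<bar>s\<bar>\<close> increases and tends to \<open>0\<close> at \<open>0\<close>
  (\<open>monotone_nonlinearity\<close>).

  Solutions of mass \<open>\<mu>\<close> for \<open>g\<close> are the critical points of \<open>E(u) = \<langle>A u, u\<rangle> / 2 - \<integral> G(u)\<close> on a sphere,
  where \<open>G\<close> is a primitive of \<open>g\<close>. They are found at large gaps of the spectrum of \<open>A\<close>. A function
  vanishing at the points of a grid with \<open>m\<close> steps on every edge satisfies a Poincare inequality with
  constant of order \<open>m\<^sup>-\<^sup>2\<close>; as these are \<open>O(m)\<close> linear conditions, the eigenvalues grow quadratically along
  a subsequence and the gaps \<open>\<lambda>\<^sub>n\<^sub>+\<^sub>1 - \<lambda>\<^sub>n\<close> are unbounded (\<open>large_gap\<close>). At a large gap write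
  \<open>u = p + \<sigma>(p) q\<close> with \<open>p\<close> in the span of the eigenvectors below the gap, \<open>q\<close> a unit vector
  orthogonal to them and \<open>\<sigma>(p)\<close> chosen so that \<open>u\<close> has mass \<open>\<mu>\<close>. The energy is strictly concave in \<open>p\<close>,
  because \<open>G\<close> is convex and the gap beats the curvature of the sphere, so that its maximiser is unique and depends
  continuously on \<open>q\<close>. Minimising the maximal value over \<open>q\<close> produces a critical point
  (\<open>saddle_point\<close>). This is carried out in finite dimensional spans of eigenvectors, with bounds that do not
  depend on the dimension, followed by a limit (\<open>solution_above_gap\<close>). The multiplier is at least
  \<open>\<lambda>\<^sub>n\<^sub>+\<^sub>1\<close> minus a constant, so it can be made as large as desired.

  The spectral theory rests on two facts about \<open>A\<close>. First, its quadratic form is \<open>\<integral> u'\<^sup>2\<close> plus a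
  symmetric boundary form that only sees the values of \<open>u\<close> at the edge ends, hence is bounded by these
  finitely many values and is a small perturbation of \<open>\<integral> u'\<^sup>2\<close> (\<open>form_lower_bound\<close>). Second, by the
  theorem of Arzela and Ascoli, sequences of bounded energy are compact. Eigenvectors are obtained by successive
  minimisation; weak limits of approximate solutions belong to the domain because \<open>A\<close> coincides with its adjoint.

  Finally, pairing the equation with a positive eigenfunction for the eigenvalue \<open>\<nu>\<close> gives
  \<open>(\<nu> - \<lambda>) \<langle>u, \<phi>\<rangle> = \<langle>f(u), \<phi>\<rangle>\<close>. If \<open>u\<close> had one sign, then \<open>f(u)\<close> would have the same sign, which is impossible
  for \<open>\<lambda> > \<nu>\<close> (\<open>sign_changing_above_positive_eigenvalue\<close>).
\<close>



section \<open>Saddle points of a perturbed quadratic form on a sphere\<close>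

lemma right_difference_quotient:
  assumes "(f has_vector_derivative w) (at_right (0::real))"
  shows "((\<lambda>t. (f t - f 0) /\<^sub>R t) \<longlongrightarrow> w) (at_right 0)"
proof -
  have "((\<lambda>y. (1 / norm (y - 0)) *\<^sub>R (f y - (f 0 + (y - 0) *\<^sub>R w))) \<longlongrightarrow> 0) (at_right 0)"
    using assms unfolding has_vector_derivative_def has_derivative_within by blast
  then have "((\<lambda>t. (f t - f 0) /\<^sub>R t - w) \<longlongrightarrow> 0) (at_right 0)"
  proof (rule Lim_transform_eventually)
    show "\<forall>\<^sub>F y in at_right 0. (1 / norm (y - 0)) *\<^sub>R (f y - (f 0 + (y - 0) *\<^sub>R w)) = (f y - f 0) /\<^sub>R y - w"
      using eventually_at_right_less[of "0::real"]
      by eventually_elim (simp add: algebra_simps divide_inverse)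
  qed
  then show ?thesis by (rule LIM_zero_cancel)
qed

text \<open>
  With \<open>y\<close> constant this is the first order condition at a maximum along a curve. Two moving curves
  \<open>x\<close>, \<open>y\<close> with the same limit \<open>u\<close> are needed to differentiate a maximal value whose maximiser moves.
  Convexity of \<open>\<Gamma>\<close> replaces differentiability: \<open>\<Gamma> x - \<Gamma> y \<le> \<gamma> x \<bullet> (x - y)\<close>.
\<close>

lemma directional_derivative_nonpos:
  fixes L :: "'a::real_inner \<Rightarrow> 'a" and \<Gamma> :: "'a \<Rightarrow> real" and \<gamma> :: "'a \<Rightarrow> 'a"
    and x y :: "real \<Rightarrow> 'a"
  defines "E \<equiv> \<lambda>v. v \<bullet> L v / 2 - \<Gamma> v"
  assumes L: "bounded_linear L" and sym: "\<And>x y. x \<bullet> L y = L x \<bullet> y"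
    and conv: "\<And>x y. \<Gamma> x + \<gamma> x \<bullet> (y - x) \<le> \<Gamma> y" and cont: "continuous_on UNIV \<gamma>"
    and x: "(x \<longlongrightarrow> u) (at_right 0)" and y: "(y \<longlongrightarrow> u) (at_right 0)"
    and w: "((\<lambda>t. (x t - y t) /\<^sub>R t) \<longlongrightarrow> w) (at_right 0)"
    and le: "eventually (\<lambda>t. E (x t) \<le> E (y t)) (at_right 0)"
  shows "(L u - \<gamma> u) \<bullet> w \<le> 0"
proof -
  interpret L: bounded_linear L by fact
  have ev: "eventually (\<lambda>t::real. t > 0) (at_right 0)"
    by (simp add: eventually_at_right_less)
  have "eventually (\<lambda>t. L ((x t + y t) /\<^sub>R 2) \<bullet> ((x t - y t) /\<^sub>R t) - \<gamma> (x t) \<bullet> ((x t - y t) /\<^sub>R t) \<le> 0) (at_right 0)"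
    using le ev
  proof eventually_elim
    case (elim t)
    have "\<Gamma> (x t) - \<Gamma> (y t) \<le> \<gamma> (x t) \<bullet> (x t - y t)"
      using conv[of "x t" "y t"] by (simp add: inner_diff_right)
    moreover have "x t \<bullet> L (x t) / 2 - y t \<bullet> L (y t) / 2 = L ((x t + y t) /\<^sub>R 2) \<bullet> (x t - y t)"
      using sym[of "x t" "y t"]
      by (simp add: L.scaleR L.add inner_add_left inner_diff_right inner_commute algebra_simps)
    ultimately have "L ((x t + y t) /\<^sub>R 2) \<bullet> (x t - y t) - \<gamma> (x t) \<bullet> (x t - y t) \<le> 0"
      using elim(1) unfolding E_def by linarith
    then have "(L ((x t + y t) /\<^sub>R 2) \<bullet> (x t - y t) - \<gamma> (x t) \<bullet> (x t - y t)) / t \<le> 0"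
      using elim(2) by (simp add: divide_nonpos_pos)
    then show ?case using elim(2) by (simp only: divide_inverse inner_scaleR_right right_diff_distrib mult.commute[of _ "inverse t"])
  qed
  note neg = this
  have lim: "((\<lambda>t. L ((x t + y t) /\<^sub>R 2) \<bullet> ((x t - y t) /\<^sub>R t) - \<gamma> (x t) \<bullet> ((x t - y t) /\<^sub>R t))
      \<longlongrightarrow> L ((u + u) /\<^sub>R 2) \<bullet> w - \<gamma> u \<bullet> w) (at_right 0)"
  proof -
    have g: "((\<lambda>t. \<gamma> (x t)) \<longlongrightarrow> \<gamma> u) (at_right 0)"
      using cont x by (simp add: continuous_on_eq_continuous_at isCont_tendsto_compose)
    note a = L.tendsto[OF tendsto_scaleR[OF tendsto_const tendsto_add[OF x y]], of "inverse 2"]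
    show ?thesis by (rule tendsto_diff[OF tendsto_inner[OF a w] tendsto_inner[OF g w]])
  qed
  have "L ((u + u) /\<^sub>R 2) \<bullet> w - \<gamma> u \<bullet> w \<le> 0"
    by (rule tendsto_upperbound[OF lim neg trivial_limit_at_right_real])
  moreover have "(u + u) /\<^sub>R 2 = u"
    using scaleR_half_double[of u] by (simp only: divide_inverse mult_1)
  ultimately show ?thesis by (simp only: inner_diff_left)
qed

text \<open>
  \<open>P\<close> and \<open>Q\<close> are the spaces below and above a gap \<open>(\<alpha>, b)\<close> of the symmetric operator \<open>L\<close>, and \<open>\<gamma>\<close> is a
  bounded subgradient of the convex function \<open>\<Gamma>\<close>. The gap is large compared with the bound \<open>\<beta>\<close> on \<open>\<gamma>\<close>, and \<open>q0\<close>
  attains its upper end.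
\<close>

locale saddle =
  fixes P Q :: "'a::real_inner set" and L :: "'a \<Rightarrow> 'a" and \<Gamma> :: "'a \<Rightarrow> real" and \<gamma> :: "'a \<Rightarrow> 'a"
    and \<alpha> b \<beta> \<mu> :: real and q0 :: 'a
  assumes P: "subspace P" and Q: "subspace Q" and orth: "\<And>p q. p \<in> P \<Longrightarrow> q \<in> Q \<Longrightarrow> p \<bullet> q = 0"
    and cP: "\<And>r. compact (P \<inter> cball 0 r)" and cQ: "compact (Q \<inter> sphere 0 1)"
    and L: "bounded_linear L" and sym: "\<And>x y. x \<bullet> L y = L x \<bullet> y"
    and Lorth: "\<And>p q. p \<in> P \<Longrightarrow> q \<in> Q \<Longrightarrow> p \<bullet> L q = 0"
    and LP: "\<And>p. p \<in> P \<Longrightarrow> p \<bullet> L p \<le> \<alpha> * (p \<bullet> p)"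
    and LQ: "\<And>q. q \<in> Q \<Longrightarrow> b * (q \<bullet> q) \<le> q \<bullet> L q"
    and conv: "\<And>x y. \<Gamma> x + \<gamma> x \<bullet> (y - x) \<le> \<Gamma> y" and cont: "continuous_on UNIV \<gamma>"
    and bound: "\<And>x. norm (\<gamma> x) \<le> \<beta>"
    and mu: "\<mu> > 0" and gap: "b - \<alpha> > 8 * \<beta> / sqrt \<mu>"
    and q0: "q0 \<in> Q" "norm q0 = 1" "q0 \<bullet> L q0 = b"
begin

sublocale L: bounded_linear L by (fact L)

text \<open>
  The sphere of mass \<open>\<mu>\<close> is parametrised by \<open>U p q\<close> with \<open>p\<close> in \<open>K\<close> and \<open>q\<close> in the unit sphere \<open>S\<close> of \<open>Q\<close>. The bound
  \<open>p \<bullet> p \<le> \<mu> / 2\<close> in \<open>K\<close> keeps \<open>\<sigma>\<close> smooth, away from its zeros.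
\<close>

definition "E v = v \<bullet> L v / 2 - \<Gamma> v"
definition "\<sigma> (p::'a) = sqrt (\<mu> - p \<bullet> p)"
definition "U p q = p + \<sigma> p *\<^sub>R q"
definition "K = {p \<in> P. p \<bullet> p \<le> \<mu> / 2}"
definition "S = {q \<in> Q. norm q = 1}"

lemma beta_nonneg: "0 \<le> \<beta>" using bound[of 0] norm_ge_zero order_trans by blast

lemma gap_pos: "b - \<alpha> > 0"
proof -
  have "0 \<le> 8 * \<beta> / sqrt \<mu>" using mu beta_nonneg by simp
  then show ?thesis using gap by linarith
qed

lemma beta_le: "\<beta> \<le> (b - \<alpha>) / 8 * sqrt \<mu>"
  using gap mu by (simp add: field_simps)

lemma Gamma_lip: "\<bar>\<Gamma> x - \<Gamma> y\<bar> \<le> \<beta> * norm (x - y)"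
proof -
  have *: "\<Gamma> x - \<Gamma> y \<le> \<beta> * norm (x - y)" for x y
  proof -
    have "\<Gamma> x - \<Gamma> y \<le> \<gamma> x \<bullet> (x - y)" using conv[of x y] by (simp add: inner_diff_right)
    also have "\<dots> \<le> norm (\<gamma> x) * norm (x - y)" by (rule norm_cauchy_schwarz)
    also have "\<dots> \<le> \<beta> * norm (x - y)" by (intro mult_right_mono bound) auto
    finally show ?thesis .
  qed
  show ?thesis using *[of x y] *[of y x] by (simp add: norm_minus_commute abs_le_iff)
qed

lemma cont_\<Gamma>: "continuous_on A \<Gamma>"
proof (rule continuous_on_subset[of UNIV])
  show "continuous_on UNIV \<Gamma>"
    unfolding continuous_on_iff
  proof (intro ballI allI impI)
    fix x :: 'a and e :: real assume "e > 0"
    show "\<exists>d>0. \<forall>x'\<in>UNIV. dist x' x < d \<longrightarrow> dist (\<Gamma> x') (\<Gamma> x) < e"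
    proof (intro exI[of _ "e / (\<beta> + 1)"] conjI ballI impI)
      show "e / (\<beta> + 1) > 0" using \<open>e > 0\<close> beta_nonneg by simp
      fix x' assume "dist x' x < e / (\<beta> + 1)"
      then have "(\<beta> + 1) * norm (x' - x) < e"
        using beta_nonneg by (simp add: dist_norm field_simps)
      moreover have "\<beta> * norm (x' - x) \<le> (\<beta> + 1) * norm (x' - x)" by (simp add: mult_right_mono)
      ultimately show "dist (\<Gamma> x') (\<Gamma> x) < e" using Gamma_lip[of x' x] by (simp add: dist_real_def)
    qed
  qed
qed auto

lemma cont_E: "continuous_on A E"
  unfolding E_def
  by (intro continuous_intros cont_\<Gamma> L.continuous_on) simp

lemma cont_U1: "continuous_on A (\<lambda>p. U p q)"
  unfolding U_def \<sigma>_def by (intro continuous_intros)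

lemma cont_U2: "continuous_on A (\<lambda>q. U p q)"
  unfolding U_def by (intro continuous_intros)

lemma SD: "q \<in> S \<Longrightarrow> q \<in> Q" "q \<in> S \<Longrightarrow> q \<bullet> q = 1"
  by (auto simp: S_def norm_eq_sqrt_inner)

lemma KD: "p \<in> K \<Longrightarrow> p \<in> P" "p \<in> K \<Longrightarrow> p \<bullet> p \<le> \<mu> / 2"
  by (auto simp: K_def)

lemma sigma_sq: "p \<in> K \<Longrightarrow> (\<sigma> p)\<^sup>2 = \<mu> - p \<bullet> p"
  using mu KD(2)[of p] unfolding \<sigma>_def by simp

lemma sigma_ge: "p \<in> K \<Longrightarrow> \<sigma> p \<ge> sqrt (\<mu> / 2)"
  using KD(2)[of p] unfolding \<sigma>_def by (intro real_sqrt_le_mono) (simp add: field_simps)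

lemma sigma_pos: "p \<in> K \<Longrightarrow> \<sigma> p > 0"
  using mu by (intro less_le_trans[OF _ sigma_ge]) auto

lemma sigma_le: "p \<in> K \<Longrightarrow> \<sigma> p \<le> sqrt \<mu>"
  unfolding \<sigma>_def by (intro real_sqrt_le_mono) simp

lemma U_sphere: assumes "p \<in> K" "q \<in> S" shows "U p q \<bullet> U p q = \<mu>"
proof -
  have "U p q \<bullet> U p q = p \<bullet> p + (\<sigma> p)\<^sup>2 * (q \<bullet> q) + 2 * \<sigma> p * (p \<bullet> q)"
    unfolding U_def by (simp add: inner_add_left inner_add_right power2_eq_square inner_commute)
  then show ?thesis using orth[OF KD(1) SD(1)] SD(2) sigma_sq assms by simp
qed

lemma U_norm: assumes "p \<in> K" "q \<in> S" shows "norm (U p q) = sqrt \<mu>"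
  using U_sphere[OF assms] by (simp add: norm_eq_sqrt_inner)

lemma U_quad: assumes "p \<in> K" "q \<in> S"
  shows "U p q \<bullet> L (U p q) = p \<bullet> L p + (\<mu> - p \<bullet> p) * (q \<bullet> L q)"
proof -
  have 1: "p \<bullet> L q = 0" using Lorth KD(1) SD(1) assms by blast
  then have 2: "q \<bullet> L p = 0" using sym[of q p] by (simp add: inner_commute)
  show ?thesis unfolding sigma_sq[OF assms(1), symmetric] using 1 2
    unfolding U_def
    by (simp add: L.add L.scaleR inner_add_left inner_add_right power2_eq_square)
qed

lemma E_U: assumes "p \<in> K" "q \<in> S"
  shows "E (U p q) = (p \<bullet> L p + (\<mu> - p \<bullet> p) * (q \<bullet> L q)) / 2 - \<Gamma> (U p q)"
  unfolding E_def U_quad[OF assms] ..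

lemma zero_K: "0 \<in> K" using mu subspace_0[OF P] by (simp add: K_def)

lemma compact_K: "compact K"
proof -
  have "K = P \<inter> cball 0 (sqrt (\<mu> / 2))"
    using mu by (auto simp: K_def norm_eq_sqrt_inner real_sqrt_le_iff real_sqrt_le_mono)
  then show ?thesis using cP by simp
qed

lemma compact_S: "compact S"
proof -
  have "S = Q \<inter> sphere 0 1" by (auto simp: S_def)
  then show ?thesis using cQ by simp
qed

lemma q0_S: "q0 \<in> S" using q0 by (simp add: S_def)

lemma midpoint_K: assumes "p1 \<in> K" "p2 \<in> K" shows "(p1 + p2) /\<^sub>R 2 \<in> K"
proof -
  have "((p1 + p2) /\<^sub>R 2) \<bullet> ((p1 + p2) /\<^sub>R 2) = (p1 \<bullet> p1 + p2 \<bullet> p2) / 2 - ((p1 - p2) \<bullet> (p1 - p2)) / 4"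
    by (simp add: inner_add_left inner_add_right inner_diff_left inner_diff_right inner_commute field_simps)
  also have "\<dots> \<le> \<mu> / 2" using KD(2)[OF assms(1)] KD(2)[OF assms(2)] inner_ge_zero[of "p1 - p2"] by argo
  finally show ?thesis using P KD(1) assms unfolding K_def by (simp add: subspace_add subspace_scale)
qed

text \<open>
  Strict concavity in \<open>p\<close>, in quantitative midpoint form. The quadratic part contributes at least
  \<open>(b - \<alpha>) / 8\<close> times the squared distance, and \<open>- \<Gamma>\<close> is concave. The point \<open>U m q\<close> differs from the midpoint of
  \<open>U p1 q\<close> and \<open>U p2 q\<close> by a multiple \<open>\<delta>\<close> of \<open>q\<close>, since \<open>\<sigma>\<close> is not affine; as \<open>\<delta>\<close> is quadratic in the
  distance, the size of the gap makes its cost at most half of the gain.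
\<close>

lemma E_midpoint: assumes p: "p1 \<in> K" "p2 \<in> K" and q: "q \<in> S"
  shows "E (U ((p1 + p2) /\<^sub>R 2) q) \<ge> (E (U p1 q) + E (U p2 q)) / 2 + (b - \<alpha>) / 16 * ((p1 - p2) \<bullet> (p1 - p2))"
proof -
  define m where "m = (p1 + p2) /\<^sub>R 2"
  define h where "h = p1 - p2"
  define sb where "sb = (\<sigma> p1 + \<sigma> p2) / 2"
  define \<delta> where "\<delta> = \<sigma> m - sb"
  define \<rho> where "\<rho> = q \<bullet> L q"
  have mK: "m \<in> K" unfolding m_def using p by (rule midpoint_K)
  have mm: "m \<bullet> m = (p1 \<bullet> p1 + p2 \<bullet> p2) / 2 - (h \<bullet> h) / 4"
    unfolding m_def h_def
    by (simp add: inner_add_left inner_add_right inner_diff_left inner_diff_right inner_commute field_simps)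
  have mLm: "m \<bullet> L m = (p1 \<bullet> L p1 + p2 \<bullet> L p2) / 2 - (h \<bullet> L h) / 4"
    unfolding m_def h_def using sym[of p1 p2]
    by (simp add: L.add L.diff L.scaleR inner_add_left inner_add_right inner_diff_left inner_diff_right inner_commute field_simps)
  have hP: "h \<in> P" unfolding h_def using P KD(1) p by (simp add: subspace_diff)
  have "(\<rho> - \<alpha>) * (h \<bullet> h) \<ge> (b - \<alpha>) * (h \<bullet> h)"
    using LQ[OF SD(1)[OF q]] SD(2)[OF q] by (intro mult_right_mono) (auto simp: \<rho>_def)
  then have quad: "\<rho> * (h \<bullet> h) - h \<bullet> L h \<ge> (b - \<alpha>) * (h \<bullet> h)"
    using LP[OF hP] by (simp add: algebra_simps)
  have s2: "sqrt (2 * \<mu>) = 2 * sqrt (\<mu> / 2)"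
    using mu by (simp add: real_sqrt_mult real_sqrt_divide field_simps)
  have sum_ge: "\<sigma> p1 + \<sigma> p2 \<ge> sqrt (2 * \<mu>)" and sm_ge: "\<sigma> m + sb \<ge> sqrt (2 * \<mu>)"
    using sigma_ge[OF p(1)] sigma_ge[OF p(2)] sigma_ge[OF mK] unfolding s2 sb_def by argo+
  have "((\<sigma> p1 - \<sigma> p2) * (\<sigma> p1 + \<sigma> p2))\<^sup>2 = (h \<bullet> (p1 + p2))\<^sup>2"
  proof -
    have "(\<sigma> p1 - \<sigma> p2) * (\<sigma> p1 + \<sigma> p2) = (\<sigma> p1)\<^sup>2 - (\<sigma> p2)\<^sup>2"
      by (simp add: algebra_simps power2_eq_square)
    also have "\<dots> = - (h \<bullet> (p1 + p2))"
      unfolding sigma_sq[OF p(1)] sigma_sq[OF p(2)] h_def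
      by (simp add: inner_add_left inner_add_right inner_diff_left inner_diff_right inner_commute)
    finally show ?thesis by simp
  qed
  also have "\<dots> \<le> (h \<bullet> h) * ((p1 + p2) \<bullet> (p1 + p2))" by (rule Cauchy_Schwarz_ineq)
  also have "\<dots> \<le> (h \<bullet> h) * (2 * \<mu>)"
  proof (intro mult_left_mono)
    have "(p1 + p2) \<bullet> (p1 + p2) + (p1 - p2) \<bullet> (p1 - p2) = 2 * (p1 \<bullet> p1) + 2 * (p2 \<bullet> p2)"
      by (simp add: inner_add_left inner_add_right inner_diff_left inner_diff_right inner_commute)
    then show "(p1 + p2) \<bullet> (p1 + p2) \<le> 2 * \<mu>"
      using KD(2)[OF p(1)] KD(2)[OF p(2)] inner_ge_zero[of "p1 - p2"] by linarith
  qed auto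
  finally have "(\<sigma> p1 - \<sigma> p2)\<^sup>2 * (\<sigma> p1 + \<sigma> p2)\<^sup>2 \<le> (h \<bullet> h) * (2 * \<mu>)"
    by (simp add: power_mult_distrib)
  moreover have "(\<sigma> p1 - \<sigma> p2)\<^sup>2 * (2 * \<mu>) \<le> (\<sigma> p1 - \<sigma> p2)\<^sup>2 * (\<sigma> p1 + \<sigma> p2)\<^sup>2"
  proof (intro mult_left_mono)
    have "(sqrt (2 * \<mu>))\<^sup>2 \<le> (\<sigma> p1 + \<sigma> p2)\<^sup>2" using sum_ge mu by (intro power_mono) auto
    then show "2 * \<mu> \<le> (\<sigma> p1 + \<sigma> p2)\<^sup>2" using mu by simp
  qed auto
  ultimately have ds: "(\<sigma> p1 - \<sigma> p2)\<^sup>2 \<le> h \<bullet> h"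
    using mu mult_right_le_imp_le[of "(\<sigma> p1 - \<sigma> p2)\<^sup>2" "2 * \<mu>" "h \<bullet> h"] by linarith
  have "\<delta> * (\<sigma> m + sb) = (\<sigma> m)\<^sup>2 - sb\<^sup>2" unfolding \<delta>_def by (simp add: algebra_simps power2_eq_square)
  also have "\<dots> = (\<sigma> p1 - \<sigma> p2)\<^sup>2 / 4 + (h \<bullet> h) / 4"
  proof -
    have "(\<sigma> m)\<^sup>2 = ((\<sigma> p1)\<^sup>2 + (\<sigma> p2)\<^sup>2) / 2 + (h \<bullet> h) / 4"
      unfolding sigma_sq[OF mK] sigma_sq[OF p(1)] sigma_sq[OF p(2)] mm by (simp add: field_simps)
    then show ?thesis unfolding sb_def by (simp add: power2_eq_square field_simps)
  qed
  finally have d: "\<delta> * (\<sigma> m + sb) = (\<sigma> p1 - \<sigma> p2)\<^sup>2 / 4 + (h \<bullet> h) / 4" .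
  have sp: "sqrt (2 * \<mu>) > 0" using mu by simp
  have d0: "0 \<le> \<delta>"
  proof (rule ccontr)
    assume "\<not> 0 \<le> \<delta>"
    then have "\<delta> * (\<sigma> m + sb) < 0" using sm_ge sp by (intro mult_neg_pos) linarith+
    moreover have "0 \<le> (\<sigma> p1 - \<sigma> p2)\<^sup>2 / 4 + (h \<bullet> h) / 4" by simp
    ultimately show False using d by linarith
  qed
  have "\<delta> * sqrt (2 * \<mu>) \<le> \<delta> * (\<sigma> m + sb)" using d0 sm_ge by (intro mult_left_mono)
  then have d1: "\<delta> * sqrt (2 * \<mu>) \<le> (h \<bullet> h) / 2" using d ds by linarith
  have "sqrt \<mu> \<le> sqrt (2 * \<mu>)" using mu by simp
  then have "\<delta> * sqrt \<mu> \<le> \<delta> * sqrt (2 * \<mu>)" using d0 by (intro mult_left_mono)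
  then have d2: "\<delta> * sqrt \<mu> \<le> (h \<bullet> h) / 2" using d1 by linarith
  have "\<beta> * \<delta> \<le> (b - \<alpha>) / 8 * sqrt \<mu> * \<delta>" using beta_le d0 by (intro mult_right_mono)
  also have "\<dots> = (b - \<alpha>) / 8 * (\<delta> * sqrt \<mu>)" by simp
  also have "\<dots> \<le> (b - \<alpha>) / 8 * ((h \<bullet> h) / 2)" using d2 gap_pos by (intro mult_left_mono) auto
  finally have bd: "\<beta> * \<delta> \<le> (b - \<alpha>) / 16 * (h \<bullet> h)" by simp
  have Um: "U m q = (U p1 q + U p2 q) /\<^sub>R 2 + \<delta> *\<^sub>R q"
  proof -
    have "(U p1 q + U p2 q) /\<^sub>R 2 = m + sb *\<^sub>R q"
      by (simp add: U_def m_def sb_def scaleR_add_right scaleR_add_left add_divide_distrib)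
    then show ?thesis by (simp add: U_def \<delta>_def scaleR_diff_left)
  qed
  have "\<Gamma> (U m q) \<le> \<Gamma> ((U p1 q + U p2 q) /\<^sub>R 2) + \<beta> * \<delta>"
    using Gamma_lip[of "U m q" "(U p1 q + U p2 q) /\<^sub>R 2"] d0 q unfolding Um S_def by simp
  moreover have "\<Gamma> ((U p1 q + U p2 q) /\<^sub>R 2) \<le> (\<Gamma> (U p1 q) + \<Gamma> (U p2 q)) / 2"
  proof -
    let ?c = "(U p1 q + U p2 q) /\<^sub>R 2"
    have "(U p1 q - ?c) + (U p2 q - ?c) = 0" 
      using scaleR_half_double[of "U p1 q + U p2 q"] by (simp add: scaleR_add_right algebra_simps)
    then have "\<gamma> ?c \<bullet> (U p1 q - ?c) + \<gamma> ?c \<bullet> (U p2 q - ?c) = 0"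
      by (metis inner_add_right inner_zero_right)
    then show ?thesis using conv[of ?c "U p1 q"] conv[of ?c "U p2 q"] by argo
  qed
  ultimately have G: "\<Gamma> (U m q) \<le> (\<Gamma> (U p1 q) + \<Gamma> (U p2 q)) / 2 + (b - \<alpha>) / 16 * (h \<bullet> h)"
    using bd by linarith
  have "(m \<bullet> L m + (\<mu> - m \<bullet> m) * \<rho>) / 2 =
     ((p1 \<bullet> L p1 + (\<mu> - p1 \<bullet> p1) * \<rho>) / 2 + (p2 \<bullet> L p2 + (\<mu> - p2 \<bullet> p2) * \<rho>) / 2) / 2 + (\<rho> * (h \<bullet> h) - h \<bullet> L h) / 8"
    unfolding mm mLm by (simp add: field_simps)
  then show ?thesis
  proof -
    define X where "X = (b - \<alpha>) * (h \<bullet> h)"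
    define A where "A p = (p \<bullet> L p + (\<mu> - p \<bullet> p) * \<rho>) / 2" for p
    have "A m = (A p1 + A p2) / 2 + (\<rho> * (h \<bullet> h) - h \<bullet> L h) / 8"
      using \<open>(m \<bullet> L m + (\<mu> - m \<bullet> m) * \<rho>) / 2 = _\<close> unfolding A_def .
    moreover have "E (U p q) = A p - \<Gamma> (U p q)" if "p \<in> K" for p
      unfolding E_U[OF that q] A_def \<rho>_def ..
    moreover have "\<Gamma> (U m q) \<le> (\<Gamma> (U p1 q) + \<Gamma> (U p2 q)) / 2 + X / 16"
      using G by (simp add: X_def)
    moreover have "X \<le> \<rho> * (h \<bullet> h) - h \<bullet> L h" using quad by (simp add: X_def)
    ultimately have "E (U m q) \<ge> (E (U p1 q) + E (U p2 q)) / 2 + X / 16"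
      using mK p by (simp add: add_divide_distrib diff_divide_distrib)
    then show ?thesis by (simp add: X_def m_def h_def)
  qed
qed

definition "maximiser (q::'a) = (SOME p. p \<in> K \<and> (\<forall>p'\<in>K. E (U p' q) \<le> E (U p q)))"

lemma maximiser: "maximiser q \<in> K" "p \<in> K \<Longrightarrow> E (U p q) \<le> E (U (maximiser q) q)"
proof -
  have "continuous_on K (\<lambda>p. E (U p q))"
    using continuous_on_compose2[OF cont_E cont_U1] by blast
  then have "\<exists>p\<in>K. \<forall>p'\<in>K. E (U p' q) \<le> E (U p q)"
    using continuous_attains_sup compact_K zero_K by blast
  then have "\<exists>p. p \<in> K \<and> (\<forall>p'\<in>K. E (U p' q) \<le> E (U p q))" by blast
  from someI_ex[OF this] have "maximiser q \<in> K \<and> (\<forall>p'\<in>K. E (U p' q) \<le> E (U (maximiser q) q))"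
    unfolding maximiser_def .
  then show "maximiser q \<in> K" "p \<in> K \<Longrightarrow> E (U p q) \<le> E (U (maximiser q) q)" by auto
qed

text \<open>
  A point that is almost optimal is close to the maximiser. This yields uniqueness of the maximiser and
  its continuous dependence on \<open>q\<close>.
\<close>

lemma maximiser_stable: assumes "p \<in> K" "q \<in> S"
  shows "E (U p q) \<le> E (U (maximiser q) q) - (b - \<alpha>) / 8 * ((maximiser q - p) \<bullet> (maximiser q - p))"
proof -
  define X where "X = (b - \<alpha>) / 16 * ((maximiser q - p) \<bullet> (maximiser q - p))"
  have "(E (U (maximiser q) q) + E (U p q)) / 2 + X \<le> E (U (maximiser q) q)"
    using E_midpoint[OF maximiser(1) assms(1) assms(2), of q] maximiser(2)[OF midpoint_K[OF maximiser(1) assms(1), of q], of q]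
    unfolding X_def by linarith
  then have "E (U p q) \<le> E (U (maximiser q) q) - 2 * X" by (simp add: add_divide_distrib)
  then show ?thesis by (simp add: X_def)
qed

text \<open>
  Moving from \<open>0\<close> to \<open>p\<close> loses at least \<open>(b - \<alpha>) / 2\<close> times \<open>p \<bullet> p\<close> in the quadratic part and gains at most a multiple of \<open>\<beta> * norm p\<close>,
  so the maximiser is small and the constraint defining \<open>K\<close> is not active.
\<close>

lemma maximiser_interior: assumes "q \<in> S" shows "maximiser q \<bullet> maximiser q < \<mu> / 2"
proof -
  let ?p = "maximiser q"
  define R where "R = b - \<alpha>"
  have s0: "\<sigma> 0 = sqrt \<mu>" by (simp add: \<sigma>_def)
  have ps: "?p \<bullet> q = 0" using orth KD(1) maximiser(1) SD(1) assms by blast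
  have "(norm (U ?p q - U 0 q))\<^sup>2 = ?p \<bullet> ?p + (\<sigma> ?p - sqrt \<mu>)\<^sup>2"
    unfolding U_def s0 power2_norm_eq_inner using ps SD(2)[OF assms]
    by (simp add: scaleR_diff_left[symmetric] add_diff_eq[symmetric] inner_add_left inner_add_right inner_commute power2_eq_square)
  also have "(\<sigma> ?p - sqrt \<mu>)\<^sup>2 \<le> ?p \<bullet> ?p"
  proof -
    have "(\<sigma> ?p - sqrt \<mu>)\<^sup>2 = (\<sigma> ?p)\<^sup>2 + (sqrt \<mu>)\<^sup>2 - 2 * \<sigma> ?p * sqrt \<mu>" by (simp add: power2_diff)
    also have "\<dots> \<le> (\<sigma> ?p)\<^sup>2 + (sqrt \<mu>)\<^sup>2 - 2 * \<sigma> ?p * \<sigma> ?p"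
      using sigma_le[OF maximiser(1)] sigma_pos[OF maximiser(1)] by (simp add: mult_left_mono)
    also have "\<dots> = ?p \<bullet> ?p" using sigma_sq[OF maximiser(1)] mu by (simp add: power2_eq_square algebra_simps)
    finally show ?thesis .
  qed
  finally have n2: "(norm (U ?p q - U 0 q))\<^sup>2 \<le> 2 * (?p \<bullet> ?p)" by simp
  have nn: "norm (U ?p q - U 0 q) \<le> 2 * norm ?p"
  proof (rule power2_le_imp_le)
    show "(norm (U ?p q - U 0 q))\<^sup>2 \<le> (2 * norm ?p)\<^sup>2"
    proof -
      have "2 * (?p \<bullet> ?p) \<le> 2\<^sup>2 * (?p \<bullet> ?p)" by simp
      then show ?thesis using n2 unfolding power_mult_distrib power2_norm_eq_inner by (rule order_trans[rotated])
    qed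
  qed auto
  have "E (U 0 q) \<le> E (U ?p q)" using maximiser(2)[OF zero_K] .
  moreover have "\<alpha> * (?p \<bullet> ?p) \<ge> ?p \<bullet> L ?p" using LP KD(1) maximiser(1) by blast
  moreover have "(q \<bullet> L q) * (?p \<bullet> ?p) \<ge> b * (?p \<bullet> ?p)"
    using LQ[OF SD(1)[OF assms]] SD(2)[OF assms] by (intro mult_right_mono) auto
  moreover have "\<Gamma> (U 0 q) - \<Gamma> (U ?p q) \<le> \<beta> * norm (U ?p q - U 0 q)"
    using Gamma_lip[of "U 0 q" "U ?p q"] by (simp add: norm_minus_commute)
  moreover have "\<beta> * norm (U ?p q - U 0 q) \<le> \<beta> * (2 * norm ?p)"
    using nn beta_nonneg by (intro mult_left_mono)
  ultimately have "R * (?p \<bullet> ?p) / 2 \<le> \<beta> * (2 * norm ?p)"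
    unfolding E_U[OF maximiser(1) assms] E_U[OF zero_K assms] R_def by (simp add: algebra_simps)
  also have "\<dots> \<le> R / 8 * sqrt \<mu> * (2 * norm ?p)"
    using beta_le unfolding R_def by (intro mult_right_mono) auto
  finally have "R * ((norm ?p)\<^sup>2 / 2) \<le> R * (sqrt \<mu> / 4 * norm ?p)"
    by (simp add: power2_norm_eq_inner algebra_simps)
  then have "(norm ?p)\<^sup>2 / 2 \<le> sqrt \<mu> / 4 * norm ?p"
    using gap_pos unfolding R_def by (simp only: mult_le_cancel_left_pos)
  then have "norm ?p * norm ?p \<le> sqrt \<mu> / 2 * norm ?p" by (simp add: power2_eq_square)
  then have "norm ?p \<le> sqrt \<mu> / 2" using mu mult_right_le_imp_le[of "norm ?p" "norm ?p" "sqrt \<mu> / 2"]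
    by (cases "norm ?p = 0") auto
  then have "(norm ?p)\<^sup>2 \<le> (sqrt \<mu> / 2)\<^sup>2" by (intro power_mono) auto
  also have "\<dots> = \<mu> / 4" using mu by (simp add: power_divide)
  finally show ?thesis using mu by (simp add: power2_norm_eq_inner)
qed

definition "J q = E (U (maximiser q) q)"

text \<open>
  \<open>J\<close> is a supremum of continuous functions of \<open>q\<close>, hence lower semicontinuous, and \<open>S\<close> is compact.
\<close>

lemma J_min: "\<exists>q\<in>S. \<forall>q'\<in>S. J q \<le> J q'"
proof -
  have c: "continuous_on S (\<lambda>q. E (U p q))" for p
    using continuous_on_compose2[OF cont_E cont_U2] by blast
  obtain q1 where q1: "q1 \<in> S" "\<And>q. q \<in> S \<Longrightarrow> E (U 0 q1) \<le> E (U 0 q)"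
    using continuous_attains_inf[OF compact_S _ c[of 0]] q0_S by auto
  have bdd: "bdd_below (J ` S)"
    using q1(2) maximiser(2)[OF zero_K] unfolding J_def by (intro bdd_belowI2[of _ "E (U 0 q1)"]) (meson order_trans)
  have "\<exists>q\<in>S. J q < Inf (J ` S) + 1 / Suc n" for n :: nat
    using cInf_lessD[of "J ` S" "Inf (J ` S) + 1 / Suc n"] q0_S by auto
  then obtain s where s: "\<And>n. s n \<in> S" "\<And>n. J (s n) < Inf (J ` S) + 1 / Suc n" by metis
  obtain q r where q: "q \<in> S" and r: "strict_mono (r :: nat \<Rightarrow> nat)" and lim: "(s \<circ> r) \<longlonglongrightarrow> q"
    using compact_S s(1) unfolding compact_def by metis
  have "J q \<le> Inf (J ` S) + 0"
  proof (rule tendsto_le[OF sequentially_bot])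
    have "(\<lambda>n. 1 / real (Suc n)) \<longlonglongrightarrow> 0" using LIMSEQ_inverse_real_of_nat by (simp add: inverse_eq_divide)
    from LIMSEQ_subseq_LIMSEQ[OF this r]
    show "(\<lambda>n. Inf (J ` S) + 1 / Suc (r n)) \<longlonglongrightarrow> Inf (J ` S) + 0"
      by (intro tendsto_intros) (simp add: o_def)
    show "(\<lambda>n. E (U (maximiser q) (s (r n)))) \<longlonglongrightarrow> J q"
      unfolding J_def using continuous_on_tendsto_compose[OF c lim q] s(1) by (simp add: o_def)
    show "\<forall>\<^sub>F n in sequentially. E (U (maximiser q) (s (r n))) \<le> Inf (J ` S) + 1 / Suc (r n)"
    proof (intro always_eventually allI)
      fix n
      have "E (U (maximiser q) (s (r n))) \<le> J (s (r n))" unfolding J_def by (intro maximiser)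
      then show "E (U (maximiser q) (s (r n))) \<le> Inf (J ` S) + 1 / Suc (r n)" using s(2)[of "r n"] by linarith
    qed
  qed
  then show ?thesis using q bdd by (intro bexI[of _ q] ballI) (auto intro: order_trans cInf_lower)
qed

lemma E_diff_le: assumes "norm x = sqrt \<mu>" "norm y = sqrt \<mu>"
  shows "E x - E y \<le> (sqrt \<mu> * onorm L + \<beta>) * norm (x - y)"
proof -
  have "x \<bullet> L x / 2 - y \<bullet> L y / 2 = (x + y) \<bullet> L (x - y) / 2"
    using sym[of x y] by (simp add: L.diff inner_add_left inner_diff_right inner_commute algebra_simps)
  also have "(x + y) \<bullet> L (x - y) \<le> norm (x + y) * norm (L (x - y))" by (rule norm_cauchy_schwarz)
  also have "\<dots> \<le> (2 * sqrt \<mu>) * (onorm L * norm (x - y))"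
    using norm_triangle_ineq[of x y] assms mu by (intro mult_mono onorm L) auto
  finally show ?thesis using Gamma_lip[of y x] by (simp add: E_def algebra_simps norm_minus_commute)
qed

end

context saddle begin

text \<open>
  The critical point is \<open>U p q\<close> for a minimiser \<open>q\<close> of \<open>J\<close> and the maximiser \<open>p\<close> that belongs to it. All bounds
  depend on the upper end \<open>b\<close> of the gap, on \<open>\<beta>\<close> and on \<open>\<mu>\<close>, but not on the dimensions of \<open>P\<close> and \<open>Q\<close>.
\<close>

theorem saddle_point:
  "\<exists>u \<nu>. u \<in> {p + q | p q. p \<in> P \<and> q \<in> Q} \<and> u \<bullet> u = \<mu> \<and>
     (\<forall>h \<in> P \<union> Q. (L u - \<gamma> u) \<bullet> h = \<nu> * (u \<bullet> h)) \<and>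
     b - 2 * \<beta> / sqrt \<mu> \<le> \<nu> \<and> \<nu> \<le> b + 5 * \<beta> / sqrt \<mu> \<and>
     u \<bullet> L u \<le> \<mu> * b + 4 * \<beta> * sqrt \<mu>"
proof -
  obtain q where q: "q \<in> S" and qmin: "\<And>q'. q' \<in> S \<Longrightarrow> J q \<le> J q'" using J_min by blast
  define p where "p = maximiser q"
  define u where "u = U p q"
  define s where "s = \<sigma> p"
  define \<nu> where "\<nu> = ((L u - \<gamma> u) \<bullet> q) / s"
  have pK: "p \<in> K" and pP: "p \<in> P" unfolding p_def using maximiser(1) KD(1) by auto
  have s0: "s > 0" unfolding s_def using sigma_pos pK by blast
  have qq: "q \<bullet> q = 1" and qQ: "q \<in> Q" using SD q by auto
  have pq: "p \<bullet> q = 0" using orth pP qQ by blast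
  \<comment> \<open>First variation in the directions of \<open>P\<close>: the curve \<open>U (p + t h) q\<close> stays in the interior of \<open>K\<close>.\<close>
  have dirP: "(L u - \<gamma> u) \<bullet> (h - ((p \<bullet> h) / s) *\<^sub>R q) \<le> 0" if h: "h \<in> P" for h
  proof -
    define x where "x t = U (p + t *\<^sub>R h) q" for t
    have "p \<bullet> p < \<mu>" using maximiser_interior[OF q] mu unfolding p_def by simp
    then have "((\<lambda>t. \<sigma> (p + t *\<^sub>R h)) has_real_derivative - (p \<bullet> h) / s) (at 0)"
      unfolding \<sigma>_def s_def
      by (auto intro!: derivative_eq_intros simp: inner_add_left inner_add_right inner_commute field_simps)
    then have "(x has_vector_derivative h - ((p \<bullet> h) / s) *\<^sub>R q) (at 0)"
      unfolding x_def U_def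
      by (auto intro!: derivative_eq_intros has_vector_derivative_add[THEN has_vector_derivative_eq_rhs] simp: has_real_derivative_iff_has_vector_derivative[symmetric])
    then have vd: "(x has_vector_derivative h - ((p \<bullet> h) / s) *\<^sub>R q) (at_right 0)"
      by (rule has_vector_derivative_at_within)
    have x0: "x 0 = u" by (simp add: x_def u_def)
    have xt: "(x \<longlongrightarrow> u) (at_right 0)"
      using has_vector_derivative_continuous[OF vd] x0 by (simp add: continuous_within)
    have c: "((\<lambda>t. (p + t *\<^sub>R h) \<bullet> (p + t *\<^sub>R h)) \<longlongrightarrow> (p + 0 *\<^sub>R h) \<bullet> (p + 0 *\<^sub>R h)) (at_right 0)"
      by (intro tendsto_intros)
    have "eventually (\<lambda>t. (p + t *\<^sub>R h) \<bullet> (p + t *\<^sub>R h) < \<mu> / 2) (at_right 0)"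
      using order_tendstoD(2)[OF c, of "\<mu> / 2"] maximiser_interior[OF q] by (simp add: p_def)
    then have ev: "eventually (\<lambda>t. E (x t) \<le> E u) (at_right 0)"
    proof eventually_elim
      case (elim t)
      then have "p + t *\<^sub>R h \<in> K" using pP h P by (simp add: K_def subspace_add subspace_scale)
      then show ?case using maximiser(2) unfolding x_def u_def p_def by blast
    qed
    have "((\<lambda>t. (x t - u) /\<^sub>R t) \<longlongrightarrow> h - ((p \<bullet> h) / s) *\<^sub>R q) (at_right 0)"
      using right_difference_quotient[OF vd] x0 by simp
    from directional_derivative_nonpos[OF L sym conv cont xt tendsto_const this] ev
    show ?thesis by (simp add: E_def)
  qed
  have eqP: "(L u - \<gamma> u) \<bullet> h = \<nu> * (p \<bullet> h)" if h: "h \<in> P" for h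
  proof -
    have "(L u - \<gamma> u) \<bullet> (h - ((p \<bullet> h) / s) *\<^sub>R q) = 0"
      using dirP[OF h] dirP[OF subspace_neg[OF P h]] by (simp add: inner_diff_right)
    then show ?thesis by (simp add: inner_diff_right \<nu>_def)
  qed
  \<comment> \<open>First variation in the directions of \<open>Q\<close>: rotate \<open>q\<close> towards \<open>h\<close> and let the maximiser follow.\<close>
  have dirQ: "(L u - \<gamma> u) \<bullet> h \<ge> 0" if h: "h \<in> Q" "h \<bullet> h = 1" "q \<bullet> h = 0" for h
  proof -
    define qt where "qt t = cos t *\<^sub>R q + sin t *\<^sub>R h" for t :: real
    define pt where "pt t = maximiser (qt t)" for t
    have qtS: "qt t \<in> S" for t
    proof -
      have "qt t \<bullet> qt t = (cos t)\<^sup>2 + (sin t)\<^sup>2"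
        unfolding qt_def using h qq
        by (simp add: inner_add_left inner_add_right inner_commute power2_eq_square)
      then have "norm (qt t) = 1" by (simp add: norm_eq_sqrt_inner)
      then show ?thesis using h(1) qQ Q by (simp add: S_def qt_def subspace_add subspace_scale)
    qed
    have ptK: "pt t \<in> K" for t unfolding pt_def by (rule maximiser(1))
    have qt0: "qt 0 = q" by (simp add: qt_def)
    have "(qt has_vector_derivative h) (at 0)"
      unfolding qt_def
      by (auto intro!: derivative_eq_intros has_vector_derivative_add[THEN has_vector_derivative_eq_rhs])
    then have vd: "(qt has_vector_derivative h) (at_right 0)"
      by (rule has_vector_derivative_at_within)
    have qlim: "(qt \<longlongrightarrow> q) (at_right 0)"
      using has_vector_derivative_continuous[OF vd] qt0 by (simp add: continuous_within)
    have dlim: "((\<lambda>t. (qt t - q) /\<^sub>R t) \<longlongrightarrow> h) (at_right 0)"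
      using right_difference_quotient[OF vd] qt0 by simp
    define C where "C = (sqrt \<mu> * onorm L + \<beta>) * sqrt \<mu>"
    have form_const: "C \<ge> 0" unfolding C_def using mu beta_nonneg onorm_pos_le[OF L] by simp
    \<comment> \<open>The maximiser depends continuously on \<open>q\<close>.\<close>
    have stab: "(b - \<alpha>) / 8 * ((p - pt t) \<bullet> (p - pt t)) \<le> C * norm (qt t - q)" for t
    proof -
      have "(b - \<alpha>) / 8 * ((p - pt t) \<bullet> (p - pt t)) \<le> J q - E (U (pt t) q)"
        using maximiser_stable[OF ptK q, of t] unfolding p_def J_def by simp
      also have "\<dots> \<le> E (U (pt t) (qt t)) - E (U (pt t) q)"
        using qmin[OF qtS, of t] unfolding J_def pt_def by simp
      also have "\<dots> \<le> (sqrt \<mu> * onorm L + \<beta>) * norm (U (pt t) (qt t) - U (pt t) q)"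
        by (intro E_diff_le U_norm ptK q qtS)
      also have "U (pt t) (qt t) - U (pt t) q = \<sigma> (pt t) *\<^sub>R (qt t - q)"
        by (simp add: U_def scaleR_diff_right)
      also have "norm \<dots> \<le> sqrt \<mu> * norm (qt t - q)"
        using sigma_pos[OF ptK, of t] sigma_le[OF ptK, of t] by (simp add: mult_right_mono)
      finally show ?thesis
        using mu beta_nonneg onorm_pos_le[OF L] by (simp add: C_def mult.assoc mult_left_mono)
    qed
    have "((\<lambda>t. norm (qt t - q)) \<longlongrightarrow> 0) (at_right 0)"
      using qlim by (simp add: LIM_zero tendsto_norm_zero)
    then have "((\<lambda>t. 8 / (b - \<alpha>) * (C * norm (qt t - q))) \<longlongrightarrow> 0) (at_right 0)"
      by (intro tendsto_mult_right_zero)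
    then have "((\<lambda>t. (p - pt t) \<bullet> (p - pt t)) \<longlongrightarrow> 0) (at_right 0)"
    proof (rule tendsto_sandwich[OF _ _ tendsto_const, rotated 2])
      show "\<forall>\<^sub>F t in at_right 0. (p - pt t) \<bullet> (p - pt t) \<le> 8 / (b - \<alpha>) * (C * norm (qt t - q))"
      proof (intro always_eventually allI)
        fix t
        define Z where "Z = (p - pt t) \<bullet> (p - pt t)"
        define W where "W = C * norm (qt t - q)"
        have "(b - \<alpha>) / 8 * Z \<le> W" unfolding Z_def W_def by (rule stab)
        then have "Z \<le> 8 / (b - \<alpha>) * W"
          using gap_pos by (simp add: pos_le_divide_eq mult.commute)
        then show "(p - pt t) \<bullet> (p - pt t) \<le> 8 / (b - \<alpha>) * (C * norm (qt t - q))"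
          unfolding Z_def W_def .
      qed
    qed auto
    then have "((\<lambda>t. sqrt ((p - pt t) \<bullet> (p - pt t))) \<longlongrightarrow> sqrt 0) (at_right 0)"
      by (rule tendsto_real_sqrt)
    then have "((\<lambda>t. norm (pt t - p)) \<longlongrightarrow> 0) (at_right 0)"
      by (simp add: norm_eq_sqrt_inner[symmetric] norm_minus_commute)
    then have plim: "(pt \<longlongrightarrow> p) (at_right 0)"
      using tendsto_norm_zero_iff LIM_zero_iff by blast
    have slim: "((\<lambda>t. \<sigma> (pt t)) \<longlongrightarrow> s) (at_right 0)"
      unfolding \<sigma>_def s_def by (intro tendsto_intros plim)
    have xl: "((\<lambda>t. U (pt t) q) \<longlongrightarrow> u) (at_right 0)"
      unfolding U_def u_def s_def[symmetric] by (intro tendsto_intros plim slim)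
    have yl: "((\<lambda>t. U (pt t) (qt t)) \<longlongrightarrow> u) (at_right 0)"
      unfolding U_def u_def s_def[symmetric] by (intro tendsto_intros plim slim qlim)
    have "((\<lambda>t. - (\<sigma> (pt t) *\<^sub>R ((qt t - q) /\<^sub>R t))) \<longlongrightarrow> - (s *\<^sub>R h)) (at_right 0)"
      by (intro tendsto_intros slim dlim)
    moreover have "- (\<sigma> (pt t) *\<^sub>R ((qt t - q) /\<^sub>R t)) = (U (pt t) q - U (pt t) (qt t)) /\<^sub>R t" for t
      by (simp add: U_def algebra_simps)
    ultimately have wl: "((\<lambda>t. (U (pt t) q - U (pt t) (qt t)) /\<^sub>R t) \<longlongrightarrow> - (s *\<^sub>R h)) (at_right 0)"
      by simp
    \<comment> \<open>With the moving maximiser in both points the comparison needs no derivative of \<open>J\<close>.\<close>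
    have "E (U (pt t) q) \<le> E (U (pt t) (qt t))" for t
    proof -
      have "E (U (pt t) q) \<le> J q" unfolding J_def using maximiser(2) ptK by blast
      also have "\<dots> \<le> E (U (pt t) (qt t))" using qmin[OF qtS, of t] unfolding J_def pt_def .
      finally show ?thesis .
    qed
    then have "(L u - \<gamma> u) \<bullet> - (s *\<^sub>R h) \<le> 0"
      using directional_derivative_nonpos[OF L sym conv cont xl yl wl] by (simp add: E_def)
    then show ?thesis using s0 by (simp add: zero_le_mult_iff)
  qed
  have dirQ0: "(L u - \<gamma> u) \<bullet> h = 0" if h: "h \<in> Q" "q \<bullet> h = 0" for h
  proof (cases "h = 0")
    case False
    define k where "k = h /\<^sub>R norm h"
    have k: "k \<in> Q" "k \<bullet> k = 1" "q \<bullet> k = 0" "h = norm h *\<^sub>R k"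
      using False h Q by (simp_all add: k_def subspace_scale power2_norm_eq_inner[symmetric] power2_eq_square)
    have "(L u - \<gamma> u) \<bullet> k \<ge> 0" "(L u - \<gamma> u) \<bullet> (- k) \<ge> 0"
      using dirQ[of k] dirQ[of "- k"] k subspace_neg[OF Q k(1)] by auto
    then have "(L u - \<gamma> u) \<bullet> k = 0" by simp
    then show ?thesis by (subst k(4)) simp
  qed simp
  have eqQ: "(L u - \<gamma> u) \<bullet> h = \<nu> * (s * (q \<bullet> h))" if h: "h \<in> Q" for h
  proof -
    have "(L u - \<gamma> u) \<bullet> (h - (q \<bullet> h) *\<^sub>R q) = 0"
      by (rule dirQ0) (use h qQ Q qq in \<open>auto simp: subspace_diff subspace_scale inner_diff_right\<close>)
    then have "(L u - \<gamma> u) \<bullet> h = (q \<bullet> h) * ((L u - \<gamma> u) \<bullet> q)" by (simp add: inner_diff_right)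
    then show ?thesis using s0 by (simp add: \<nu>_def)
  qed
  have u_eq: "u = p + s *\<^sub>R q" by (simp add: u_def U_def s_def)
  have uu: "u \<bullet> u = \<mu>" unfolding u_def by (rule U_sphere[OF pK q])
  have un: "norm u = sqrt \<mu>" unfolding u_def by (rule U_norm[OF pK q])
  have sm: "sqrt \<mu> > 0" using mu by simp
  \<comment> \<open>The equations in \<open>P\<close>, in \<open>Q\<close> and along \<open>q\<close> share the multiplier \<open>\<nu>\<close>, defined by the last one.\<close>
  have mult: "(L u - \<gamma> u) \<bullet> h = \<nu> * (u \<bullet> h)" if "h \<in> P \<union> Q" for h
  proof (cases "h \<in> P")
    case True
    then have "u \<bullet> h = p \<bullet> h"
      using orth[OF True qQ] by (simp add: u_eq inner_add_left inner_commute[of q])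
    then show ?thesis using eqP[OF True] by simp
  next
    case False
    then have h: "h \<in> Q" using that by simp
    then have "u \<bullet> h = s * (q \<bullet> h)"
      using orth[OF pP h] by (simp add: u_eq inner_add_left)
    then show ?thesis using eqQ[OF h] by simp
  qed
  have lower: "b - 2 * \<beta> / sqrt \<mu> \<le> \<nu>"
  proof -
    have "L u \<bullet> q = s * (q \<bullet> L q)"
    proof -
      have "L u \<bullet> q = u \<bullet> L q" by (rule sym[symmetric])
      then show ?thesis using Lorth[OF pP qQ] by (simp add: u_eq inner_add_left)
    qed
    moreover have "q \<bullet> L q \<ge> b" using LQ[OF qQ] qq by simp
    moreover have "\<gamma> u \<bullet> q \<le> \<beta>"
      using norm_cauchy_schwarz[of "\<gamma> u" q] bound[of u] qq by (simp add: norm_eq_sqrt_inner)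
    ultimately have nus: "\<nu> \<ge> b - \<beta> / s"
    proof -
      assume 1: "L u \<bullet> q = s * (q \<bullet> L q)" "b \<le> q \<bullet> L q" "\<gamma> u \<bullet> q \<le> \<beta>"
      have "\<nu> = q \<bullet> L q - (\<gamma> u \<bullet> q) / s"
        using 1(1) s0 unfolding \<nu>_def by (simp add: inner_diff_left diff_divide_distrib)
      moreover have "(\<gamma> u \<bullet> q) / s \<le> \<beta> / s" using 1(3) s0 by (simp add: divide_right_mono)
      ultimately show ?thesis using 1(2) by linarith
    qed
    have "\<beta> / s \<le> 2 * \<beta> / sqrt \<mu>"
    proof -
      have "sqrt \<mu> / 2 = sqrt (\<mu> / 4)" by (simp add: real_sqrt_divide)
      also have "\<dots> \<le> sqrt (\<mu> / 2)" using mu by (intro real_sqrt_le_mono) simp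
      also have "\<dots> \<le> s" unfolding s_def by (rule sigma_ge[OF pK])
      finally have "\<beta> * sqrt \<mu> \<le> \<beta> * (2 * s)" using beta_nonneg by (intro mult_left_mono) auto
      then show ?thesis using s0 sm by (simp add: field_simps)
    qed
    then show ?thesis using nus by linarith
  qed
  have quad: "u \<bullet> L u \<le> \<mu> * b + 4 * \<beta> * sqrt \<mu>"
  proof -
    let ?p = "maximiser q0"
    have "?p \<bullet> L ?p \<le> b * (?p \<bullet> ?p)"
      using LP[OF KD(1)[OF maximiser(1)], of q0] mult_right_mono[of \<alpha> b "?p \<bullet> ?p"] gap_pos by simp
    then have "J q0 \<le> \<mu> * b / 2 - \<Gamma> (U ?p q0)"
      unfolding J_def E_U[OF maximiser(1) q0_S] q0(3) by (simp add: algebra_simps)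
    moreover have "J q = u \<bullet> L u / 2 - \<Gamma> u"
      unfolding J_def p_def[symmetric] u_def[symmetric] by (simp add: E_def)
    moreover have "\<Gamma> u - \<Gamma> (U ?p q0) \<le> \<beta> * (2 * sqrt \<mu>)"
    proof -
      have "norm (u - U ?p q0) \<le> 2 * sqrt \<mu>"
        using norm_triangle_ineq4[of u "U ?p q0"] un U_norm[OF maximiser(1) q0_S, of q0] by simp
      then show ?thesis using Gamma_lip[of u "U ?p q0"] beta_nonneg mult_left_mono[of "norm (u - U ?p q0)" "2 * sqrt \<mu>" \<beta>] by linarith
    qed
    ultimately show ?thesis using qmin[OF q0_S] by simp
  qed
  have upper: "\<nu> \<le> b + 5 * \<beta> / sqrt \<mu>"
  proof -
    have "u \<in> {p + q | p q. p \<in> P \<and> q \<in> Q}" unfolding u_eq using pP qQ Q subspace_scale by blast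
    have "(L u - \<gamma> u) \<bullet> u = \<nu> * \<mu>"
    proof -
      have "(L u - \<gamma> u) \<bullet> u = (L u - \<gamma> u) \<bullet> p + s * ((L u - \<gamma> u) \<bullet> q)"
        using arg_cong[OF u_eq, of "\<lambda>v. (L u - \<gamma> u) \<bullet> v"] by (simp only: inner_add_right inner_scaleR_right)
      also have "\<dots> = \<nu> * (u \<bullet> p) + s * (\<nu> * (u \<bullet> q))"
        using mult[of p] mult[of q] pP qQ by simp
      also have "\<dots> = \<nu> * (u \<bullet> (p + s *\<^sub>R q))" by (simp only: inner_add_right inner_scaleR_right) (simp only: distrib_left mult.left_commute)
      finally show ?thesis unfolding u_eq[symmetric] uu .
    qed
    moreover have "- (\<gamma> u \<bullet> u) \<le> \<beta> * sqrt \<mu>"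
    proof -
      have "- (\<gamma> u \<bullet> u) \<le> norm (\<gamma> u) * sqrt \<mu>"
        using norm_cauchy_schwarz[of "- \<gamma> u" u] un by simp
      also have "\<dots> \<le> \<beta> * sqrt \<mu>" using bound[of u] sm by (intro mult_right_mono) auto
      finally show ?thesis .
    qed
    ultimately have "\<nu> * \<mu> \<le> \<mu> * b + 5 * \<beta> * sqrt \<mu>"
      using quad inner_commute[of u "L u"] by (simp add: inner_diff_left algebra_simps)
    also have "\<dots> = (b + 5 * \<beta> / sqrt \<mu>) * \<mu>"
    proof -
      have "\<mu> / sqrt \<mu> = sqrt \<mu>" using mu real_div_sqrt by simp
      then have "5 * \<beta> * sqrt \<mu> = 5 * \<beta> / sqrt \<mu> * \<mu>" by (metis times_divide_eq_right times_divide_eq_left)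
      then show ?thesis by (simp only: distrib_right mult.commute[of \<mu> b])
    qed
    finally show ?thesis using mu by simp
  qed
  have "u \<in> {p + q | p q. p \<in> P \<and> q \<in> Q}" unfolding u_eq using pP qQ Q subspace_scale by blast
  then show ?thesis using uu mult lower upper quad by blast
qed

end


section \<open>The inner product space of finitely supported sequences\<close>

text \<open>
  The eigenvector expansions used below have finite but unbounded length. This type contains all of them at once,
  so that the saddle point theorem can be applied with every number of eigenvectors.
\<close>

typedef fin_seq = "{c :: nat \<Rightarrow> real. finite {i. c i \<noteq> 0}}"
  morphisms coord Abs_fin_seq
  by (rule exI[of _ "\<lambda>_. 0"]) simp

setup_lifting type_definition_fin_seq

lemma finite_support: "finite {i. coord c i \<noteq> 0}"
  using coord[of c] by simp

instantiation fin_seq :: real_vector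
begin

lift_definition zero_fin_seq :: fin_seq is "\<lambda>_. 0" by simp
lift_definition plus_fin_seq :: "fin_seq \<Rightarrow> fin_seq \<Rightarrow> fin_seq" is "\<lambda>c d i. c i + d i"
  subgoal for c d by (rule finite_subset[of _ "{i. c i \<noteq> 0} \<union> {i. d i \<noteq> 0}"]) auto
  done
lift_definition uminus_fin_seq :: "fin_seq \<Rightarrow> fin_seq" is "\<lambda>c i. - c i" by simp
lift_definition minus_fin_seq :: "fin_seq \<Rightarrow> fin_seq \<Rightarrow> fin_seq" is "\<lambda>c d i. c i - d i"
  subgoal for c d by (rule finite_subset[of _ "{i. c i \<noteq> 0} \<union> {i. d i \<noteq> 0}"]) auto
  done
lift_definition scaleR_fin_seq :: "real \<Rightarrow> fin_seq \<Rightarrow> fin_seq" is "\<lambda>r c i. r * c i"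
  by (rule finite_subset[of _ "{i. _ i \<noteq> 0}"]) auto

instance by standard (transfer; auto simp: algebra_simps)+

end

lemmas coord_simps [simp] = zero_fin_seq.rep_eq plus_fin_seq.rep_eq uminus_fin_seq.rep_eq
  minus_fin_seq.rep_eq scaleR_fin_seq.rep_eq

lemma fin_seq_eqI: "(\<And>i. coord c i = coord d i) \<Longrightarrow> c = d"
  by (metis coord_inject ext)

instantiation fin_seq :: real_inner
begin

definition inner_fin_seq :: "fin_seq \<Rightarrow> fin_seq \<Rightarrow> real" where
  "inner_fin_seq c d = (\<Sum>i | coord c i \<noteq> 0. coord c i * coord d i)"
definition norm_fin_seq :: "fin_seq \<Rightarrow> real" where "norm_fin_seq c = sqrt (inner c c)"
definition dist_fin_seq :: "fin_seq \<Rightarrow> fin_seq \<Rightarrow> real" where "dist_fin_seq c d = norm (c - d)"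
definition sgn_fin_seq :: "fin_seq \<Rightarrow> fin_seq" where "sgn_fin_seq c = c /\<^sub>R norm c"
definition uniformity_fin_seq :: "(fin_seq \<times> fin_seq) filter" where
  "uniformity_fin_seq = (INF e\<in>{0<..}. principal {(x, y). dist x y < e})"
definition open_fin_seq :: "fin_seq set \<Rightarrow> bool" where
  "open_fin_seq U \<longleftrightarrow> (\<forall>x\<in>U. eventually (\<lambda>(x', y). x' = x \<longrightarrow> y \<in> U) uniformity)"

lemma inner_fin_seq_eq:
  assumes "finite I" "\<And>i. i \<notin> I \<Longrightarrow> coord c i = 0 \<or> coord d i = 0"
  shows "inner c d = (\<Sum>i\<in>I. coord c i * coord d i)"
  unfolding inner_fin_seq_def
  using assms finite_support[of c] by (intro sum.mono_neutral_cong) auto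

instance
proof
  fix x y z :: fin_seq and r :: real
  let ?I = "{i. coord x i \<noteq> 0} \<union> {i. coord y i \<noteq> 0} \<union> {i. coord z i \<noteq> 0}"
  have I: "finite ?I" by (simp add: finite_support)
  have e: "inner a b = (\<Sum>i\<in>?I. coord a i * coord b i)"
    if "\<And>i. i \<notin> ?I \<Longrightarrow> coord a i = 0" for a b
    using that by (intro inner_fin_seq_eq[OF I]) blast
  show "inner x y = inner y x"
    by (subst (1 2) e) (auto simp: mult.commute)
  show "inner (x + y) z = inner x z + inner y z"
    by (subst (1 2 3) e) (auto simp: algebra_simps sum.distrib)
  show "inner (r *\<^sub>R x) y = r * inner x y"
    by (subst (1 2) e) (auto simp: sum_distrib_left algebra_simps)
  show "0 \<le> inner x x" unfolding inner_fin_seq_def by (intro sum_nonneg) simp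
  show "(inner x x = 0) = (x = 0)"
  proof
    assume "inner x x = 0"
    then have "\<forall>i\<in>{i. coord x i \<noteq> 0}. coord x i * coord x i = 0"
      unfolding inner_fin_seq_def
      by (subst (asm) sum_nonneg_eq_0_iff) (auto simp: finite_support)
    then show "x = 0" by (intro fin_seq_eqI) auto
  qed (simp add: inner_fin_seq_def)
qed (simp_all add: norm_fin_seq_def dist_fin_seq_def sgn_fin_seq_def uniformity_fin_seq_def open_fin_seq_def)

end

lift_definition unit :: "nat \<Rightarrow> fin_seq" is "\<lambda>k i. if i = k then 1 else 0" by simp

lemma coord_unit [simp]: "coord (unit k) i = (if i = k then 1 else 0)"
  by (simp add: unit.rep_eq)

lemma inner_unit [simp]: "inner c (unit k) = coord c k"
  by (subst inner_fin_seq_eq[of "{k}"]) auto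

lemma coord_sum [simp]: "coord (\<Sum>i\<in>I. f i) k = (\<Sum>i\<in>I. coord (f i) k)"
  by (induction I rule: infinite_finite_induct) auto

definition supported_on :: "nat set \<Rightarrow> fin_seq set" where
  "supported_on I = {c. \<forall>i. i \<notin> I \<longrightarrow> coord c i = 0}"

lemma subspace_supported_on: "subspace (supported_on I)"
  by (auto simp: subspace_def supported_on_def)

lemma closed_supported_on: "closed (supported_on I)"
proof -
  have "supported_on I = (\<Inter>i\<in>-I. {c. inner c (unit i) = 0})" by (auto simp: supported_on_def)
  also have "closed \<dots>" by (intro closed_INT ballI closed_Collect_eq continuous_intros)
  finally show ?thesis .
qed

text \<open>
  Adding one index enlarges the set to a closed subset of the sum of two compact sets.
\<close>

lemma compact_supported_on: assumes "finite I" shows "compact (supported_on I \<inter> cball 0 r)"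
  using assms
proof (induction I)
  case empty
  have "supported_on {} \<inter> cball 0 r = {0} \<inter> cball 0 r" by (auto simp: supported_on_def intro: fin_seq_eqI)
  then show ?case by (simp add: finite_imp_compact)
next
  case (insert k I)
  let ?T = "(\<lambda>t. t *\<^sub>R unit k) ` {- r..r}"
  have T: "compact ?T" by (intro compact_continuous_image continuous_intros) auto
  have "supported_on (insert k I) \<inter> cball 0 r \<subseteq> {x + y | x y. x \<in> supported_on I \<inter> cball 0 r \<and> y \<in> ?T}"
  proof
    fix c assume c: "c \<in> supported_on (insert k I) \<inter> cball 0 r"
    let ?y = "coord c k *\<^sub>R unit k"
    have n: "(norm (c - ?y))\<^sup>2 + (coord c k)\<^sup>2 = (norm c)\<^sup>2"
      unfolding power2_norm_eq_inner
      by (simp add: inner_diff_left inner_diff_right inner_commute[of "unit k"] power2_eq_square)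
    have "(norm (c - ?y))\<^sup>2 \<le> (norm c)\<^sup>2" unfolding n[symmetric] by simp
    then have "norm (c - ?y) \<le> r" using c power2_le_imp_le[of "norm (c - ?y)" "norm c"] by simp
    moreover have "c - ?y \<in> supported_on I" using c by (auto simp: supported_on_def)
    moreover have "\<bar>coord c k\<bar> \<le> r"
      using c Cauchy_Schwarz_ineq2[of c "unit k"] inner_unit[of "unit k" k] by (simp add: norm_eq_sqrt_inner)
    then have "?y \<in> ?T" by (intro imageI) auto
    ultimately have "c - ?y \<in> supported_on I \<inter> cball 0 r" "?y \<in> ?T" "c = (c - ?y) + ?y" by auto
    then show "c \<in> {x + y | x y. x \<in> supported_on I \<inter> cball 0 r \<and> y \<in> ?T}" by blast
  qed
  then have "supported_on (insert k I) \<inter> cball 0 r =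
      (supported_on (insert k I) \<inter> cball 0 r) \<inter> {x + y | x y. x \<in> supported_on I \<inter> cball 0 r \<and> y \<in> ?T}" by blast
  moreover have "compact \<dots>"
    using closed_supported_on by (intro closed_Int_compact compact_sums insert T closed_Int closed_cball)
  ultimately show ?case by simp
qed


section \<open>Semi-inner products\<close>

text \<open>
  Square integrable functions are handled through representatives, so vectors of length zero need not vanish.
\<close>

locale semi_inner =
  fixes H :: "'a::real_vector set" and ip :: "'a \<Rightarrow> 'a \<Rightarrow> real"
  assumes H: "subspace H"
    and ip_add: "\<And>x y z. x \<in> H \<Longrightarrow> y \<in> H \<Longrightarrow> z \<in> H \<Longrightarrow> ip (x + y) z = ip x z + ip y z"
    and ip_scale: "\<And>r x y. x \<in> H \<Longrightarrow> y \<in> H \<Longrightarrow> ip (r *\<^sub>R x) y = r * ip x y"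
    and ip_sym: "\<And>x y. x \<in> H \<Longrightarrow> y \<in> H \<Longrightarrow> ip x y = ip y x"
    and ip_nonneg: "\<And>x. x \<in> H \<Longrightarrow> 0 \<le> ip x x"
begin

definition "nrm x = sqrt (ip x x)"

lemma H_simps [simp, intro]: "0 \<in> H" "x \<in> H \<Longrightarrow> y \<in> H \<Longrightarrow> x + y \<in> H" "x \<in> H \<Longrightarrow> y \<in> H \<Longrightarrow> x - y \<in> H"
  "x \<in> H \<Longrightarrow> r *\<^sub>R x \<in> H" "x \<in> H \<Longrightarrow> - x \<in> H"
  using H by (simp_all add: subspace_0 subspace_add subspace_diff subspace_scale subspace_neg)

lemma H_sum [simp, intro]: "(\<And>i. i \<in> I \<Longrightarrow> f i \<in> H) \<Longrightarrow> (\<Sum>i\<in>I. f i) \<in> H"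
  using H by (simp add: subspace_sum)

lemma ip_diff: "x \<in> H \<Longrightarrow> y \<in> H \<Longrightarrow> z \<in> H \<Longrightarrow> ip (x - y) z = ip x z - ip y z"
  using ip_add[of "x - y" y z] by simp

lemma ip_add_right: "x \<in> H \<Longrightarrow> y \<in> H \<Longrightarrow> z \<in> H \<Longrightarrow> ip z (x + y) = ip z x + ip z y"
  using ip_add[of x y z] by (simp add: ip_sym[of z])

lemma ip_diff_right: "x \<in> H \<Longrightarrow> y \<in> H \<Longrightarrow> z \<in> H \<Longrightarrow> ip z (x - y) = ip z x - ip z y"
  using ip_diff[of x y z] by (simp add: ip_sym[of z])

lemma ip_scale_right: "x \<in> H \<Longrightarrow> y \<in> H \<Longrightarrow> ip x (r *\<^sub>R y) = r * ip x y"
  using ip_scale[of y x r] by (simp add: ip_sym[of x])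

lemma ip_zero [simp]: "x \<in> H \<Longrightarrow> ip 0 x = 0" "x \<in> H \<Longrightarrow> ip x 0 = 0"
  using ip_scale[of 0 x 0] ip_scale_right[of x 0 0] by auto

lemma ip_sum: "(\<And>i. i \<in> I \<Longrightarrow> f i \<in> H) \<Longrightarrow> y \<in> H \<Longrightarrow> ip (\<Sum>i\<in>I. f i) y = (\<Sum>i\<in>I. ip (f i) y)"
  by (induction I rule: infinite_finite_induct) (auto simp: ip_add)

lemma ip_sum_right: "(\<And>i. i \<in> I \<Longrightarrow> f i \<in> H) \<Longrightarrow> y \<in> H \<Longrightarrow> ip y (\<Sum>i\<in>I. f i) = (\<Sum>i\<in>I. ip y (f i))"
  by (induction I rule: infinite_finite_induct) (auto simp: ip_add_right)

lemmas ip_simps = ip_add ip_diff ip_scale ip_add_right ip_diff_right ip_scale_right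

lemma cauchy: assumes "x \<in> H" "y \<in> H" shows "(ip x y)\<^sup>2 \<le> ip x x * ip y y"
proof -
  have q: "0 \<le> ip x x + 2 * t * ip x y + t\<^sup>2 * ip y y" for t
  proof -
    have "0 \<le> ip (x + t *\<^sub>R y) (x + t *\<^sub>R y)" using assms by (intro ip_nonneg) auto
    also have "\<dots> = ip x x + 2 * t * ip x y + t\<^sup>2 * ip y y"
      using assms ip_sym[of y x] by (simp add: ip_simps power2_eq_square algebra_simps)
    finally show ?thesis .
  qed
  show ?thesis
  proof (cases "ip y y = 0")
    case True
    have "ip x y = 0"
    proof (rule ccontr)
      assume n: "ip x y \<noteq> 0"
      have "0 \<le> ip x x + 2 * (- (ip x x + 1) / (2 * ip x y)) * ip x y"
        using q[of "- (ip x x + 1) / (2 * ip x y)"] True by simp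
      then show False using n by (simp add: field_simps)
    qed
    then show ?thesis using True by simp
  next
    case False
    then have p: "ip y y > 0" using ip_nonneg[OF assms(2)] by simp
    have "0 \<le> ip x x + 2 * (- ip x y / ip y y) * ip x y + (- ip x y / ip y y)\<^sup>2 * ip y y" by (rule q)
    also have "\<dots> = ip x x - (ip x y)\<^sup>2 / ip y y"
      using p by (simp add: power2_eq_square field_simps)
    finally show ?thesis using p by (simp add: field_simps)
  qed
qed

lemma nrm_nonneg [simp]: "x \<in> H \<Longrightarrow> 0 \<le> nrm x"
  by (simp add: nrm_def ip_nonneg)

lemma nrm_sq: "x \<in> H \<Longrightarrow> (nrm x)\<^sup>2 = ip x x"
  by (simp add: nrm_def ip_nonneg)

lemma cauchy_abs: assumes "x \<in> H" "y \<in> H" shows "\<bar>ip x y\<bar> \<le> nrm x * nrm y"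
  using real_sqrt_le_mono[OF cauchy[OF assms]] by (simp add: nrm_def real_sqrt_mult)

lemma nrm_triangle: assumes "x \<in> H" "y \<in> H" shows "nrm (x + y) \<le> nrm x + nrm y"
proof (rule power2_le_imp_le)
  have "(nrm (x + y))\<^sup>2 = (nrm x)\<^sup>2 + (nrm y)\<^sup>2 + 2 * ip x y"
    using assms ip_sym[of y x] by (simp add: nrm_sq ip_simps)
  also have "\<dots> \<le> (nrm x)\<^sup>2 + (nrm y)\<^sup>2 + 2 * (nrm x * nrm y)"
    using cauchy_abs[OF assms] by linarith
  finally show "(nrm (x + y))\<^sup>2 \<le> (nrm x + nrm y)\<^sup>2" by (simp add: power2_sum)
qed (use assms in simp)

lemma nrm_scale: "x \<in> H \<Longrightarrow> nrm (r *\<^sub>R x) = \<bar>r\<bar> * nrm x"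
  by (simp add: nrm_def ip_simps real_sqrt_mult mult.assoc[symmetric])

lemma nrm_minus: "x \<in> H \<Longrightarrow> nrm (- x) = nrm x"
  using nrm_scale[of x "-1"] by simp

lemma nrm_minus_commute: "x \<in> H \<Longrightarrow> y \<in> H \<Longrightarrow> nrm (x - y) = nrm (y - x)"
  using nrm_minus[of "x - y"] by simp

lemma nrm_eq_0: "x \<in> H \<Longrightarrow> nrm x = 0 \<longleftrightarrow> ip x x = 0"
  by (simp add: nrm_def)

lemma null_ip: "x \<in> H \<Longrightarrow> y \<in> H \<Longrightarrow> ip x x = 0 \<Longrightarrow> ip x y = 0"
  using cauchy[of x y] by simp

lemma null_diff_ip: "x \<in> H \<Longrightarrow> x' \<in> H \<Longrightarrow> y \<in> H \<Longrightarrow> ip (x - x') (x - x') = 0 \<Longrightarrow> ip x y = ip x' y"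
  using null_ip[of "x - x'" y] by (simp add: ip_diff)

lemma tendsto_ip:
  assumes x: "\<And>k. x k \<in> H" and v: "v \<in> H" "w \<in> H" and lim: "(\<lambda>k. nrm (x k - v)) \<longlonglongrightarrow> 0"
  shows "(\<lambda>k. ip (x k) w) \<longlonglongrightarrow> ip v w"
proof -
  have "(\<lambda>k. nrm (x k - v) * nrm w) \<longlonglongrightarrow> 0" using tendsto_mult_left_zero[OF lim] .
  then have "(\<lambda>k. ip (x k) w - ip v w) \<longlonglongrightarrow> 0"
  proof (rule Lim_null_comparison[rotated])
    show "\<forall>\<^sub>F k in sequentially. norm (ip (x k) w - ip v w) \<le> nrm (x k - v) * nrm w"
      using cauchy_abs[of "x _ - v" w] x v by (simp add: ip_diff)
  qed
  then show ?thesis by (rule LIM_zero_cancel)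
qed

lemma tendsto_ip_self:
  assumes x: "\<And>k. x k \<in> H" and v: "v \<in> H" and lim: "(\<lambda>k. nrm (x k - v)) \<longlonglongrightarrow> 0"
  shows "(\<lambda>k. ip (x k) (x k)) \<longlonglongrightarrow> ip v v"
proof -
  have "(\<lambda>k. (nrm (x k - v))\<^sup>2 + 2 * ip (x k) v - ip v v) \<longlonglongrightarrow> 0\<^sup>2 + 2 * ip v v - ip v v"
    by (intro tendsto_intros lim tendsto_ip x v)
  moreover have "(nrm (x k - v))\<^sup>2 + 2 * ip (x k) v - ip v v = ip (x k) (x k)" for k
    using x[of k] v ip_sym[of v "x k"] by (simp add: nrm_sq ip_simps)
  ultimately show ?thesis by simp
qed

definition orthonormal :: "(nat \<Rightarrow> 'a) \<Rightarrow> nat \<Rightarrow> bool" where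
  "orthonormal \<phi> n \<longleftrightarrow> (\<forall>i<n. \<phi> i \<in> H) \<and> (\<forall>i<n. \<forall>j<n. ip (\<phi> i) (\<phi> j) = (if i = j then 1 else 0))"

definition proj :: "(nat \<Rightarrow> 'a) \<Rightarrow> nat \<Rightarrow> 'a \<Rightarrow> 'a" where
  "proj \<phi> n x = (\<Sum>i<n. ip x (\<phi> i) *\<^sub>R \<phi> i)"

lemma orthonormalD: "orthonormal \<phi> n \<Longrightarrow> i < n \<Longrightarrow> \<phi> i \<in> H"
  "orthonormal \<phi> n \<Longrightarrow> i < n \<Longrightarrow> j < n \<Longrightarrow> ip (\<phi> i) (\<phi> j) = (if i = j then 1 else 0)"
  by (auto simp: orthonormal_def)

lemma ip_combination: assumes "orthonormal \<phi> n" "j < n"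
  shows "ip (\<Sum>i<n. c i *\<^sub>R \<phi> i) (\<phi> j) = c j"
proof -
  have "ip (\<Sum>i<n. c i *\<^sub>R \<phi> i) (\<phi> j) = (\<Sum>i<n. c i * ip (\<phi> i) (\<phi> j))"
    using orthonormalD[OF assms(1)] assms(2) by (subst ip_sum) (auto simp: ip_scale)
  also have "\<dots> = (\<Sum>i<n. if i = j then c j else 0)"
    using orthonormalD[OF assms(1)] assms(2) by (intro sum.cong) auto
  finally show ?thesis using assms(2) by simp
qed

lemma ip_combination_self: assumes "orthonormal \<phi> n"
  shows "ip (\<Sum>i<n. c i *\<^sub>R \<phi> i) (\<Sum>i<n. c i *\<^sub>R \<phi> i) = (\<Sum>i<n. (c i)\<^sup>2)"
proof -
  let ?s = "\<Sum>i<n. c i *\<^sub>R \<phi> i"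
  have s: "?s \<in> H" using orthonormalD(1)[OF assms] by auto
  have "ip ?s ?s = (\<Sum>i<n. ip ?s (c i *\<^sub>R \<phi> i))"
    using s orthonormalD(1)[OF assms] by (intro ip_sum_right) auto
  also have "\<dots> = (\<Sum>i<n. (c i)\<^sup>2)"
    using orthonormalD(1)[OF assms]
    by (intro sum.cong refl) (simp add: ip_scale_right[OF s] ip_combination[OF assms] power2_eq_square)
  finally show ?thesis .
qed

lemma proj_H: "orthonormal \<phi> n \<Longrightarrow> proj \<phi> n x \<in> H"
  unfolding proj_def by (auto simp: orthonormal_def)

lemma proj_orth: assumes "orthonormal \<phi> n" "x \<in> H" "j < n"
  shows "ip (x - proj \<phi> n x) (\<phi> j) = 0"
  using ip_combination[OF assms(1,3), of "\<lambda>i. ip x (\<phi> i)"] proj_H[OF assms(1), of x] orthonormalD(1)[OF assms(1,3)] assms(2)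
  by (simp add: ip_diff proj_def[symmetric])

lemma ip_proj: assumes "orthonormal \<phi> n" "x \<in> H" "y \<in> H"
  shows "ip (proj \<phi> n x) y = (\<Sum>i<n. ip x (\<phi> i) * ip y (\<phi> i))"
  unfolding proj_def using orthonormalD(1)[OF assms(1)] assms(3)
  by (subst ip_sum) (auto simp: ip_scale ip_sym[of y] intro!: sum.cong)

lemma proj_residual: assumes "orthonormal \<phi> n" "x \<in> H"
  shows "ip (x - proj \<phi> n x) (x - proj \<phi> n x) = ip x x - (\<Sum>i<n. (ip x (\<phi> i))\<^sup>2)"
proof -
  have "ip (proj \<phi> n x) (proj \<phi> n x) = (\<Sum>i<n. (ip x (\<phi> i))\<^sup>2)"
    unfolding proj_def by (rule ip_combination_self[OF assms(1)])
  moreover have "ip (proj \<phi> n x) x = (\<Sum>i<n. (ip x (\<phi> i))\<^sup>2)"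
    using ip_proj[OF assms assms(2)] by (simp add: power2_eq_square)
  ultimately show ?thesis
    using ip_sym[OF assms(2) proj_H[OF assms(1), of x]] proj_H[OF assms(1), of x] assms(2) by (simp add: ip_simps)
qed

lemma bessel: assumes "orthonormal \<phi> n" "x \<in> H" shows "(\<Sum>i<n. (ip x (\<phi> i))\<^sup>2) \<le> ip x x"
  using ip_nonneg[of "x - proj \<phi> n x"] proj_residual[OF assms] proj_H[OF assms(1), of x] assms(2) by simp

lemma nrm_residual_le: assumes "orthonormal \<phi> n" "x \<in> H" shows "nrm (x - proj \<phi> n x) \<le> nrm x"
  unfolding nrm_def proj_residual[OF assms] by (intro real_sqrt_le_mono) (simp add: sum_nonneg)

end


section \<open>Eigenvectors of a self-adjoint operator by successive minimisation\<close>

text \<open>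
  Finitely many linear functionals admit vectors \<open>e l\<close> such that \<open>u - (\<Sum>l\<in>F. l u *\<^sub>R e l)\<close> is annihilated by all of
  them, even if the functionals are linearly dependent. A new functional \<open>p\<close> either vanishes on the common kernel of the old
  ones, and then needs no vector, or it is normalised on some \<open>z\<close> in that kernel and the old vectors are corrected by
  multiples of \<open>z\<close>.
\<close>

lemma dual_vectors:
  fixes V :: "'a::real_vector set" and F :: "('a \<Rightarrow> real) set"
  assumes "finite F" and V: "subspace V" and lin: "\<And>l. l \<in> F \<Longrightarrow> linear l"
  shows "\<exists>e. (\<forall>l\<in>F. e l \<in> V) \<and> (\<forall>u\<in>V. \<forall>k\<in>F. k (u - (\<Sum>l\<in>F. l u *\<^sub>R e l)) = 0)"
  using assms(1) lin
proof (induction F)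
  case empty
  show ?case by simp
next
  case (insert p F)
  have "\<exists>e. (\<forall>l\<in>F. e l \<in> V) \<and> (\<forall>u\<in>V. \<forall>k\<in>F. k (u - (\<Sum>l\<in>F. l u *\<^sub>R e l)) = 0)"
    using insert.prems by (intro insert.IH) simp
  then obtain e where e: "\<And>l. l \<in> F \<Longrightarrow> e l \<in> V"
    and k: "\<And>u k. u \<in> V \<Longrightarrow> k \<in> F \<Longrightarrow> k (u - (\<Sum>l\<in>F. l u *\<^sub>R e l)) = 0" by blast
  define w where "w u = u - (\<Sum>l\<in>F. l u *\<^sub>R e l)" for u
  have lin: "linear l" if "l \<in> insert p F" for l using insert.prems that .
  have wV: "w u \<in> V" if "u \<in> V" for u
    unfolding w_def using that e V by (intro subspace_diff subspace_sum subspace_scale) auto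
  show ?case
  proof (cases "\<exists>z\<in>V. (\<forall>l\<in>F. l z = 0) \<and> p z \<noteq> 0")
    case True
    then obtain z0 where z0: "z0 \<in> V" "\<And>l. l \<in> F \<Longrightarrow> l z0 = 0" "p z0 \<noteq> 0" by blast
    define z where "z = (1 / p z0) *\<^sub>R z0"
    have z: "z \<in> V" "\<And>l. l \<in> F \<Longrightarrow> l z = 0" "p z = 1"
      using z0 V lin by (auto simp: z_def subspace_scale linear_scale)
    define e' where "e' l = (if l = p then z else e l - p (e l) *\<^sub>R z)" for l
    have eq: "u - (\<Sum>l\<in>insert p F. l u *\<^sub>R e' l) = w u - p (w u) *\<^sub>R z" for u
    proof -
      have "(\<Sum>l\<in>F. l u *\<^sub>R e' l) = (\<Sum>l\<in>F. l u *\<^sub>R e l - (l u * p (e l)) *\<^sub>R z)"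
        using insert.hyps by (intro sum.cong) (auto simp: e'_def scaleR_diff_right)
      also have "\<dots> = (\<Sum>l\<in>F. l u *\<^sub>R e l) - (\<Sum>l\<in>F. l u * p (e l)) *\<^sub>R z"
        by (simp add: sum_subtractf scaleR_sum_left)
      also have "(\<Sum>l\<in>F. l u * p (e l)) = p u - p (w u)"
        using lin[of p] by (simp add: w_def linear_diff linear_sum linear_scale)
      finally show ?thesis using insert.hyps by (simp add: e'_def w_def algebra_simps)
    qed
    have "k (u - (\<Sum>l\<in>insert p F. l u *\<^sub>R e' l)) = 0" if "u \<in> V" "k \<in> insert p F" for u k
    proof -
      have "k (w u - p (w u) *\<^sub>R z) = k (w u) - p (w u) * k z"
        using lin[OF that(2)] by (simp add: linear_diff linear_scale)
      also have "\<dots> = 0" 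
        using z(2)[of k] z(3) k[OF that(1), of k] that(2) unfolding w_def[symmetric] by (cases "k = p") auto
      finally show ?thesis unfolding eq .
    qed
    moreover have "\<forall>l\<in>insert p F. e' l \<in> V"
      using z e V by (auto simp: e'_def intro!: subspace_diff subspace_scale)
    ultimately show ?thesis by (intro exI[of _ e']) blast
  next
    case False
    then have pw: "p (w u) = 0" if "u \<in> V" for u
      using wV[OF that] k[OF that] by (auto simp: w_def)
    define e' where "e' l = (if l = p then 0 else e l)" for l
    have eq: "u - (\<Sum>l\<in>insert p F. l u *\<^sub>R e' l) = w u" for u
    proof -
      have "(\<Sum>l\<in>F. l u *\<^sub>R e' l) = (\<Sum>l\<in>F. l u *\<^sub>R e l)"
        using insert.hyps by (intro sum.cong) (auto simp: e'_def)
      then show ?thesis using insert.hyps by (simp add: e'_def w_def)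
    qed
    have "k (u - (\<Sum>l\<in>insert p F. l u *\<^sub>R e' l)) = 0" if "u \<in> V" "k \<in> insert p F" for u k
      unfolding eq using that pw k by (auto simp: w_def)
    moreover have "\<forall>l\<in>insert p F. e' l \<in> V"
      using e V by (auto simp: e'_def subspace_0)
    ultimately show ?thesis by (intro exI[of _ e']) blast
  qed
qed

lemma independent_common_kernel:
  fixes B :: "'a::real_vector set" and F :: "('a \<Rightarrow> real) set"
  assumes "independent B" "finite F" "card F < card B" and lin: "\<And>l. l \<in> F \<Longrightarrow> linear l"
  shows "\<exists>u\<in>span B. u \<noteq> 0 \<and> (\<forall>l\<in>F. l u = 0)"
proof (rule ccontr)
  assume "\<not> ?thesis"
  then have triv: "u = 0" if "u \<in> span B" "\<And>l. l \<in> F \<Longrightarrow> l u = 0" for u using that by blast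
  obtain e where e: "\<And>l. l \<in> F \<Longrightarrow> e l \<in> span B"
    and k: "\<And>u k. u \<in> span B \<Longrightarrow> k \<in> F \<Longrightarrow> k (u - (\<Sum>l\<in>F. l u *\<^sub>R e l)) = 0"
    using dual_vectors[OF assms(2) subspace_span[of B] lin] by blast
  have "B \<subseteq> span (e ` F)"
  proof
    fix u assume "u \<in> B"
    then have u: "u \<in> span B" by (rule span_base)
    have "(\<Sum>l\<in>F. l u *\<^sub>R e l) \<in> span B" using e by (intro span_sum span_scale)
    then have "u - (\<Sum>l\<in>F. l u *\<^sub>R e l) = 0" using k[OF u] u by (intro triv span_diff)
    then have "u = (\<Sum>l\<in>F. l u *\<^sub>R e l)" by simp
    also have "\<dots> \<in> span (e ` F)" by (intro span_sum span_scale span_base imageI)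
    finally show "u \<in> span (e ` F)" .
  qed
  then have "card B \<le> card (e ` F)"
    using independent_span_bound[OF _ assms(1)] assms(2) by blast
  then show False using card_image_le[OF assms(2), of e] assms(3) by simp
qed

text \<open>
  \<open>A\<close> is symmetric on \<open>D\<close>, and \<open>closed\<close> says that a vector in the domain of the adjoint is represented
  in \<open>D\<close>. Only the values \<open>ip (A u) v\<close> are determined, so \<open>A\<close> is linear only up to null vectors.
\<close>

locale sa_operator = semi_inner H ip for H :: "'a::real_vector set" and ip +
  fixes D :: "'a set" and A :: "'a \<Rightarrow> 'a" and C :: real
  assumes D: "subspace D" and DH: "D \<subseteq> H" and AH: "\<And>u. u \<in> D \<Longrightarrow> A u \<in> H"
    and sym: "\<And>u v. u \<in> D \<Longrightarrow> v \<in> D \<Longrightarrow> ip (A u) v = ip u (A v)"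
    and closed: "\<And>v w. v \<in> H \<Longrightarrow> w \<in> H \<Longrightarrow> (\<And>u. u \<in> D \<Longrightarrow> ip (A u) v = ip u w) \<Longrightarrow>
       \<exists>u\<in>D. ip (u - v) (u - v) = 0 \<and> ip (A u - w) (A u - w) = 0"
    and dense: "\<And>v e. v \<in> H \<Longrightarrow> 0 < e \<Longrightarrow> \<exists>u\<in>D. nrm (u - v) < e"
    and compact: "\<And>x K. (\<And>k::nat. x k \<in> D) \<Longrightarrow> (\<And>k. ip (x k) (x k) \<le> K) \<Longrightarrow> (\<And>k. ip (A (x k)) (x k) \<le> K) \<Longrightarrow>
       \<exists>r v. strict_mono r \<and> v \<in> H \<and> (\<lambda>k. nrm (x (r k) - v)) \<longlonglongrightarrow> 0"
    and below: "\<And>u. u \<in> D \<Longrightarrow> - C * ip u u \<le> ip (A u) u" and C: "C \<ge> 0"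
    and infinite_dim: "\<And>n. \<exists>\<psi>. orthonormal \<psi> n"
begin

lemma D_H [simp]: "u \<in> D \<Longrightarrow> u \<in> H" using DH by blast

lemma D_simps [simp]: "0 \<in> D" "x \<in> D \<Longrightarrow> y \<in> D \<Longrightarrow> x + y \<in> D" "x \<in> D \<Longrightarrow> y \<in> D \<Longrightarrow> x - y \<in> D"
  "x \<in> D \<Longrightarrow> r *\<^sub>R x \<in> D"
  using D by (simp_all add: subspace_0 subspace_add subspace_diff subspace_scale)

lemma D_sum [simp]: "(\<And>i. i \<in> I \<Longrightarrow> f i \<in> D) \<Longrightarrow> (\<Sum>i\<in>I. f i) \<in> D"
  using D by (simp add: subspace_sum)

lemmas [simp] = AH

lemma A_add: "u \<in> D \<Longrightarrow> v \<in> D \<Longrightarrow> w \<in> D \<Longrightarrow> ip (A (u + v)) w = ip (A u) w + ip (A v) w"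
  by (simp add: sym ip_add)
lemma A_diff: "u \<in> D \<Longrightarrow> v \<in> D \<Longrightarrow> w \<in> D \<Longrightarrow> ip (A (u - v)) w = ip (A u) w - ip (A v) w"
  by (simp add: sym ip_diff)
lemma A_scale: "u \<in> D \<Longrightarrow> w \<in> D \<Longrightarrow> ip (A (r *\<^sub>R u)) w = r * ip (A u) w"
  by (simp add: sym ip_scale)
lemma A_sum: "(\<And>i. i \<in> I \<Longrightarrow> f i \<in> D) \<Longrightarrow> w \<in> D \<Longrightarrow> ip (A (\<Sum>i\<in>I. f i)) w = (\<Sum>i\<in>I. ip (A (f i)) w)"
  by (simp add: sym ip_sum)

definition "ev u = ip (A u) u"

definition eigen :: "'a \<Rightarrow> bool" where
  "eigen x \<longleftrightarrow> x \<in> D \<and> (\<forall>w\<in>D. ip (A x) w = ev x * ip x w)"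

definition eigen_system :: "(nat \<Rightarrow> 'a) \<Rightarrow> nat \<Rightarrow> bool" where
  "eigen_system \<phi> n \<longleftrightarrow> (\<forall>i<n. eigen (\<phi> i)) \<and> orthonormal \<phi> n"

lemma eigenD: "eigen x \<Longrightarrow> x \<in> D" "eigen x \<Longrightarrow> w \<in> D \<Longrightarrow> ip (A x) w = ev x * ip x w"
  by (auto simp: eigen_def)

lemma eigen_systemD: "eigen_system \<phi> n \<Longrightarrow> i < n \<Longrightarrow> \<phi> i \<in> D" "eigen_system \<phi> n \<Longrightarrow> i < n \<Longrightarrow> eigen (\<phi> i)"
   "eigen_system \<phi> n \<Longrightarrow> orthonormal \<phi> n"
  by (auto simp: eigen_system_def eigen_def)

lemma proj_D: "eigen_system \<phi> n \<Longrightarrow> proj \<phi> n x \<in> D"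
  unfolding proj_def by (intro D_sum D_simps(4)) (auto dest: eigen_systemD)

text \<open>
  Otherwise every vector would equal its projection to the span of \<open>\<phi> 0, \<dots>, \<phi> (n - 1)\<close> up to a null vector, first on \<open>D\<close> and
  then everywhere by density. Summing squared Fourier coefficients of \<open>n + 1\<close> orthonormal vectors in both orders would
  then bound \<open>n + 1\<close> by \<open>n\<close>.
\<close>

lemma exists_nonnull_orthogonal:
  assumes "eigen_system \<phi> n"
  shows "\<exists>u\<in>D. (\<forall>i<n. ip u (\<phi> i) = 0) \<and> ip u u \<noteq> 0"
proof (rule ccontr)
  assume "\<not> ?thesis"
  then have null: "ip u u = 0" if "u \<in> D" "\<And>i. i < n \<Longrightarrow> ip u (\<phi> i) = 0" for u using that by blast
  note on = eigen_systemD(3)[OF assms]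
  have eq: "ip v v = (\<Sum>i<n. (ip v (\<phi> i))\<^sup>2)" if v: "v \<in> H" for v
  proof -
    let ?w = "v - proj \<phi> n v"
    have w: "?w \<in> H" using v proj_H[OF on] by simp
    have "ip u ?w = 0" if u: "u \<in> D" for u
    proof -
      let ?r = "u - proj \<phi> n u"
      have "ip ?r ?r = 0" using u proj_D[OF assms] proj_orth[OF on] by (intro null) auto
      then have "ip u ?w = ip (proj \<phi> n u) ?w"
        using u proj_H[OF on] w by (intro null_diff_ip) auto
      also have "\<dots> = (\<Sum>i<n. ip u (\<phi> i) * ip ?w (\<phi> i))"
        using u w by (intro ip_proj[OF on]) auto
      also have "\<dots> = 0" using proj_orth[OF on v] by simp
      finally show ?thesis .
    qed
    then have *: "ip ?w ?w = ip (?w - u) ?w" if "u \<in> D" for u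
      using that w by (subst ip_diff) auto
    have "nrm ?w \<le> 0"
    proof (rule ccontr)
      assume "\<not> nrm ?w \<le> 0"
      then have pos: "nrm ?w > 0" by simp
      obtain u where u: "u \<in> D" "nrm (u - ?w) < nrm ?w" using dense[OF w pos] by blast
      have "(nrm ?w)\<^sup>2 = ip (?w - u) ?w" using *[OF u(1)] nrm_sq[OF w] by simp
      also have "\<dots> \<le> nrm (?w - u) * nrm ?w" using cauchy_abs[of "?w - u" ?w] w u by simp
      also have "nrm (?w - u) = nrm (u - ?w)" using w u by (intro nrm_minus_commute) auto
      also have "nrm (u - ?w) * nrm ?w < nrm ?w * nrm ?w" using u pos by simp
      finally show False by (simp add: power2_eq_square)
    qed
    then have "ip ?w ?w = 0" using w nrm_nonneg[OF w] nrm_eq_0[OF w] by simp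
    then show ?thesis using proj_residual[OF on v] by simp
  qed
  obtain \<psi> where \<psi>: "orthonormal \<psi> (Suc n)" using infinite_dim by blast
  have "real (Suc n) = (\<Sum>j<Suc n. ip (\<psi> j) (\<psi> j))" using \<psi> by (simp add: orthonormal_def)
  also have "\<dots> = (\<Sum>j<Suc n. \<Sum>i<n. (ip (\<phi> i) (\<psi> j))\<^sup>2)"
    using eq orthonormalD(1)[OF \<psi>] orthonormalD(1)[OF on] by (intro sum.cong refl) (simp add: ip_sym[of "\<psi> _"])
  also have "\<dots> = (\<Sum>i<n. \<Sum>j<Suc n. (ip (\<phi> i) (\<psi> j))\<^sup>2)" by (rule sum.swap)
  also have "\<dots> \<le> (\<Sum>i<n. ip (\<phi> i) (\<phi> i))"
    using orthonormalD(1)[OF on] by (intro sum_mono bessel[OF \<psi>]) auto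
  also have "\<dots> = n" using on by (simp add: orthonormal_def)
  finally show False by simp
qed

text \<open>
  A minimising sequence of the form on the orthogonal complement \<open>K\<close> of the known eigenvectors converges
  in norm by compactness. Since \<open>u \<mapsto> ip (A u) u - l * ip u u\<close> is nonnegative on \<open>K\<close>, the Cauchy-Schwarz inequality for this
  form turns approximate minimality into the weak eigenvalue equation for the limit, and the adjoint puts the limit into \<open>D\<close>.
\<close>

lemma eigen_step:
  assumes sys: "eigen_system \<phi> n"
  shows "\<exists>x. eigen x \<and> (\<forall>i<n. ip x (\<phi> i) = 0) \<and> ip x x = 1 \<and>
    (\<forall>u\<in>D. (\<forall>i<n. ip u (\<phi> i) = 0) \<longrightarrow> ev x * ip u u \<le> ip (A u) u)"
proof -
  note on = eigen_systemD(3)[OF sys]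
  have pD: "\<And>i. i < n \<Longrightarrow> \<phi> i \<in> D" by (rule eigen_systemD(1)[OF sys])
  define K where "K = {u\<in>D. \<forall>i<n. ip u (\<phi> i) = 0}"
  have KD: "u \<in> K \<Longrightarrow> u \<in> D" for u by (simp add: K_def)
  have K: "subspace K"
    unfolding subspace_def K_def using pD by (auto simp: ip_add ip_scale)
  define W where "W = {ip (A u) u | u. u \<in> K \<and> ip u u = 1}"
  define l where "l = Inf W"
  have scaled: "ip ((1 / nrm u) *\<^sub>R u) ((1 / nrm u) *\<^sub>R u) = 1"
    "ip (A ((1 / nrm u) *\<^sub>R u)) ((1 / nrm u) *\<^sub>R u) = ip (A u) u / ip u u"
    if u: "u \<in> D" "ip u u \<noteq> 0" for u
  proof -
    have s: "nrm u * nrm u = ip u u" using nrm_sq[of u] u by (simp add: power2_eq_square)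
    have n0: "nrm u \<noteq> 0" using u nrm_eq_0[of u] by simp
    show "ip ((1 / nrm u) *\<^sub>R u) ((1 / nrm u) *\<^sub>R u) = 1"
      using u n0 by (simp add: ip_simps s[symmetric])
    show "ip (A ((1 / nrm u) *\<^sub>R u)) ((1 / nrm u) *\<^sub>R u) = ip (A u) u / ip u u"
      using u n0 by (simp add: A_scale ip_scale_right s[symmetric])
  qed
  obtain u0 where u0: "u0 \<in> K" "ip u0 u0 \<noteq> 0"
    using exists_nonnull_orthogonal[OF sys] by (auto simp: K_def)
  have Wne: "W \<noteq> {}"
    using scaled(1)[OF KD[OF u0(1)] u0(2)] subspace_scale[OF K u0(1)] unfolding W_def by blast
  have Wbd: "bdd_below W"
    using below KD unfolding W_def by (intro bdd_belowI[of _ "- C"]) force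
  have min: "l * ip u u \<le> ip (A u) u" if u: "u \<in> K" for u
  proof (cases "ip u u = 0")
    case True
    then show ?thesis using below[OF KD[OF u]] by simp
  next
    case False
    have "ip (A u) u / ip u u \<in> W"
      using scaled[OF KD[OF u] False] subspace_scale[OF K u] unfolding W_def by (smt (verit) mem_Collect_eq)
    then have "l \<le> ip (A u) u / ip u u" unfolding l_def using Wbd by (rule cInf_lower)
    moreover have "ip u u > 0" using False ip_nonneg[of u] KD[OF u] by simp
    ultimately show ?thesis by (simp add: field_simps)
  qed
  have "\<exists>u. u \<in> K \<and> ip u u = 1 \<and> ip (A u) u < l + 1 / Suc k" for k :: nat
    using cInf_lessD[OF Wne, of "l + 1 / Suc k"] unfolding l_def[symmetric] by (auto simp: W_def)
  then obtain x where xK: "\<And>k. x k \<in> K" and x1: "\<And>k. ip (x k) (x k) = 1"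
    and xl: "\<And>k. ip (A (x k)) (x k) < l + 1 / Suc k" by metis
  have xD: "x k \<in> D" for k using xK KD by blast
  have xb: "ip (A (x k)) (x k) \<le> max 1 (l + 1)" for k
  proof -
    have "1 / real (Suc k) \<le> 1" by simp
    then show ?thesis using xl[of k] by linarith
  qed
  have xb1: "ip (x k) (x k) \<le> max 1 (l + 1)" for k using x1[of k] by simp
  obtain r v where r: "strict_mono r" and v: "v \<in> H" and lim: "(\<lambda>k. nrm (x (r k) - v)) \<longlonglongrightarrow> 0"
    using compact[of x, OF xD xb1 xb] by blast
  have xH: "x (r k) \<in> H" for k using xD by simp
  have vv: "ip v v = 1"
    using LIMSEQ_unique[OF tendsto_ip_self[OF xH v lim]] x1 by simp
  have vphi: "ip v (\<phi> i) = 0" if "i < n" for i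
    using LIMSEQ_unique[OF tendsto_ip[OF xH v _ lim, of "\<phi> i"]] pD[OF that] xK that by (simp add: K_def)
  have weakK: "(\<lambda>k. ip (x (r k)) (A w - l *\<^sub>R w)) \<longlonglongrightarrow> 0" if w: "w \<in> K" for w
  proof -
    interpret b: semi_inner K "\<lambda>u w. ip (A u) w - l * ip u w"
    proof
      show "subspace K" by (rule K)
      fix x y z r assume xyz: "x \<in> K" "y \<in> K"
      then have D: "x \<in> D" "y \<in> D" using KD by auto
      show "ip (A (r *\<^sub>R x)) y - l * ip (r *\<^sub>R x) y = r * (ip (A x) y - l * ip x y)"
        using D by (simp add: A_scale ip_scale algebra_simps)
      show "ip (A x) y - l * ip x y = ip (A y) x - l * ip y x"
        using D by (simp add: sym[of x y] ip_sym[of x "A y"] ip_sym[of x y])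
      show "0 \<le> ip (A x) x - l * ip x x" using min[OF xyz(1)] by simp
      assume "z \<in> K"
      then have "z \<in> D" using KD by auto
      then show "ip (A (x + y)) z - l * ip (x + y) z = ip (A x) z - l * ip x z + (ip (A y) z - l * ip y z)"
        using D by (simp add: A_add ip_add algebra_simps)
    qed
    have wD: "w \<in> D" using w KD by blast
    let ?q = "ip (A w) w - l * ip w w"
    have q0: "?q \<ge> 0" using min[OF w] by simp
    have le: "(ip (x (r k)) (A w - l *\<^sub>R w))\<^sup>2 \<le> 1 / Suc (r k) * ?q" for k
    proof -
      have "(ip (A (x (r k))) w - l * ip (x (r k)) w)\<^sup>2 \<le> (ip (A (x (r k))) (x (r k)) - l * ip (x (r k)) (x (r k))) * ?q"
        by (rule b.cauchy[OF xK w])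
      also have "\<dots> \<le> 1 / Suc (r k) * ?q"
        using xl[of "r k"] x1[of "r k"] q0 by (intro mult_right_mono) auto
      finally show ?thesis using wD xD[of "r k"] by (simp add: ip_simps sym)
    qed
    have "(\<lambda>n. 1 / real (Suc n)) \<longlonglongrightarrow> 0" using LIMSEQ_inverse_real_of_nat by (simp add: inverse_eq_divide)
    from LIMSEQ_subseq_LIMSEQ[OF this r] have "(\<lambda>k. 1 / real (Suc (r k)) * ?q) \<longlonglongrightarrow> 0"
      by (intro tendsto_mult_left_zero) (simp add: o_def)
    then have "(\<lambda>k. (ip (x (r k)) (A w - l *\<^sub>R w))\<^sup>2) \<longlonglongrightarrow> 0"
      by (rule Lim_null_comparison[rotated]) (use le in simp)
    from tendsto_real_sqrt[OF this] show ?thesis by (simp add: tendsto_rabs_zero_iff)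
  qed
  have weak: "ip (A w) v = ip w (l *\<^sub>R v)" if w: "w \<in> D" for w
  proof -
    let ?p = "proj \<phi> n w"
    let ?w = "w - ?p"
    have p: "?p \<in> D" by (rule proj_D[OF sys])
    have wK: "?w \<in> K" using w p proj_orth[OF on] by (simp add: K_def)
    have "ip (x (r k)) (A w - l *\<^sub>R w) = ip (x (r k)) (A ?w - l *\<^sub>R ?w)" for k
    proof -
      have xi: "ip (x (r k)) (\<phi> i) = 0" if "i < n" for i using xK[of "r k"] that by (simp add: K_def)
      have "ip ?p (x (r k)) = 0" using ip_proj[OF on D_H[OF w] xH[of k]] xi by simp
      moreover have "ip (A ?p) (x (r k)) = 0"
      proof -
        have "ip (A (\<phi> i)) (x (r k)) = 0" if "i < n" for i
          using eigenD(2)[OF eigen_systemD(2)[OF sys that] xD] xi[OF that] pD[OF that] xH[of k]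
          by (simp add: ip_sym[of "\<phi> i"])
        then have "(\<Sum>i<n. ip (A (ip w (\<phi> i) *\<^sub>R \<phi> i)) (x (r k))) = 0"
          using pD xD by (intro sum.neutral) (simp add: A_scale)
        then show ?thesis unfolding proj_def using pD xD by (subst A_sum) auto
      qed
      moreover have "ip (x (r k)) (A z) = ip (A z) (x (r k))" "ip (x (r k)) z = ip z (x (r k))" if "z \<in> D" for z
        using that xH[of k] by (simp_all add: ip_sym[of "x (r k)"])
      ultimately show ?thesis
        using w p xD[of "r k"] by (simp add: ip_simps A_diff)
    qed
    then have "(\<lambda>k. ip (x (r k)) (A w - l *\<^sub>R w)) \<longlonglongrightarrow> 0" using weakK[OF wK] by simp
    moreover have "(\<lambda>k. ip (x (r k)) (A w - l *\<^sub>R w)) \<longlonglongrightarrow> ip v (A w - l *\<^sub>R w)"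
      using w by (intro tendsto_ip[OF xH v _ lim]) auto
    ultimately have "ip v (A w - l *\<^sub>R w) = 0" by (rule LIMSEQ_unique[rotated])
    then show ?thesis using w v by (simp add: ip_simps ip_sym[of v])
  qed
  obtain u where u: "u \<in> D" "ip (u - v) (u - v) = 0" "ip (A u - l *\<^sub>R v) (A u - l *\<^sub>R v) = 0"
    using closed[OF v _ weak] v by auto
  have uy: "ip u y = ip v y" if "y \<in> H" for y using null_diff_ip[of u v y] u v that by simp
  have uu: "ip u u = 1" using uy[of u] uy[of v] ip_sym[of v u] u v vv by simp
  have Au: "ip (A u) w = l * ip u w" if "w \<in> D" for w
    using null_diff_ip[of "A u" "l *\<^sub>R v" w] u v that uy[of w] by (simp add: ip_scale)
  have evu: "ev u = l" using Au[OF u(1)] uu by (simp add: ev_def)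
  have "eigen u" using u Au evu by (simp add: eigen_def)
  moreover have "\<forall>i<n. ip u (\<phi> i) = 0" using uy vphi pD by simp
  moreover have "\<forall>u'\<in>D. (\<forall>i<n. ip u' (\<phi> i) = 0) \<longrightarrow> ev u * ip u' u' \<le> ip (A u') u'"
    unfolding evu using min by (simp add: K_def)
  ultimately show ?thesis using uu by blast
qed

lemma eigenbasis:
  "\<exists>\<phi> :: nat \<Rightarrow> 'a. \<forall>n. eigen (\<phi> n) \<and> (\<forall>i<n. ip (\<phi> n) (\<phi> i) = 0) \<and> ip (\<phi> n) (\<phi> n) = 1 \<and>
    (\<forall>u\<in>D. (\<forall>i<n. ip u (\<phi> i) = 0) \<longrightarrow> ev (\<phi> n) * ip u u \<le> ip (A u) u)"
proof (rule dependent_wellorder_choice)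
  fix x :: nat and f :: "nat \<Rightarrow> 'a"
  assume ih: "\<And>y. y < x \<Longrightarrow> eigen (f y) \<and> (\<forall>i<y. ip (f y) (f i) = 0) \<and> ip (f y) (f y) = 1 \<and>
    (\<forall>u\<in>D. (\<forall>i<y. ip u (f i) = 0) \<longrightarrow> ev (f y) * ip u u \<le> ip (A u) u)"
  have "orthonormal f x"
    unfolding orthonormal_def
  proof (intro conjI allI impI)
    fix i j assume ij: "i < x" "j < x"
    show "f i \<in> H" using ih[OF ij(1)] eigenD(1) by simp
    have "f i \<in> H" "f j \<in> H" using ih ij eigenD(1) by auto
    then show "ip (f i) (f j) = (if i = j then 1 else 0)"
      using ih[OF ij(1)] ih[OF ij(2)] ip_sym[of "f i" "f j"] by (cases i j rule: linorder_cases) auto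
  qed
  then have "eigen_system f x" using ih by (simp add: eigen_system_def)
  from eigen_step[OF this]
  show "\<exists>r. eigen r \<and> (\<forall>i<x. ip r (f i) = 0) \<and> ip r r = 1 \<and>
    (\<forall>u\<in>D. (\<forall>i<x. ip u (f i) = 0) \<longrightarrow> ev r * ip u u \<le> ip (A u) u)" by blast
qed simp

definition "\<phi> = (SOME \<phi> :: nat \<Rightarrow> 'a. \<forall>n. eigen (\<phi> n) \<and> (\<forall>i<n. ip (\<phi> n) (\<phi> i) = 0) \<and> ip (\<phi> n) (\<phi> n) = 1 \<and>
    (\<forall>u\<in>D. (\<forall>i<n. ip u (\<phi> i) = 0) \<longrightarrow> ev (\<phi> n) * ip u u \<le> ip (A u) u))"

definition "eigval n = ev (\<phi> n)"

lemma phi_props: "eigen (\<phi> n)" "i < n \<Longrightarrow> ip (\<phi> n) (\<phi> i) = 0" "ip (\<phi> n) (\<phi> n) = 1"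
  "u \<in> D \<Longrightarrow> (\<And>i. i < n \<Longrightarrow> ip u (\<phi> i) = 0) \<Longrightarrow> eigval n * ip u u \<le> ip (A u) u"
  using someI_ex[OF eigenbasis, folded \<phi>_def] unfolding eigval_def by blast+

lemma phi_D [simp]: "\<phi> n \<in> D" using phi_props(1) eigenD(1) by blast

lemma A_phi: "w \<in> D \<Longrightarrow> ip (A (\<phi> n)) w = eigval n * ip (\<phi> n) w"
  using phi_props(1) eigenD(2) unfolding eigval_def by blast

lemma ip_phi: "ip (\<phi> i) (\<phi> j) = (if i = j then 1 else 0)"
  using phi_props(2,3) ip_sym[of "\<phi> i" "\<phi> j"] by (cases i j rule: linorder_cases) auto

lemma phi_orthonormal: "orthonormal \<phi> n"
  by (simp add: orthonormal_def ip_phi)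

lemma A_phi_right: "w \<in> D \<Longrightarrow> ip (A w) (\<phi> n) = eigval n * ip w (\<phi> n)"
  using A_phi[of w n] by (simp add: sym ip_sym[of w])

lemma eigval_mono: "m \<le> n \<Longrightarrow> eigval m \<le> eigval n"
proof -
  assume "m \<le> n"
  then have "eigval m * ip (\<phi> n) (\<phi> n) \<le> ip (A (\<phi> n)) (\<phi> n)"
    by (intro phi_props(4)) (auto simp: ip_phi)
  then show ?thesis by (simp add: ip_phi A_phi)
qed

lemma A_combination:
  "ip (A (\<Sum>i\<in>I. c i *\<^sub>R \<phi> i)) (\<Sum>i\<in>I. c i *\<^sub>R \<phi> i) = (\<Sum>i\<in>I. eigval i * (c i)\<^sup>2)" if I: "finite I"
proof -
  let ?s = "\<Sum>i\<in>I. c i *\<^sub>R \<phi> i"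
  have s: "?s \<in> D" by simp
  have "ip (A ?s) ?s = (\<Sum>i\<in>I. ip (A (c i *\<^sub>R \<phi> i)) ?s)" using s by (subst A_sum) auto
  also have "\<dots> = (\<Sum>i\<in>I. eigval i * (c i)\<^sup>2)"
  proof (rule sum.cong[OF refl])
    fix i assume i: "i \<in> I"
    have "ip (\<phi> i) ?s = (\<Sum>j\<in>I. c j * ip (\<phi> i) (\<phi> j))"
      by (subst ip_sum_right) (auto simp: ip_scale_right)
    also have "\<dots> = (\<Sum>j\<in>I. if i = j then c i else 0)" by (intro sum.cong) (auto simp: ip_phi)
    finally have "ip (\<phi> i) ?s = c i" using i I by simp
    then show "ip (A (c i *\<^sub>R \<phi> i)) ?s = eigval i * (c i)\<^sup>2"
      using s by (simp add: A_scale A_phi power2_eq_square)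
  qed
  finally show ?thesis .
qed

text \<open>
  Since the eigenvalues tend to infinity, this estimate makes the remainders of eigenvector expansions small.
\<close>

lemma residual_D: assumes "x \<in> D"
  shows "eigval n * ip (x - proj \<phi> n x) (x - proj \<phi> n x) \<le> ip (A x) x + C * ip x x"
proof -
  let ?p = "proj \<phi> n x"
  have p: "?p \<in> D" unfolding proj_def by simp
  let ?r = "x - ?p"
  have r: "?r \<in> D" using assms p by simp
  have orth: "ip ?r (\<phi> i) = 0" if "i < n" for i using proj_orth[OF phi_orthonormal _ that] assms by simp
  have "eigval n * ip ?r ?r \<le> ip (A ?r) ?r" using r orth by (intro phi_props(4)) auto
  also have "\<dots> = ip (A x) x - ip (A ?p) ?p"
  proof -
    have "ip (A ?r) ?p = (\<Sum>i<n. ip x (\<phi> i) * ip (A ?r) (\<phi> i))"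
      unfolding proj_def using r by (subst ip_sum_right) (auto simp: ip_scale_right proj_def[symmetric])
    also have "\<dots> = 0" using orth r by (intro sum.neutral) (simp add: A_phi_right)
    finally have "ip (A x) ?p = ip (A ?p) ?p" using assms p by (simp add: A_diff)
    moreover have "ip (A ?p) x = ip (A x) ?p" using assms p by (simp add: sym[of ?p] ip_sym[of ?p])
    ultimately show ?thesis using assms p by (simp add: A_diff ip_diff_right)
  qed
  also have "\<dots> \<le> ip (A x) x + C * ip x x"
  proof -
    have "- C * ip ?p ?p \<le> ip (A ?p) ?p" by (rule below[OF p])
    moreover have "ip ?p ?p \<le> ip x x"
      unfolding proj_def using bessel[OF phi_orthonormal, of x n] assms
      by (subst ip_combination_self[OF phi_orthonormal]) simp
    ultimately show ?thesis using C mult_left_mono[of "ip ?p ?p" "ip x x" C] by simp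
  qed
  finally show ?thesis .
qed

end


section \<open>Growth of the eigenvalues and spectral gaps\<close>

text \<open>
  Assumption \<open>weyl\<close> is a lower bound on the eigenvalues in dual form: up to \<open>E * m\<close> linear conditions
  the form is at least of order \<open>m\<^sup>2\<close>.
\<close>

locale discrete_sa_operator = sa_operator H ip D A C for H :: "'a::real_vector set" and ip D A C +
  fixes E :: nat and \<omega> \<kappa> :: real
  assumes \<omega>: "\<omega> > 0"
    and weyl: "\<And>m::nat. m > 0 \<Longrightarrow> \<exists>F. finite F \<and> card F \<le> E * m \<and> (\<forall>l\<in>F. linear l) \<and>
       (\<forall>u\<in>D. (\<forall>l\<in>F. l u = (0::real)) \<longrightarrow> (\<omega> * (real m)\<^sup>2 - \<kappa>) * ip u u \<le> ip (A u) u)"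
begin

lemma phi_independent: "independent (\<phi> ` {..n})" and phi_inj: "inj_on \<phi> {..n}"
proof -
  show inj: "inj_on \<phi> {..n}"
  proof (rule inj_onI)
    fix i j assume "\<phi> i = \<phi> j"
    then show "i = j" using ip_phi[of i j] ip_phi[of j j] by (metis zero_neq_one)
  qed
  show "independent (\<phi> ` {..n})"
  proof (rule independent_if_scalars_zero)
    fix f x assume s: "(\<Sum>x\<in>\<phi> ` {..n}. f x *\<^sub>R x) = 0" and x: "x \<in> \<phi> ` {..n}"
    then obtain j where j: "j \<le> n" "x = \<phi> j" by auto
    have "0 = ip (\<Sum>x\<in>\<phi> ` {..n}. f x *\<^sub>R x) (\<phi> j)" unfolding s by simp
    also have "\<dots> = ip (\<Sum>i<Suc n. f (\<phi> i) *\<^sub>R \<phi> i) (\<phi> j)"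
      by (simp add: sum.reindex[OF inj] lessThan_Suc_atMost)
    also have "\<dots> = f (\<phi> j)" using j by (intro ip_combination phi_orthonormal) auto
    finally show "f x = 0" using j by simp
  qed simp
qed

lemma span_phi: assumes "u \<in> span (\<phi> ` {..n})"
  shows "\<exists>c. u = (\<Sum>i\<le>n. c i *\<^sub>R \<phi> i)"
proof -
  obtain q where "u = (\<Sum>x\<in>\<phi> ` {..n}. q x *\<^sub>R x)"
    using assms by (auto simp: span_finite)
  then show ?thesis by (intro exI[of _ "\<lambda>i. q (\<phi> i)"]) (simp add: sum.reindex[OF phi_inj])
qed

text \<open>
  The span of \<open>E * m + 1\<close> eigenvectors contains a nonzero vector satisfying \<open>E * m\<close> linear conditions.
\<close>

lemma eigval_lower: assumes "m > 0" shows "\<omega> * (real m)\<^sup>2 - \<kappa> \<le> eigval (E * m)"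
proof -
  let ?n = "E * m"
  obtain F :: "('a \<Rightarrow> real) set" where F: "finite F" "card F \<le> E * m" "\<And>l. l \<in> F \<Longrightarrow> linear l"
    and ker: "\<And>u. u \<in> D \<Longrightarrow> (\<And>l. l \<in> F \<Longrightarrow> l u = 0) \<Longrightarrow> (\<omega> * (real m)\<^sup>2 - \<kappa>) * ip u u \<le> ip (A u) u"
    using weyl[OF assms] by blast
  have "card F < card (\<phi> ` {..?n})" using F(2) by (simp add: card_image[OF phi_inj])
  from independent_common_kernel[OF phi_independent F(1) this F(3)]
  obtain u where u: "u \<in> span (\<phi> ` {..?n})" "u \<noteq> 0" "\<And>l. l \<in> F \<Longrightarrow> l u = 0" by blast
  obtain q where q: "u = (\<Sum>i\<le>?n. q i *\<^sub>R \<phi> i)" using span_phi[OF u(1)] by blast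
  have uD: "u \<in> D" unfolding q by simp
  have ipu: "ip u u = (\<Sum>i\<le>?n. (q i)\<^sup>2)"
    unfolding q using ip_combination_self[OF phi_orthonormal, of q "Suc ?n"] by (simp add: lessThan_Suc_atMost)
  have pos: "ip u u > 0"
  proof -
    obtain i where "i \<le> ?n" "q i \<noteq> 0"
    proof (rule ccontr)
      assume "\<not> thesis"
      then have "\<And>i. i \<le> ?n \<Longrightarrow> q i = 0" using that by blast
      then have "u = 0" unfolding q by simp
      then show False using u(2) by simp
    qed
    then show ?thesis unfolding ipu by (intro sum_pos2[of _ i]) auto
  qed
  have "(\<omega> * (real m)\<^sup>2 - \<kappa>) * ip u u \<le> ip (A u) u" using ker uD u(3) by blast
  also have "\<dots> = (\<Sum>i\<le>?n. eigval i * (q i)\<^sup>2)" unfolding q by (rule A_combination) simp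
  also have "\<dots> \<le> (\<Sum>i\<le>?n. eigval ?n * (q i)\<^sup>2)"
    by (intro sum_mono mult_right_mono eigval_mono) auto
  also have "\<dots> = eigval ?n * ip u u" unfolding ipu by (simp add: sum_distrib_left)
  finally show ?thesis using pos by simp
qed

lemma quadratic_dominates: "\<exists>m0. \<forall>m\<ge>m0. \<omega> * (real m)\<^sup>2 > a * real m + b"
proof (intro exI allI impI)
  fix m :: nat assume m: "nat \<lceil>(\<bar>a\<bar> + \<bar>b\<bar> + 1) / \<omega>\<rceil> + 1 \<le> m"
  have "(\<bar>a\<bar> + \<bar>b\<bar> + 1) / \<omega> \<le> real m" using m by linarith
  then have "\<bar>a\<bar> + \<bar>b\<bar> + 1 \<le> \<omega> * real m" using \<omega> by (simp add: field_simps)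
  then have "(\<bar>a\<bar> + \<bar>b\<bar> + 1) * real m \<le> \<omega> * real m * real m" by (intro mult_right_mono) auto
  moreover have "a * real m \<le> \<bar>a\<bar> * real m" by (intro mult_right_mono) auto
  moreover have "b \<le> \<bar>b\<bar> * real m" using m mult_left_mono[of 1 "real m" "\<bar>b\<bar>"] by simp
  moreover have "real m > 0" using m by simp
  moreover have "(\<bar>a\<bar> + \<bar>b\<bar> + 1) * real m = \<bar>a\<bar> * real m + \<bar>b\<bar> * real m + real m"
    by (simp add: algebra_simps)
  ultimately have "a * real m + b < \<omega> * real m * real m" by linarith
  then show "\<omega> * (real m)\<^sup>2 > a * real m + b" by (simp add: power2_eq_square mult.assoc)
qed

lemma eigval_unbounded: "\<exists>n0. \<forall>n\<ge>n0. B \<le> eigval n"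
proof -
  obtain m0 where m0: "\<forall>m\<ge>m0. \<omega> * (real m)\<^sup>2 > 0 * real m + (B + \<kappa>)" using quadratic_dominates by blast
  let ?m = "Suc m0"
  have "B \<le> eigval (E * ?m)" using m0[rule_format, of ?m] eigval_lower[of ?m] by simp
  then show ?thesis using eigval_mono order_trans by blast
qed

text \<open>
  If all gaps beyond some index were at most \<open>R\<close>, the eigenvalues would grow at most linearly.
\<close>

lemma large_gap: "\<exists>n. eigval (Suc n) - eigval n > R \<and> eigval (Suc n) \<ge> B"
proof (rule ccontr)
  assume neg: "\<not> ?thesis"
  obtain n0 where n0: "\<And>n. n \<ge> n0 \<Longrightarrow> B \<le> eigval n" using eigval_unbounded by blast
  have step: "eigval (Suc n) \<le> eigval n + \<bar>R\<bar>" if "n \<ge> n0" for n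
  proof -
    have "\<not> eigval (Suc n) - eigval n > R" using neg n0[of "Suc n"] that by auto
    then show ?thesis by linarith
  qed
  have lin: "eigval (n0 + k) \<le> eigval n0 + \<bar>R\<bar> * k" for k
  proof (induction k)
    case (Suc k)
    then show ?case using step[of "n0 + k"] by (simp add: algebra_simps)
  qed simp
  obtain m0 where m0: "\<forall>m\<ge>m0. \<omega> * (real m)\<^sup>2 > (\<bar>R\<bar> * E) * real m + (\<bar>eigval n0\<bar> + \<bar>\<kappa>\<bar>)"
    using quadratic_dominates by blast
  let ?m = "m0 + n0 + 1"
  have "eigval (E * ?m) \<le> eigval n0 + \<bar>R\<bar> * real (E * ?m)"
  proof (cases "E * ?m \<ge> n0")
    case True
    have "eigval (E * ?m) \<le> eigval n0 + \<bar>R\<bar> * real (E * ?m - n0)" using lin[of "E * ?m - n0"] True by simp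
    also have "\<dots> \<le> eigval n0 + \<bar>R\<bar> * real (E * ?m)" by (intro add_left_mono mult_left_mono of_nat_mono diff_le_self) simp
    finally show ?thesis .
  next
    case False
    then have "eigval (E * ?m) \<le> eigval n0" by (intro eigval_mono) simp
    moreover have "0 \<le> \<bar>R\<bar> * real (E * ?m)" by (intro mult_nonneg_nonneg) auto
    ultimately show ?thesis by linarith
  qed
  moreover have "\<omega> * (real ?m)\<^sup>2 - \<kappa> \<le> eigval (E * ?m)" by (rule eigval_lower) simp
  moreover have "\<omega> * (real ?m)\<^sup>2 > (\<bar>R\<bar> * E) * real ?m + (\<bar>eigval n0\<bar> + \<bar>\<kappa>\<bar>)" using m0[rule_format, of ?m] by simp
  moreover have "\<bar>R\<bar> * real (E * ?m) = (\<bar>R\<bar> * E) * real ?m" by (simp only: of_nat_mult mult.assoc)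
  ultimately show False by linarith
qed

text \<open>
  Remainders are small on \<open>D\<close> by \<open>residual_D\<close>. Passing to the remainder does not increase the norm, so the density of \<open>D\<close> gives the
  general case.
\<close>

lemma complete: assumes x: "x \<in> H" shows "(\<lambda>n. nrm (x - proj \<phi> n x)) \<longlonglongrightarrow> 0"
proof (rule LIMSEQ_I)
  fix e :: real assume e: "0 < e"
  obtain u where u: "u \<in> D" "nrm (u - x) < e / 2" using dense[OF x, of "e / 2"] e by auto
  define M where "M = ip (A u) u + C * ip u u"
  obtain n0 where n0: "\<And>n. n \<ge> n0 \<Longrightarrow> \<bar>M\<bar> * 8 / e\<^sup>2 + 1 \<le> eigval n" using eigval_unbounded by blast
  show "\<exists>n0. \<forall>n\<ge>n0. norm (nrm (x - proj \<phi> n x) - 0) < e"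
  proof (intro exI[of _ n0] allI impI)
    fix n assume n: "n \<ge> n0"
    let ?p = "proj \<phi> n"
    have pH: "?p y \<in> H" for y by (rule proj_H[OF phi_orthonormal])
    have r: "u - ?p u \<in> H" "x - u \<in> H" using u x pH by auto
    have "(\<bar>M\<bar> * 8 / e\<^sup>2 + 1) * (nrm (u - ?p u))\<^sup>2 \<le> eigval n * (nrm (u - ?p u))\<^sup>2"
      using n0[OF n] by (intro mult_right_mono) auto
    also have "\<dots> \<le> \<bar>M\<bar>" using residual_D[OF u(1), of n] by (simp add: nrm_sq[OF r(1)] M_def)
    finally have "(\<bar>M\<bar> * 8 / e\<^sup>2 + 1) * (nrm (u - ?p u))\<^sup>2 \<le> \<bar>M\<bar>" .
    moreover have "\<bar>M\<bar> < (\<bar>M\<bar> * 8 / e\<^sup>2 + 1) * (e / 2)\<^sup>2"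
    proof -
      have "(\<bar>M\<bar> * 8 / e\<^sup>2 + 1) * (e / 2)\<^sup>2 = 2 * \<bar>M\<bar> + (e / 2)\<^sup>2"
        using e by (simp add: power2_eq_square field_simps)
      moreover have "(e / 2)\<^sup>2 > 0" using e by simp
      ultimately show ?thesis by linarith
    qed
    ultimately have "(\<bar>M\<bar> * 8 / e\<^sup>2 + 1) * (nrm (u - ?p u))\<^sup>2 < (\<bar>M\<bar> * 8 / e\<^sup>2 + 1) * (e / 2)\<^sup>2" by linarith
    moreover have "0 < \<bar>M\<bar> * 8 / e\<^sup>2 + 1" by (simp add: add_nonneg_pos)
    ultimately have "(nrm (u - ?p u))\<^sup>2 < (e / 2)\<^sup>2" by (simp only: mult_less_cancel_left_pos)
    then have 1: "nrm (u - ?p u) < e / 2" using e by (intro power2_less_imp_less[of _ "e / 2"]) auto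
    have eq: "x - ?p x = (u - ?p u) + ((x - u) - ?p (x - u))"
    proof -
      have "?p (x - u) = ?p x - ?p u"
        using x u by (simp add: proj_def ip_diff scaleR_diff_left sum_subtractf)
      then show ?thesis by simp
    qed
    have "nrm (x - ?p x) \<le> nrm (u - ?p u) + nrm ((x - u) - ?p (x - u))"
      unfolding eq using r pH by (intro nrm_triangle) auto
    also have "nrm ((x - u) - ?p (x - u)) \<le> nrm (x - u)" by (rule nrm_residual_le[OF phi_orthonormal r(2)])
    also have "nrm (x - u) = nrm (u - x)" using u x by (intro nrm_minus_commute) auto
    finally show "norm (nrm (x - ?p x) - 0) < e" using 1 u(2) x pH[of x] by simp
  qed
qed

end


section \<open>Semilinear equations at a spectral gap\<close>

text \<open>
  \<open>\<gamma>\<close> is a bounded subgradient of the convex function \<open>\<Gamma>\<close>. Its continuity is stated as an almost Lipschitz estimate,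
  which holds for superposition with a bounded uniformly continuous function.
\<close>

locale semilinear_problem = discrete_sa_operator H ip D A C E \<omega> \<kappa> for H :: "'a::real_vector set" and ip D A C E \<omega> \<kappa> +
  fixes \<Gamma> :: "'a \<Rightarrow> real" and \<gamma> :: "'a \<Rightarrow> 'a" and \<beta> :: real
  assumes gH: "\<And>x. x \<in> H \<Longrightarrow> \<gamma> x \<in> H"
    and g_bound: "\<And>x. x \<in> H \<Longrightarrow> nrm (\<gamma> x) \<le> \<beta>"
    and g_conv: "\<And>x y. x \<in> H \<Longrightarrow> y \<in> H \<Longrightarrow> \<Gamma> x + ip (\<gamma> x) (y - x) \<le> \<Gamma> y"
    and g_cont: "\<And>e. e > 0 \<Longrightarrow> \<exists>M. \<forall>x\<in>H. \<forall>y\<in>H. nrm (\<gamma> x - \<gamma> y) \<le> e + M * nrm (x - y)"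
begin

definition T :: "nat \<Rightarrow> fin_seq \<Rightarrow> 'a" where "T N c = (\<Sum>i<N. coord c i *\<^sub>R \<phi> i)"

lemma T_D [simp]: "T N c \<in> D" unfolding T_def by simp

lemma T_diff: "T N (c - d) = T N c - T N d"
  unfolding T_def by (simp add: scaleR_diff_left sum_subtractf)

lemma ip_T_phi: "i < N \<Longrightarrow> ip (T N c) (\<phi> i) = coord c i"
  unfolding T_def by (rule ip_combination[OF phi_orthonormal])

lemma ip_T: "y \<in> H \<Longrightarrow> ip y (T N c) = (\<Sum>i<N. ip y (\<phi> i) * coord c i)"
  unfolding T_def by (subst ip_sum_right) (auto simp: ip_scale_right mult.commute)

lemma inner_eq_sum: "c \<in> supported_on {..<N} \<Longrightarrow> c \<bullet> d = (\<Sum>i<N. coord c i * coord d i)"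
  by (rule inner_fin_seq_eq) (auto simp: supported_on_def)

lemma T_norm: "nrm (T N c) \<le> norm c"
proof -
  have "ip (T N c) (T N c) = (\<Sum>i<N. (coord c i)\<^sup>2)"
    unfolding T_def by (rule ip_combination_self[OF phi_orthonormal])
  also have "\<dots> \<le> (\<Sum>i\<in>{..<N} \<union> {i. coord c i \<noteq> 0}. (coord c i)\<^sup>2)"
    by (intro sum_mono2) (auto simp: finite_support)
  also have "\<dots> = c \<bullet> c"
    by (subst inner_fin_seq_eq[of "{..<N} \<union> {i. coord c i \<noteq> 0}"]) (auto simp: finite_support power2_eq_square)
  finally show ?thesis unfolding nrm_def norm_eq_sqrt_inner by (rule real_sqrt_le_mono)
qed

definition galerkin_grad :: "nat \<Rightarrow> fin_seq \<Rightarrow> fin_seq" where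
  "galerkin_grad N c = (\<Sum>i<N. ip (\<gamma> (T N c)) (\<phi> i) *\<^sub>R unit i)"

definition galerkin_op :: "nat \<Rightarrow> fin_seq \<Rightarrow> fin_seq" where
  "galerkin_op N c = (\<Sum>i<N. (eigval i * (c \<bullet> unit i)) *\<^sub>R unit i)"

lemma coord_galerkin_grad: "coord (galerkin_grad N c) i = (if i < N then ip (\<gamma> (T N c)) (\<phi> i) else 0)"
proof -
  have "coord (galerkin_grad N c) i = (\<Sum>j<N. if i = j then ip (\<gamma> (T N c)) (\<phi> j) else 0)"
    unfolding galerkin_grad_def coord_sum by (intro sum.cong) auto
  then show ?thesis by simp
qed

lemma coord_galerkin_op: "coord (galerkin_op N c) i = (if i < N then eigval i * coord c i else 0)"
proof -
  have "coord (galerkin_op N c) i = (\<Sum>j<N. if i = j then eigval j * coord c j else 0)"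
    unfolding galerkin_op_def coord_sum by (intro sum.cong) auto
  then show ?thesis by simp
qed

lemma norm_combination_le:
  assumes "y \<in> H" shows "norm (\<Sum>i<N. ip y (\<phi> i) *\<^sub>R unit i) \<le> nrm y"
proof -
  let ?s = "\<Sum>i<N. ip y (\<phi> i) *\<^sub>R unit i"
  have co: "coord ?s i = (if i < N then ip y (\<phi> i) else 0)" for i
  proof -
    have "coord ?s i = (\<Sum>j<N. if i = j then ip y (\<phi> j) else 0)"
      unfolding coord_sum by (intro sum.cong) auto
    then show ?thesis by simp
  qed
  have "?s \<bullet> ?s = (\<Sum>i<N. (ip y (\<phi> i))\<^sup>2)"
    by (subst inner_eq_sum[of _ N]) (auto simp: supported_on_def co power2_eq_square simp del: coord_sum)
  also have "\<dots> \<le> ip y y" by (rule bessel[OF phi_orthonormal assms])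
  finally show ?thesis unfolding nrm_def norm_eq_sqrt_inner by (rule real_sqrt_le_mono)
qed

lemma galerkin_grad_bound: "norm (galerkin_grad N c) \<le> \<beta>"
proof -
  have t: "T N c \<in> H" by simp
  show ?thesis unfolding galerkin_grad_def
    using norm_combination_le[OF gH[OF t], of N] g_bound[OF t] by linarith
qed

lemma galerkin_grad_diff: "norm (galerkin_grad N c - galerkin_grad N d) \<le> nrm (\<gamma> (T N c) - \<gamma> (T N d))"
proof -
  have t: "\<gamma> (T N c) \<in> H" "\<gamma> (T N d) \<in> H" by (simp_all add: gH)
  have "galerkin_grad N c - galerkin_grad N d = (\<Sum>i<N. ip (\<gamma> (T N c) - \<gamma> (T N d)) (\<phi> i) *\<^sub>R unit i)"
    using t by (simp add: galerkin_grad_def ip_diff scaleR_diff_left sum_subtractf)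
  then show ?thesis using norm_combination_le[of "\<gamma> (T N c) - \<gamma> (T N d)" N] t by simp
qed

lemma galerkin_grad_cont: "continuous_on UNIV (galerkin_grad N)"
  unfolding continuous_on_iff
proof (intro ballI allI impI)
  fix c :: fin_seq and e :: real assume e: "e > 0"
  obtain M where M: "\<And>x y. x \<in> H \<Longrightarrow> y \<in> H \<Longrightarrow> nrm (\<gamma> x - \<gamma> y) \<le> e / 2 + M * nrm (x - y)"
    using g_cont[of "e / 2"] e by auto
  show "\<exists>d>0. \<forall>c'\<in>UNIV. dist c' c < d \<longrightarrow> dist (galerkin_grad N c') (galerkin_grad N c) < e"
  proof (intro exI[of _ "e / (2 * (\<bar>M\<bar> + 1))"] conjI ballI impI)
    show "0 < e / (2 * (\<bar>M\<bar> + 1))" using e by simp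
    fix c' assume "dist c' c < e / (2 * (\<bar>M\<bar> + 1))"
    then have d: "(\<bar>M\<bar> + 1) * norm (c' - c) < e / 2" by (simp add: dist_norm field_simps)
    have "norm (galerkin_grad N c' - galerkin_grad N c) \<le> e / 2 + M * nrm (T N c' - T N c)"
      using galerkin_grad_diff[of N c' c] M[of "T N c'" "T N c"] by simp
    also have "M * nrm (T N c' - T N c) \<le> (\<bar>M\<bar> + 1) * norm (c' - c)"
      unfolding T_diff[symmetric] using T_norm[of N "c' - c"] by (intro mult_mono) auto
    finally show "dist (galerkin_grad N c') (galerkin_grad N c) < e" using d by (simp add: dist_norm)
  qed
qed

lemma galerkin_saddle:
  assumes mu: "\<mu> > 0" and gap: "eigval (Suc n) - eigval n > 8 * \<beta> / sqrt \<mu>" and N: "Suc n < N"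
  shows "saddle (supported_on {..n}) (supported_on {Suc n..<N}) (galerkin_op N) (\<lambda>c. \<Gamma> (T N c)) (galerkin_grad N)
    (eigval n) (eigval (Suc n)) \<beta> \<mu> (unit (Suc n))"
proof (rule saddle.intro)
  let ?P = "supported_on {..n}" and ?Q = "supported_on {Suc n..<N}"
  show "subspace ?P" "subspace ?Q" by (rule subspace_supported_on)+
  have L: "galerkin_op N d \<in> supported_on I" if "d \<in> supported_on I" for d I
    using that by (auto simp: supported_on_def coord_galerkin_op)
  show orth: "p \<bullet> q = 0" if "p \<in> ?P" "q \<in> ?Q" for p q
  proof -
    have "coord p i = 0 \<or> coord q i = 0" for i
      using that by (cases "i \<le> n") (auto simp: supported_on_def)
    then show ?thesis by (subst inner_fin_seq_eq[of "{}"]) auto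
  qed
  show "p \<bullet> galerkin_op N q = 0" if "p \<in> ?P" "q \<in> ?Q" for p q using orth L that by blast
  show "compact (?P \<inter> cball 0 r)" for r by (rule compact_supported_on) simp
  have sph: "?Q \<inter> sphere 0 1 = (?Q \<inter> cball 0 1) \<inter> sphere 0 1" by auto
  show "compact (?Q \<inter> sphere 0 1)"
  proof -
    have "sphere 0 1 = {x :: fin_seq. norm x = 1}" by auto
    also have "closed \<dots>" by (intro closed_Collect_eq continuous_intros)
    finally have "closed (sphere (0 :: fin_seq) 1)" .
    moreover have "compact (?Q \<inter> cball 0 1)" by (rule compact_supported_on) simp
    ultimately show ?thesis unfolding sph using compact_Int_closed by blast
  qed
  show "bounded_linear (galerkin_op N)"
  proof -
    have "galerkin_op N = (\<lambda>c. \<Sum>i<N. (eigval i * (c \<bullet> unit i)) *\<^sub>R unit i)"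
      by (rule ext) (simp add: galerkin_op_def)
    then show ?thesis by (simp only:) (intro bounded_linear_intros)
  qed
  have form: "x \<bullet> galerkin_op N y = (\<Sum>i<N. eigval i * coord x i * coord y i)" for x y
    by (subst inner_fin_seq_eq[of "{..<N}"]) (auto simp: coord_galerkin_op intro!: sum.cong)
  show "x \<bullet> galerkin_op N y = galerkin_op N x \<bullet> y" for x y
    unfolding form inner_commute[of _ y] by (simp add: mult.commute mult.left_commute)
  show "p \<bullet> galerkin_op N p \<le> eigval n * (p \<bullet> p)" if p: "p \<in> ?P" for p
  proof -
    have "p \<in> supported_on {..<N}" using p N by (auto simp: supported_on_def)
    then have "eigval n * (p \<bullet> p) = (\<Sum>i<N. eigval n * coord p i * coord p i)"
      by (simp add: inner_eq_sum sum_distrib_left mult.assoc)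
    moreover have "eigval i * coord p i * coord p i \<le> eigval n * coord p i * coord p i" for i
      using p mult_right_mono[OF eigval_mono[of i n], of "coord p i * coord p i"]
      by (cases "i \<le> n") (auto simp: supported_on_def mult.assoc)
    ultimately show ?thesis unfolding form by (simp add: sum_mono)
  qed
  show "eigval (Suc n) * (q \<bullet> q) \<le> q \<bullet> galerkin_op N q" if q: "q \<in> ?Q" for q
  proof -
    have "q \<in> supported_on {..<N}" using q by (auto simp: supported_on_def)
    then have "eigval (Suc n) * (q \<bullet> q) = (\<Sum>i<N. eigval (Suc n) * coord q i * coord q i)"
      by (simp add: inner_eq_sum sum_distrib_left mult.assoc)
    moreover have "eigval (Suc n) * coord q i * coord q i \<le> eigval i * coord q i * coord q i" for i
      using q mult_right_mono[OF eigval_mono[of "Suc n" i], of "coord q i * coord q i"]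
      by (cases "Suc n \<le> i") (auto simp: supported_on_def mult.assoc)
    ultimately show ?thesis unfolding form by (simp add: sum_mono)
  qed
  show "\<Gamma> (T N x) + galerkin_grad N x \<bullet> (y - x) \<le> \<Gamma> (T N y)" for x y
  proof -
    have "galerkin_grad N x \<bullet> (y - x) = (\<Sum>i<N. ip (\<gamma> (T N x)) (\<phi> i) * coord (y - x) i)"
      by (subst inner_eq_sum[of _ N]) (auto simp: supported_on_def coord_galerkin_grad)
    also have "\<dots> = ip (\<gamma> (T N x)) (T N y - T N x)"
      unfolding T_diff[symmetric] by (rule ip_T[symmetric]) (simp add: gH)
    finally show ?thesis using g_conv[of "T N x" "T N y"] by simp
  qed
  show "continuous_on UNIV (galerkin_grad N)" by (rule galerkin_grad_cont)
  show "norm (galerkin_grad N x) \<le> \<beta>" for x by (rule galerkin_grad_bound)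
  show "\<mu> > 0" by fact
  show "8 * \<beta> / sqrt \<mu> < eigval (Suc n) - eigval n" by fact
  show "unit (Suc n) \<in> ?Q" using N by (auto simp: supported_on_def)
  show "norm (unit (Suc n)) = 1" by (simp add: norm_eq_sqrt_inner)
  show "unit (Suc n) \<bullet> galerkin_op N (unit (Suc n)) = eigval (Suc n)"
    using N by (simp add: inner_commute[of "unit (Suc n)"] coord_galerkin_op)
qed

lemma galerkin_solution:
  assumes mu: "\<mu> > 0" and gap: "eigval (Suc n) - eigval n > 8 * \<beta> / sqrt \<mu>" and N: "Suc n < N"
  shows "\<exists>u \<nu>. u \<in> D \<and> ip u u = \<mu> \<and>
     (\<forall>i<N. eigval i * ip u (\<phi> i) - ip (\<gamma> u) (\<phi> i) = \<nu> * ip u (\<phi> i)) \<and>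
     eigval (Suc n) - 2 * \<beta> / sqrt \<mu> \<le> \<nu> \<and> \<nu> \<le> eigval (Suc n) + 5 * \<beta> / sqrt \<mu> \<and>
     ip (A u) u \<le> \<mu> * eigval (Suc n) + 4 * \<beta> * sqrt \<mu>"
proof -
  interpret s: saddle "supported_on {..n}" "supported_on {Suc n..<N}" "galerkin_op N" "\<lambda>c. \<Gamma> (T N c)"
    "galerkin_grad N" "eigval n" "eigval (Suc n)" \<beta> \<mu> "unit (Suc n)"
    using assms by (rule galerkin_saddle)
  obtain c \<nu> where c: "c \<in> {p + q | p q. p \<in> supported_on {..n} \<and> q \<in> supported_on {Suc n..<N}}"
    and cc: "c \<bullet> c = \<mu>"
    and eq: "\<And>h. h \<in> supported_on {..n} \<union> supported_on {Suc n..<N} \<Longrightarrow> (galerkin_op N c - galerkin_grad N c) \<bullet> h = \<nu> * (c \<bullet> h)"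
    and nu: "eigval (Suc n) - 2 * \<beta> / sqrt \<mu> \<le> \<nu>" "\<nu> \<le> eigval (Suc n) + 5 * \<beta> / sqrt \<mu>"
    and en: "c \<bullet> galerkin_op N c \<le> \<mu> * eigval (Suc n) + 4 * \<beta> * sqrt \<mu>"
    using s.saddle_point by blast
  have cs: "c \<in> supported_on {..<N}" using c N by (auto simp: supported_on_def)
  have "ip (T N c) (T N c) = c \<bullet> c"
    unfolding T_def by (subst ip_combination_self[OF phi_orthonormal]) (simp add: inner_eq_sum[OF cs] power2_eq_square)
  moreover have "ip (A (T N c)) (T N c) = c \<bullet> galerkin_op N c"
    unfolding T_def by (subst A_combination) (auto simp: inner_eq_sum[OF cs] coord_galerkin_op power2_eq_square intro!: sum.cong)
  moreover have "eigval i * ip (T N c) (\<phi> i) - ip (\<gamma> (T N c)) (\<phi> i) = \<nu> * ip (T N c) (\<phi> i)" if i: "i < N" for i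
  proof -
    have "unit i \<in> supported_on {..n} \<union> supported_on {Suc n..<N}" using i by (auto simp: supported_on_def)
    from eq[OF this] show ?thesis using i by (simp add: coord_galerkin_op coord_galerkin_grad ip_T_phi)
  qed
  ultimately show ?thesis using cc nu en by (intro exI[of _ "T N c"] exI[of _ \<nu>]) auto
qed

text \<open>
  The solutions of the projected problems in the first \<open>N\<close> eigenvectors have bounded form and bounded multipliers, so a
  subsequence converges. The limit satisfies the equation tested with each eigenvector, hence by completeness with
  each element of \<open>D\<close>, and so it lies in the domain of the adjoint.
\<close>

theorem solution_above_gap:
  assumes mu: "\<mu> > 0" and gap: "eigval (Suc n) - eigval n > 8 * \<beta> / sqrt \<mu>"
  shows "\<exists>u \<nu>. u \<in> D \<and> ip u u = \<mu> \<and> \<nu> \<ge> eigval (Suc n) - 2 * \<beta> / sqrt \<mu> \<and>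
     (\<forall>y\<in>H. ip (A u) y = \<nu> * ip u y + ip (\<gamma> u) y)"
proof -
  define a where "a = eigval (Suc n) - 2 * \<beta> / sqrt \<mu>"
  define b where "b = eigval (Suc n) + 5 * \<beta> / sqrt \<mu>"
  define M0 where "M0 = max \<mu> (\<mu> * eigval (Suc n) + 4 * \<beta> * sqrt \<mu>)"
  have "\<exists>u \<nu>. u \<in> D \<and> ip u u = \<mu> \<and>
     (\<forall>i<Suc (Suc (n + k)). eigval i * ip u (\<phi> i) - ip (\<gamma> u) (\<phi> i) = \<nu> * ip u (\<phi> i)) \<and>
     a \<le> \<nu> \<and> \<nu> \<le> b \<and> ip (A u) u \<le> M0" for k
    using galerkin_solution[OF mu gap, of "Suc (Suc (n + k))"] unfolding a_def b_def M0_def by (force simp: le_max_iff_disj)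
  then obtain U V where U: "\<And>k. U k \<in> D" "\<And>k. ip (U k) (U k) = \<mu>" "\<And>k. ip (A (U k)) (U k) \<le> M0"
    and V: "\<And>k. a \<le> V k" "\<And>k. V k \<le> b"
    and eq: "\<And>k i. i < Suc (Suc (n + k)) \<Longrightarrow> eigval i * ip (U k) (\<phi> i) - ip (\<gamma> (U k)) (\<phi> i) = V k * ip (U k) (\<phi> i)"
    by metis
  have "ip (U k) (U k) \<le> M0" for k using U(2) by (simp add: M0_def)
  then obtain r v where r: "strict_mono (r :: nat \<Rightarrow> nat)" and v: "v \<in> H" and lim: "(\<lambda>k. nrm (U (r k) - v)) \<longlonglongrightarrow> 0"
    using compact[of U M0] U by blast
  have "\<forall>k. (V \<circ> r) k \<in> {a..b}" using V by simp
  then obtain \<nu> s where nu: "\<nu> \<in> {a..b}" and s: "strict_mono (s :: nat \<Rightarrow> nat)" and lims: "((V \<circ> r) \<circ> s) \<longlonglongrightarrow> \<nu>"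
    using compact_Icc[of a b] unfolding compact_def by metis
  define t where "t = r \<circ> s"
  have t: "strict_mono t" unfolding t_def using r s by (rule strict_mono_o)
  have limU: "(\<lambda>k. nrm (U (t k) - v)) \<longlonglongrightarrow> 0"
    using LIMSEQ_subseq_LIMSEQ[OF lim s] by (simp add: t_def o_def)
  have limV: "(\<lambda>k. V (t k)) \<longlonglongrightarrow> \<nu>" using lims by (simp add: t_def o_def)
  have UH: "U (t k) \<in> H" for k using U(1) by simp
  have limg: "(\<lambda>k. nrm (\<gamma> (U (t k)) - \<gamma> v)) \<longlonglongrightarrow> 0"
  proof (rule LIMSEQ_I)
    fix e :: real assume e: "e > 0"
    obtain M where M: "\<And>x y. x \<in> H \<Longrightarrow> y \<in> H \<Longrightarrow> nrm (\<gamma> x - \<gamma> y) \<le> e / 2 + M * nrm (x - y)"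
      using g_cont[of "e / 2"] e by auto
    have "(\<lambda>k. M * nrm (U (t k) - v)) \<longlonglongrightarrow> 0" by (rule tendsto_mult_right_zero[OF limU])
    then have "eventually (\<lambda>k. M * nrm (U (t k) - v) < e / 2) sequentially"
      by (rule order_tendstoD) (use e in simp)
    then obtain k0 where k0: "\<And>k. k \<ge> k0 \<Longrightarrow> M * nrm (U (t k) - v) < e / 2"
      unfolding eventually_sequentially by blast
    show "\<exists>k0. \<forall>k\<ge>k0. norm (nrm (\<gamma> (U (t k)) - \<gamma> v) - 0) < e"
    proof (intro exI[of _ k0] allI impI)
      fix k assume "k \<ge> k0"
      then have "nrm (\<gamma> (U (t k)) - \<gamma> v) < e" using k0[of k] M[OF UH[of k] v] by linarith
      then show "norm (nrm (\<gamma> (U (t k)) - \<gamma> v) - 0) < e" using UH[of k] v by (simp add: gH)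
    qed
  qed
  \<comment> \<open>The limit solves the equation tested with each eigenvector.\<close>
  have eqi: "eigval i * ip v (\<phi> i) = ip (\<nu> *\<^sub>R v + \<gamma> v) (\<phi> i)" for i
  proof -
    have l1: "(\<lambda>k. ip (U (t k)) (\<phi> i)) \<longlonglongrightarrow> ip v (\<phi> i)" by (intro tendsto_ip[OF UH v _ limU]) simp
    have l2: "(\<lambda>k. ip (\<gamma> (U (t k))) (\<phi> i)) \<longlonglongrightarrow> ip (\<gamma> v) (\<phi> i)"
      by (intro tendsto_ip[OF gH[OF UH] gH[OF v] _ limg]) simp
    have "(\<lambda>k. eigval i * ip (U (t k)) (\<phi> i) - ip (\<gamma> (U (t k))) (\<phi> i) - V (t k) * ip (U (t k)) (\<phi> i))
      \<longlonglongrightarrow> eigval i * ip v (\<phi> i) - ip (\<gamma> v) (\<phi> i) - \<nu> * ip v (\<phi> i)"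
      by (intro tendsto_diff tendsto_mult tendsto_const l1 l2 limV)
    moreover have ev: "eventually (\<lambda>k. eigval i * ip (U (t k)) (\<phi> i) - ip (\<gamma> (U (t k))) (\<phi> i) - V (t k) * ip (U (t k)) (\<phi> i) = 0) sequentially"
      unfolding eventually_sequentially
    proof (intro exI[of _ i] allI impI)
      fix k assume "i \<le> k"
      then have "i < Suc (Suc (n + t k))" using seq_suble[OF t, of k] by linarith
      from eq[OF this] show "eigval i * ip (U (t k)) (\<phi> i) - ip (\<gamma> (U (t k))) (\<phi> i) - V (t k) * ip (U (t k)) (\<phi> i) = 0" by simp
    qed
    ultimately have "eigval i * ip v (\<phi> i) - ip (\<gamma> v) (\<phi> i) - \<nu> * ip v (\<phi> i) = 0"
      using LIMSEQ_unique tendsto_eventually[OF ev] by blast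
    then show ?thesis using v by (simp add: ip_add ip_scale gH)
  qed
  define y where "y = \<nu> *\<^sub>R v + \<gamma> v"
  have y: "y \<in> H" unfolding y_def using v gH by simp
  \<comment> \<open>Expanding \<open>A w\<close> and \<open>w\<close> in eigenvectors extends the equation to all test elements \<open>w\<close> of the domain.\<close>
  have proj_lim: "(\<lambda>m. ip (proj \<phi> m x) z) \<longlonglongrightarrow> ip x z" if "x \<in> H" "z \<in> H" for x z
  proof (rule tendsto_ip[OF proj_H[OF phi_orthonormal] that])
    show "(\<lambda>m. nrm (proj \<phi> m x - x)) \<longlonglongrightarrow> 0"
      using complete[OF that(1)] nrm_minus_commute[OF that(1) proj_H[OF phi_orthonormal]] by simp
  qed
  have weak: "ip (A w) v = ip w y" if w: "w \<in> D" for w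
  proof -
    have "ip (proj \<phi> m (A w)) v = ip (proj \<phi> m w) y" for m
      using w v y by (simp add: ip_proj[OF phi_orthonormal] A_phi_right eqi[folded y_def, symmetric] mult.commute mult.left_commute)
    then show ?thesis
      using LIMSEQ_unique[OF proj_lim[of "A w" v]] proj_lim[of w y] w v y by simp
  qed
  obtain u where u: "u \<in> D" "ip (u - v) (u - v) = 0" "ip (A u - y) (A u - y) = 0"
    using closed[OF v y weak] by blast
  have uz: "ip u z = ip v z" if "z \<in> H" for z using null_diff_ip[of u v z] u v that by simp
  have vv: "ip v v = \<mu>" using LIMSEQ_unique[OF tendsto_ip_self[OF UH v limU]] U(2) by simp
  have "ip u u = \<mu>" using uz[of u] uz[of v] ip_sym[of v u] u v vv by simp
  moreover have "ip (A u) z = \<nu> * ip u z + ip (\<gamma> u) z" if z: "z \<in> H" for z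
  proof -
    have "ip (A u) z = ip y z" using null_diff_ip[of "A u" y z] u y z by simp
    moreover have "ip (\<gamma> u - \<gamma> v) (\<gamma> u - \<gamma> v) = 0"
    proof -
      have "nrm (\<gamma> u - \<gamma> v) \<le> 0 + e" if "e > 0" for e
      proof -
        have "nrm (u - v) = 0" using u v by (simp add: nrm_eq_0)
        moreover obtain M where "\<forall>x\<in>H. \<forall>y\<in>H. nrm (\<gamma> x - \<gamma> y) \<le> e + M * nrm (x - y)"
          using g_cont[OF \<open>e > 0\<close>] by blast
        then have "nrm (\<gamma> u - \<gamma> v) \<le> e + M * nrm (u - v)" using u(1) v D_H by blast
        ultimately show ?thesis by simp
      qed
      then have "nrm (\<gamma> u - \<gamma> v) \<le> 0" by (rule field_le_epsilon)
      moreover have "\<gamma> u - \<gamma> v \<in> H" using u v gH by simp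
      ultimately show ?thesis using nrm_nonneg nrm_eq_0 by (metis order_antisym)
    qed
    ultimately show ?thesis
      using uz[OF z] null_diff_ip[of "\<gamma> u" "\<gamma> v" z] u v z by (simp add: y_def ip_add ip_scale gH)
  qed
  ultimately show ?thesis using u(1) nu unfolding a_def by (intro exI[of _ u] exI[of _ \<nu>]) auto
qed

end


section \<open>Integration by parts and the lemma of du Bois-Reymond\<close>

lemma set_integrable_continuous: "continuous_on {a..b} f \<Longrightarrow> set_integrable lborel {a..b::real} (f :: real \<Rightarrow> real)"
  by (rule borel_integrable_atLeastAtMost')

lemma LBINT_continuous: "continuous_on {a..b} f \<Longrightarrow> (LBINT x:{a..b}. f x) = integral {a..b::real} (f :: real \<Rightarrow> real)"
  by (rule set_borel_integral_eq_integral(2)[OF set_integrable_continuous])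

lemma LBINT_cong: "(\<And>x. x \<in> {a..b} \<Longrightarrow> f x = g x) \<Longrightarrow> (LBINT x:{a..b::real}. f x) = (LBINT x:{a..b}. (g x :: real))"
  by (rule set_lebesgue_integral_cong) auto

lemma LBINT_derivative:
  fixes \<phi> :: "real \<Rightarrow> real"
  assumes "a \<le> b" and d: "\<And>x. x \<in> {a..b} \<Longrightarrow> (\<phi> has_real_derivative \<phi>' x) (at x within {a..b})"
    and c: "continuous_on {a..b} \<phi>'"
  shows "(LBINT x:{a..b}. \<phi>' x) = \<phi> b - \<phi> a"
  unfolding LBINT_continuous[OF c]
  by (rule integral_unique[OF fundamental_theorem_of_calculus[OF assms(1)]])
     (use d in \<open>simp add: has_real_derivative_iff_has_vector_derivative\<close>)

lemma set_borel_measurable_mult: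
  fixes f g :: "real \<Rightarrow> real"
  assumes "set_borel_measurable M A f" "set_borel_measurable M A g"
  shows "set_borel_measurable M A (\<lambda>x. f x * g x)"
proof -
  have "(\<lambda>x. (indicator A x *\<^sub>R f x) * (indicator A x *\<^sub>R g x)) \<in> borel_measurable M"
    using assms unfolding set_borel_measurable_def by (rule borel_measurable_times)
  also have "(\<lambda>x. (indicator A x *\<^sub>R f x) * (indicator A x *\<^sub>R g x)) = (\<lambda>x. indicator A x *\<^sub>R (f x * g x))"
    by (rule ext) (simp add: indicator_def)
  finally show ?thesis by (simp add: set_borel_measurable_def)
qed

lemma set_integrable_imp_measurable:
  "set_integrable M A f \<Longrightarrow> set_borel_measurable M A (f :: real \<Rightarrow> real)"
  by (auto simp: set_integrable_def set_borel_measurable_def)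

lemma set_integrable_mult_continuous:
  fixes h \<phi> :: "real \<Rightarrow> real"
  assumes h: "set_integrable lborel {0..l} h" and c: "continuous_on {0..l} \<phi>"
  shows "set_integrable lborel {0..l} (\<lambda>x. h x * \<phi> x)"
proof -
  have "bounded (\<phi> ` {0..l})" by (intro compact_imp_bounded compact_continuous_image c compact_Icc)
  then obtain B where B: "\<forall>x\<in>{0..l}. \<bar>\<phi> x\<bar> \<le> B" unfolding bounded_iff by auto
  have m: "set_borel_measurable lborel {0..l} (\<lambda>x. h x * \<phi> x)"
    by (intro set_borel_measurable_mult set_integrable_imp_measurable h set_integrable_continuous c)
  have "set_integrable lborel {0..l} (\<lambda>x. h x * B)" using h by simp
  then show ?thesis
  proof (rule set_integrable_bound[OF _ m], intro AE_I2 impI)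
    fix x assume "x \<in> {0..l}"
    then have "\<bar>\<phi> x\<bar> \<le> \<bar>B\<bar>" using B by force
    then show "norm (h x * \<phi> x) \<le> norm (h x * B)" by (simp add: abs_mult mult_left_mono)
  qed
qed

text \<open>
  Here \<open>h\<close> is merely integrable, so its primitive need not be differentiable everywhere; both sides come from the
  integral of \<open>h t * \<phi>' x\<close> over the triangle \<open>t \<le> x\<close> by Fubini's theorem.
\<close>

lemma integration_by_parts:
  fixes h \<phi> :: "real \<Rightarrow> real"
  assumes h: "set_integrable lborel {0..l} h" and l: "0 \<le> l"
    and d: "\<And>x. x \<in> {0..l} \<Longrightarrow> (\<phi> has_real_derivative \<phi>' x) (at x within {0..l})"
    and c: "continuous_on {0..l} \<phi>'"
  shows "(LBINT x:{0..l}. h x * \<phi> x) = \<phi> l * (LBINT x:{0..l}. h x) - (LBINT x:{0..l}. (LBINT t:{0..x}. h t) * \<phi>' x)"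
proof -
  define a where "a x = indicator {0..l} x * \<phi>' x" for x
  define b where "b t = indicator {0..l} t * h t" for t
  have a: "integrable lborel a" using set_integrable_continuous[OF c] by (simp add: set_integrable_def a_def[abs_def])
  have b: "integrable lborel b" using h by (simp add: set_integrable_def b_def[abs_def])
  have [measurable]: "a \<in> borel_measurable borel" "b \<in> borel_measurable borel"
    using a b by (auto dest: borel_measurable_integrable)
  define f where "f x t = a x * b t * (if t \<le> x then 1 else 0)" for x t :: real
  have prod: "integrable (lborel \<Otimes>\<^sub>M lborel) (\<lambda>(x, t). a x * b t)"
  proof (rule lborel_pair.Fubini_integrable)
    show "(\<lambda>(x, t). a x * b t) \<in> borel_measurable (lborel \<Otimes>\<^sub>M lborel)" by measurable
    show "integrable lborel (\<lambda>x. LINT t|lborel. norm (case (x, t) of (x, t) \<Rightarrow> a x * b t))"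
      using a by (simp add: abs_mult)
    show "AE x in lborel. integrable lborel (\<lambda>t. case (x, t) of (x, t) \<Rightarrow> a x * b t)"
      using b by simp
  qed
  have "integrable (lborel \<Otimes>\<^sub>M lborel) (\<lambda>(x, t). f x t)"
  proof (rule Bochner_Integration.integrable_bound[OF prod])
    show "(\<lambda>(x, t). f x t) \<in> borel_measurable (lborel \<Otimes>\<^sub>M lborel)" unfolding f_def by measurable
  qed (auto simp: f_def)
  then have fub: "(LINT t|lborel. LINT x|lborel. f x t) = (LINT x|lborel. LINT t|lborel. f x t)"
    by (rule lborel_pair.Fubini_integral)
  have inner1: "(LINT t|lborel. f x t) = indicator {0..l} x *\<^sub>R ((LBINT t:{0..x}. h t) * \<phi>' x)" for x
  proof (cases "x \<in> {0..l}")
    case True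
    have "f x t = (indicator {0..x} t *\<^sub>R h t) * \<phi>' x" for t
      using True by (auto simp: f_def a_def b_def indicator_def)
    then show ?thesis using True by (simp add: set_lebesgue_integral_def)
  qed (simp add: f_def a_def)
  have inner2: "(LINT x|lborel. f x t) = indicator {0..l} t *\<^sub>R (h t * (\<phi> l - \<phi> t))" for t
  proof (cases "t \<in> {0..l}")
    case True
    have "f x t = h t * (indicator {t..l} x *\<^sub>R \<phi>' x)" for x
      using True by (auto simp: f_def a_def b_def indicator_def)
    then have "(LINT x|lborel. f x t) = h t * (LBINT x:{t..l}. \<phi>' x)"
      by (simp add: set_lebesgue_integral_def)
    also have "(LBINT x:{t..l}. \<phi>' x) = \<phi> l - \<phi> t"
      using True c by (intro LBINT_derivative continuous_on_subset[OF c] DERIV_subset[OF d]) auto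
    finally show ?thesis using True by simp
  qed (simp add: f_def b_def)
  have cphi: "continuous_on {0..l} \<phi>" using d by (intro DERIV_continuous_on)
  have hphi: "set_integrable lborel {0..l} (\<lambda>x. h x * \<phi> x)"
    by (rule set_integrable_mult_continuous[OF h cphi])
  have "(LBINT x:{0..l}. (LBINT t:{0..x}. h t) * \<phi>' x) = (LBINT t:{0..l}. h t * (\<phi> l - \<phi> t))"
    using fub unfolding inner1 inner2 by (simp add: set_lebesgue_integral_def)
  also have "\<dots> = (LBINT t:{0..l}. \<phi> l * h t - h t * \<phi> t)" by (simp add: algebra_simps)
  also have "\<dots> = \<phi> l * (LBINT x:{0..l}. h x) - (LBINT x:{0..l}. h x * \<phi> x)"
    using h hphi by (subst set_integral_diff) auto
  finally show ?thesis by simp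
qed

lemma primitive_continuous:
  assumes "set_integrable lborel {0..l} (h :: real \<Rightarrow> real)"
  shows "continuous_on {0..l} (\<lambda>x. LBINT t:{0..x}. h t)"
proof -
  have "continuous_on {0..l} (\<lambda>x. integral {0..x} h)"
    by (rule indefinite_integral_continuous_1[OF set_borel_integral_eq_integral(1)[OF assms]])
  moreover have "(LBINT t:{0..x}. h t) = integral {0..x} h" if "x \<in> {0..l}" for x
    using that by (intro set_borel_integral_eq_integral(2) set_integrable_subset[OF assms]) auto
  ultimately show ?thesis using continuous_on_cong[OF refl, of "{0..l}"] by (metis (no_types, lifting))
qed

lemma LBINT_split:
  assumes "set_integrable lborel {0..l} (h :: real \<Rightarrow> real)" "0 \<le> a" "a \<le> b" "b \<le> l"
  shows "(LBINT t:{a<..b}. h t) = (LBINT t:{0..b}. h t) - (LBINT t:{0..a}. h t)"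
proof -
  have "{0..b} = {0..a} \<union> {a<..b}" using assms by auto
  then have "(LBINT t:{0..b}. h t) = (LBINT t:{0..a} \<union> {a<..b}. h t)" by simp
  also have "\<dots> = (LBINT t:{0..a}. h t) + (LBINT t:{a<..b}. h t)"
    using assms by (intro set_integral_Un set_integrable_subset[OF assms(1)]) auto
  finally show ?thesis by simp
qed

lemma positive_part_square_derivative:
  "((\<lambda>x::real. (max 0 (x - a))\<^sup>2 / 2) has_real_derivative max 0 (x - a)) (at x)"
proof (cases x a rule: linorder_cases)
  case less
  have "((\<lambda>x::real. 0) has_real_derivative 0) (at x)" by simp
  then show ?thesis using less
    by (subst DERIV_cong_ev[OF refl, of _ "\<lambda>_. 0"])
       (auto simp: max_def intro!: eventually_mono[OF eventually_nhds_in_open[of "{..<a}"]])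
next
  case greater
  have "((\<lambda>x::real. (x - a)\<^sup>2 / 2) has_real_derivative x - a) (at x)" by (auto intro!: derivative_eq_intros)
  then show ?thesis using greater
    by (subst DERIV_cong_ev[OF refl, of _ "\<lambda>x. (x - a)\<^sup>2 / 2"])
       (auto simp: max_def intro!: eventually_mono[OF eventually_nhds_in_open[of "{a<..}"]])
next
  case equal
  have "((\<lambda>h. ((max 0 h)\<^sup>2 / 2) / h) \<longlongrightarrow> 0) (at (0::real))"
  proof (rule Lim_null_comparison)
    show "\<forall>\<^sub>F h in at (0::real). norm ((max 0 h)\<^sup>2 / 2 / h) \<le> \<bar>h\<bar>"
      by (intro always_eventually) (auto simp: max_def power2_eq_square)
  qed (auto intro!: tendsto_eq_intros)
  then show ?thesis using equal by (simp add: DERIV_def)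
qed

lemma test_functionD:
  assumes "\<phi> \<in> test_functions l" "0 < l"
  shows "(\<phi> has_real_derivative deriv \<phi> x) (at x)" "continuous_on A (deriv \<phi>)" "\<phi> l = 0" "\<phi> 0 = 0"
proof -
  from assms obtain a b where ab: "0 < a" "b < l" "\<And>x. x \<notin> {a..b} \<Longrightarrow> \<phi> x = 0"
    and d: "\<And>x. \<phi> differentiable (at x)" and c: "continuous_on UNIV (deriv \<phi>)"
    unfolding test_functions_def by blast
  show "(\<phi> has_real_derivative deriv \<phi> x) (at x)"
    using d[of x] by (simp add: DERIV_deriv_iff_real_differentiable)
  show "continuous_on A (deriv \<phi>)" using c by (rule continuous_on_subset) simp
  show "\<phi> l = 0" "\<phi> 0 = 0" using ab by auto
qed

text \<open>
  A continuously differentiable step from \<open>0\<close> to \<open>1\<close>. Its derivative is a trapezoid of height \<open>1 / (b - a)\<close>, supported in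
  \<open>[a, b + \<epsilon>]\<close>, which tends to the normalised indicator function of \<open>(a, b]\<close>.
\<close>

definition bump :: "real \<Rightarrow> real \<Rightarrow> real \<Rightarrow> real \<Rightarrow> real" where
  "bump \<epsilon> a b x = ((max 0 (x - a))\<^sup>2 / 2 - (max 0 (x - (a + \<epsilon>)))\<^sup>2 / 2
      - (max 0 (x - b))\<^sup>2 / 2 + (max 0 (x - (b + \<epsilon>)))\<^sup>2 / 2) / (\<epsilon> * (b - a))"

definition bump_deriv :: "real \<Rightarrow> real \<Rightarrow> real \<Rightarrow> real \<Rightarrow> real" where
  "bump_deriv \<epsilon> a b x = (max 0 (x - a) - max 0 (x - (a + \<epsilon>)) - max 0 (x - b) + max 0 (x - (b + \<epsilon>))) / (\<epsilon> * (b - a))"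

lemma bump_has_deriv: "(bump \<epsilon> a b has_real_derivative bump_deriv \<epsilon> a b x) (at x)"
  unfolding bump_def[abs_def] bump_deriv_def
  by (intro DERIV_cdivide DERIV_add DERIV_diff positive_part_square_derivative)

lemma bump_left: "x \<le> a \<Longrightarrow> a < b \<Longrightarrow> 0 < \<epsilon> \<Longrightarrow> bump \<epsilon> a b x = 0"
  by (simp add: bump_def max_def)

lemma bump_right: "b + \<epsilon> \<le> x \<Longrightarrow> a < b \<Longrightarrow> 0 < \<epsilon> \<Longrightarrow> bump \<epsilon> a b x = 1"
  by (simp add: bump_def max_def power2_eq_square field_simps)

lemma bump_difference_test_function:
  assumes "0 < a" "a < b" "0 < c" "c < d" "0 < \<epsilon>" "b + \<epsilon> < l" "d + \<epsilon> < l"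
  shows "(\<lambda>x. bump \<epsilon> a b x - bump \<epsilon> c d x) \<in> test_functions l"
    "deriv (\<lambda>x. bump \<epsilon> a b x - bump \<epsilon> c d x) = (\<lambda>x. bump_deriv \<epsilon> a b x - bump_deriv \<epsilon> c d x)"
proof -
  have D: "((\<lambda>x. bump \<epsilon> a b x - bump \<epsilon> c d x) has_real_derivative bump_deriv \<epsilon> a b x - bump_deriv \<epsilon> c d x) (at x)" for x
    by (intro DERIV_diff bump_has_deriv)
  then show e: "deriv (\<lambda>x. bump \<epsilon> a b x - bump \<epsilon> c d x) = (\<lambda>x. bump_deriv \<epsilon> a b x - bump_deriv \<epsilon> c d x)"
    by (intro ext DERIV_imp_deriv)
  have "continuous_on UNIV (\<lambda>x. bump_deriv \<epsilon> a b x - bump_deriv \<epsilon> c d x)"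
    unfolding bump_deriv_def using assms by (intro continuous_intros) auto
  moreover have "bump \<epsilon> a b x - bump \<epsilon> c d x = 0" if "x \<notin> {min a c..max (b + \<epsilon>) (d + \<epsilon>)}" for x
    using that assms by (cases "x < min a c") (auto simp: bump_left bump_right)
  moreover have "0 < min a c" "max (b + \<epsilon>) (d + \<epsilon>) < l" using assms by auto
  ultimately show "(\<lambda>x. bump \<epsilon> a b x - bump \<epsilon> c d x) \<in> test_functions l"
    unfolding test_functions_def mem_Collect_eq e
    using D by (intro conjI allI exI[of _ "min a c"] exI[of _ "max (b + \<epsilon>) (d + \<epsilon>)"] impI)
      (auto simp: real_differentiable_def)
qed

lemma bump_deriv_bound: assumes "a < b" "0 < \<epsilon>" shows "\<bar>bump_deriv \<epsilon> a b x\<bar> \<le> 1 / (b - a)"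
proof -
  let ?n = "max 0 (x - a) - max 0 (x - (a + \<epsilon>)) - max 0 (x - b) + max 0 (x - (b + \<epsilon>))"
  have "\<bar>?n\<bar> \<le> \<epsilon>" using assms by (simp add: max_def)
  then have "\<bar>?n\<bar> / (\<epsilon> * (b - a)) \<le> \<epsilon> / (\<epsilon> * (b - a))"
    using assms by (intro divide_right_mono) auto
  then show ?thesis using assms by (simp add: bump_deriv_def abs_mult)
qed

lemma bump_deriv_tendsto:
  assumes "a < b" and e: "\<And>k. 0 < \<epsilon> k" "\<epsilon> \<longlonglongrightarrow> 0"
  shows "(\<lambda>k::nat. bump_deriv (\<epsilon> k) a b x) \<longlonglongrightarrow> indicator {a<..b} x / (b - a)"
proof -
  have eq: "bump_deriv (\<epsilon> k) a b x = indicator {a<..b} x / (b - a)"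
    if k: "\<epsilon> k < \<bar>x - a\<bar> \<or> x = a" "\<epsilon> k < \<bar>x - b\<bar> \<or> x = b" "\<epsilon> k < b - a" for k
    using assms(1) e(1)[of k] k by (auto simp: bump_deriv_def max_def indicator_def field_simps split: if_splits)
  have ev: "eventually (\<lambda>k. \<epsilon> k < y) sequentially" if "y > 0" for y
    using order_tendstoD(2)[OF e(2) that] .
  have "eventually (\<lambda>k. \<epsilon> k < \<bar>x - a\<bar> \<or> x = a) sequentially" "eventually (\<lambda>k. \<epsilon> k < \<bar>x - b\<bar> \<or> x = b) sequentially"
    "eventually (\<lambda>k. \<epsilon> k < b - a) sequentially"
    using ev[of "\<bar>x - a\<bar>"] ev[of "\<bar>x - b\<bar>"] ev[of "b - a"] assms(1)
    by (cases "x = a"; cases "x = b"; simp)+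
  then have "eventually (\<lambda>k. bump_deriv (\<epsilon> k) a b x = indicator {a<..b} x / (b - a)) sequentially"
    by eventually_elim (rule eq)
  then show ?thesis by (rule tendsto_eventually)
qed

text \<open>
  Differences of two steps are test functions, and in the limit they show that the mean values of \<open>p\<close> over any two subintervals
  agree. Phrasing the conclusion with the primitive of \<open>p\<close> avoids statements almost everywhere.
\<close>

lemma du_Bois_Reymond:
  assumes l: "0 < l" and p: "set_integrable lborel {0..l} (p :: real \<Rightarrow> real)"
    and z: "\<And>\<phi>. \<phi> \<in> test_functions l \<Longrightarrow> (LBINT x:{0..l}. p x * deriv \<phi> x) = 0"
  shows "\<exists>K. \<forall>x\<in>{0..l}. (LBINT t:{0..x}. p t) = K * x"
proof -
  define P where "P x = (LBINT t:{0..x}. p t)" for x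
  have eq: "(P b - P a) / (b - a) = (P d - P c) / (d - c)"
    if ab: "0 < a" "a < b" "b < l" and cd: "0 < c" "c < d" "d < l" for a b c d
  proof -
    define \<epsilon>0 where "\<epsilon>0 = min (l - b) (l - d)"
    define \<epsilon> where "\<epsilon> k = \<epsilon>0 / real (Suc (Suc k))" for k
    have e0: "\<epsilon>0 > 0" using ab cd by (simp add: \<epsilon>0_def)
    have e: "0 < \<epsilon> k" "\<epsilon> k < \<epsilon>0" for k
    proof -
      have "\<epsilon>0 * 1 < \<epsilon>0 * real (Suc (Suc k))" using e0 by (intro mult_strict_left_mono) auto
      then show "\<epsilon> k < \<epsilon>0" by (simp add: \<epsilon>_def divide_less_eq)
    qed (use e0 in \<open>simp add: \<epsilon>_def\<close>)
    have elim: "\<epsilon> \<longlonglongrightarrow> 0"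
      unfolding \<epsilon>_def by (rule tendsto_divide_0[OF tendsto_const]) (intro filterlim_at_top_imp_at_infinity filterlim_compose[OF filterlim_real_sequentially] filterlim_Suc filterlim_compose[OF filterlim_Suc])
    let ?\<psi> = "\<lambda>k x. bump_deriv (\<epsilon> k) a b x - bump_deriv (\<epsilon> k) c d x"
    let ?I = "\<lambda>x. indicator {a<..b} x / (b - a) - indicator {c<..d} x / (d - c)"
    have zero: "(LBINT x:{0..l}. p x * ?\<psi> k x) = 0" for k
    proof -
      have "b + \<epsilon> k < l" "d + \<epsilon> k < l" using e(2)[of k] by (auto simp: \<epsilon>0_def)
      from bump_difference_test_function[OF ab(1,2) cd(1,2) e(1) this]
      show ?thesis using z by metis
    qed
    have pm: "set_borel_measurable lborel {0..l} p" by (rule set_integrable_imp_measurable[OF p])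
    have psim: "?\<psi> k \<in> borel_measurable borel" for k unfolding bump_deriv_def by measurable
    have "(\<lambda>k. LBINT x:{0..l}. p x * ?\<psi> k x) \<longlonglongrightarrow> (LBINT x:{0..l}. p x * ?I x)"
      unfolding set_lebesgue_integral_def
    proof (rule integral_dominated_convergence[where w = "\<lambda>x. \<bar>indicator {0..l} x *\<^sub>R p x\<bar> * (1 / (b - a) + 1 / (d - c))"])
      show "(\<lambda>x. indicator {0..l} x *\<^sub>R (p x * ?I x)) \<in> borel_measurable lborel"
      proof -
        have "(\<lambda>x. (indicator {0..l} x *\<^sub>R p x) * ?I x) \<in> borel_measurable lborel"
          using pm unfolding set_borel_measurable_def by measurable
        then show ?thesis by (simp add: mult.assoc)
      qed
      show "(\<lambda>x. indicator {0..l} x *\<^sub>R (p x * ?\<psi> k x)) \<in> borel_measurable lborel" for k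
      proof -
        have "(\<lambda>x. (indicator {0..l} x *\<^sub>R p x) * ?\<psi> k x) \<in> borel_measurable lborel"
          using pm psim[of k] unfolding set_borel_measurable_def by measurable
        then show ?thesis by (simp add: mult.assoc)
      qed
      show "integrable lborel (\<lambda>x. \<bar>indicator {0..l} x *\<^sub>R p x\<bar> * (1 / (b - a) + 1 / (d - c)))"
        using p unfolding set_integrable_def by (intro integrable_mult_left integrable_abs)
      show "AE x in lborel. (\<lambda>k. indicator {0..l} x *\<^sub>R (p x * ?\<psi> k x)) \<longlonglongrightarrow> indicator {0..l} x *\<^sub>R (p x * ?I x)"
        by (intro AE_I2 tendsto_scaleR tendsto_mult tendsto_const tendsto_diff bump_deriv_tendsto ab cd e elim)
      show "AE x in lborel. norm (indicator {0..l} x *\<^sub>R (p x * ?\<psi> k x)) \<le> \<bar>indicator {0..l} x *\<^sub>R p x\<bar> * (1 / (b - a) + 1 / (d - c))" for k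
      proof (rule AE_I2)
        fix x
        have "\<bar>?\<psi> k x\<bar> \<le> 1 / (b - a) + 1 / (d - c)"
          using bump_deriv_bound[OF ab(2) e(1), of k x] bump_deriv_bound[OF cd(2) e(1), of k x] by linarith
        then show "norm (indicator {0..l} x *\<^sub>R (p x * ?\<psi> k x)) \<le> \<bar>indicator {0..l} x *\<^sub>R p x\<bar> * (1 / (b - a) + 1 / (d - c))"
          by (simp add: abs_mult mult.assoc[symmetric] mult_left_mono)
      qed
    qed
    then have "(LBINT x:{0..l}. p x * ?I x) = 0" 
      unfolding zero by (simp only: LIMSEQ_const_iff)
    moreover have "(LBINT x:{0..l}. p x * ?I x) = (P b - P a) / (b - a) - (P d - P c) / (d - c)"
    proof -
      have part: "(LBINT x:{0..l}. p x * (indicator {a<..b} x / (b - a))) = (P b - P a) / (b - a)"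
         "set_integrable lborel {0..l} (\<lambda>x. p x * (indicator {a<..b} x / (b - a)))"
        if "0 < a" "a < b" "b < l" for a b
      proof -
        have i: "indicator {0..l} x *\<^sub>R (p x * (indicator {a<..b} x / (b - a))) = (indicator {a<..b} x *\<^sub>R p x) / (b - a)" for x
          using that by (auto simp: indicator_def)
        have "(LBINT t:{a<..b}. p t) = P b - P a" unfolding P_def using that by (intro LBINT_split[OF p]) auto
        then show "(LBINT x:{0..l}. p x * (indicator {a<..b} x / (b - a))) = (P b - P a) / (b - a)"
          unfolding set_lebesgue_integral_def i by simp
        have "set_integrable lborel {a<..b} p" using that by (intro set_integrable_subset[OF p]) auto
        then show "set_integrable lborel {0..l} (\<lambda>x. p x * (indicator {a<..b} x / (b - a)))"
          unfolding set_integrable_def i by simp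
      qed
      have "(LBINT x:{0..l}. p x * ?I x) =
        (LBINT x:{0..l}. p x * (indicator {a<..b} x / (b - a)) - p x * (indicator {c<..d} x / (d - c)))"
        by (simp only: right_diff_distrib)
      also have "\<dots> = (LBINT x:{0..l}. p x * (indicator {a<..b} x / (b - a))) - (LBINT x:{0..l}. p x * (indicator {c<..d} x / (d - c)))"
        by (rule set_integral_diff(2)[OF part(2)[OF ab] part(2)[OF cd]])
      finally show ?thesis unfolding part(1)[OF ab] part(1)[OF cd] .
    qed
    ultimately show ?thesis by simp
  qed
  \<comment> \<open>The mean value over the middle third serves as a reference.\<close>
  define K where "K = (P (2 * l / 3) - P (l / 3)) / (l / 3)"
  have step: "P b - K * b = P a - K * a" if "0 < a" "a < b" "b < l" for a b
    using eq[OF that, of "l / 3" "2 * l / 3"] l that by (simp add: K_def field_simps)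
  have const: "P x - K * x = P (l / 2) - K * (l / 2)" if "x \<in> {0<..<l}" for x
    using step[of x "l / 2"] step[of "l / 2" x] that l by (cases x "l / 2" rule: linorder_cases) auto
  have cont: "continuous_on {0..l} (\<lambda>x. P x - K * x)"
    unfolding P_def by (intro continuous_intros primitive_continuous p)
  have all: "P x - K * x = P (l / 2) - K * (l / 2)" if "x \<in> {0..l}" for x
    using continuous_constant_on_closure[of "{0<..<l}" "\<lambda>x. P x - K * x" "P (l / 2) - K * (l / 2)" x]
      const cont that l by (simp add: closure_greaterThanLessThan)
  have "P 0 = 0"
  proof -
    have "(LBINT t:{0..0}. p t) = integral {0..0} p"
      using l by (intro set_borel_integral_eq_integral(2) set_integrable_subset[OF p]) auto
    then show ?thesis by (simp add: P_def)
  qed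
  then have "P x = K * x" if "x \<in> {0..l}" for x using all[OF that] all[of 0] l by simp
  then show ?thesis unfolding P_def by blast
qed


section \<open>Regularity and inequalities on an interval\<close>

lemma primitive_diff:
  fixes g h :: "real \<Rightarrow> real"
  assumes "set_integrable lborel {0..l} g" "set_integrable lborel {0..l} h" "x \<in> {0..l}"
  shows "(LBINT t:{0..x}. g t - h t) = (LBINT t:{0..x}. g t) - (LBINT t:{0..x}. h t)"
  using assms(3) by (intro set_integral_diff(2) set_integrable_subset[OF assms(1)] set_integrable_subset[OF assms(2)]) auto

lemma continuous_primitive_linear:
  assumes l: "0 < l" and p: "continuous_on {0..l} (p :: real \<Rightarrow> real)"
    and K: "\<And>x. x \<in> {0..l} \<Longrightarrow> (LBINT t:{0..x}. p t) = K * x" and x: "x \<in> {0..l}"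
  shows "p x = K"
proof -
  have "((\<lambda>x. integral {0..x} p) has_real_derivative p x) (at x within {0..l})"
    using integral_has_real_derivative[OF p x] .
  moreover have "((\<lambda>x. integral {0..x} p) has_real_derivative K) (at x within {0..l})"
  proof (rule has_field_derivative_transform_within[where d = 1])
    show "((\<lambda>x. K * x) has_real_derivative K) (at x within {0..l})" by (auto intro!: derivative_eq_intros)
    fix y assume "y \<in> {0..l}"
    then show "K * y = integral {0..y} p"
      using K[of y] LBINT_continuous[OF continuous_on_subset[OF p], of 0 y] by auto
  qed (use x in auto)
  ultimately show ?thesis
    using vector_derivative_unique_within[of x "{0..l}" "\<lambda>x. integral {0..x} p" "p x" K] l x
    by (auto simp: has_real_derivative_iff_has_vector_derivative trivial_limit_within intro: islimpt_Icc)
qed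

text \<open>
  The lemma of du Bois-Reymond, applied to the difference of \<open>u\<close> and the primitive of \<open>g\<close>.
\<close>

lemma primitive_of_weak_derivative:
  assumes l: "0 < l" and w: "weak_deriv l u g"
    and g: "set_integrable lborel {0..l} g" and u: "set_integrable lborel {0..l} u"
  shows "\<exists>K. \<forall>x\<in>{0..l}. (LBINT t:{0..x}. u t) = K * x + (LBINT t:{0..x}. (LBINT s:{0..t}. g s))"
proof -
  let ?G = "\<lambda>x. LBINT s:{0..x}. g s"
  have G: "set_integrable lborel {0..l} ?G" by (rule set_integrable_continuous[OF primitive_continuous[OF g]])
  have "\<exists>K. \<forall>x\<in>{0..l}. (LBINT t:{0..x}. u t - ?G t) = K * x"
  proof (rule du_Bois_Reymond[OF l])
    show "set_integrable lborel {0..l} (\<lambda>t. u t - ?G t)" using u G by (rule set_integral_diff(1))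
    fix \<phi> assume \<phi>: "\<phi> \<in> test_functions l"
    note t = test_functionD[OF \<phi> l]
    have "(LBINT x:{0..l}. g x * \<phi> x) = \<phi> l * ?G l - (LBINT x:{0..l}. ?G x * deriv \<phi> x)"
      using l by (intro integration_by_parts[OF g] has_field_derivative_at_within[OF t(1)] t(2)) auto
    then have "(LBINT x:{0..l}. u x * deriv \<phi> x) = (LBINT x:{0..l}. ?G x * deriv \<phi> x)"
      using w \<phi> t(3) by (simp add: weak_deriv_def)
    then show "(LBINT x:{0..l}. (u x - ?G x) * deriv \<phi> x) = 0"
      using set_integrable_mult_continuous[OF u t(2)] set_integrable_mult_continuous[OF G t(2)]
      by (simp add: left_diff_distrib set_integral_diff(2))
  qed
  then obtain K where K: "\<And>x. x \<in> {0..l} \<Longrightarrow> (LBINT t:{0..x}. u t - ?G t) = K * x" by blast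
  then show ?thesis using primitive_diff[OF u G] by (intro exI[of _ K] ballI) (force simp: algebra_simps)
qed

lemma primitive_at_0: "0 < l \<Longrightarrow> set_integrable lborel {0..l} h \<Longrightarrow> (LBINT t:{0..0}. (h :: real \<Rightarrow> real) t) = 0"
proof -
  assume "0 < l" and p: "set_integrable lborel {0..l} h"
  then have "(LBINT t:{0..0}. h t) = integral {0..0} h"
    by (intro set_borel_integral_eq_integral(2) set_integrable_subset[OF p]) auto
  then show ?thesis by simp
qed

text \<open>
  The weak derivative \<open>g\<close> of \<open>u\<close> and the primitive of \<open>h\<close> differ by a constant \<open>c\<close> in the sense of primitives, so \<open>u\<close> is
  a primitive of the continuous function \<open>c + (LBINT t:{0..x}. h t)\<close>.
\<close>

lemma H2_regularity:
  assumes l: "0 < l" and u: "continuous_on {0..l} u" and w: "weak_deriv2 l u h"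
    and h: "set_integrable lborel {0..l} h" and L2: "\<And>g. g \<in> L2_interval l \<Longrightarrow> set_integrable lborel {0..l} g"
  shows "\<exists>c. \<forall>x\<in>{0..l}. (u has_real_derivative c + (LBINT t:{0..x}. h t)) (at x within {0..l})"
proof -
  obtain g where "g \<in> L2_interval l" and ug: "weak_deriv l u g" and gh: "weak_deriv l g h"
    using w by (auto simp: weak_deriv2_def)
  then have g: "set_integrable lborel {0..l} g" using L2 by blast
  let ?H = "\<lambda>x. LBINT t:{0..x}. h t"
  let ?G = "\<lambda>x. LBINT t:{0..x}. g t"
  have Hc: "continuous_on {0..l} ?H" and Gc: "continuous_on {0..l} ?G"
    by (intro primitive_continuous h g)+
  obtain c where c: "\<And>x. x \<in> {0..l} \<Longrightarrow> ?G x = c * x + (LBINT t:{0..x}. ?H t)"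
    using primitive_of_weak_derivative[OF l gh h g] by blast
  obtain K where K: "\<And>x. x \<in> {0..l} \<Longrightarrow> (LBINT t:{0..x}. u t) = K * x + (LBINT t:{0..x}. ?G t)"
    using primitive_of_weak_derivative[OF l ug g set_integrable_continuous[OF u]] by blast
  have uG: "u x - ?G x = K" if "x \<in> {0..l}" for x
  proof (rule continuous_primitive_linear[OF l _ _ that])
    show "continuous_on {0..l} (\<lambda>x. u x - ?G x)" by (intro continuous_intros u Gc)
    fix y assume "y \<in> {0..l}"
    then show "(LBINT t:{0..y}. u t - ?G t) = K * y"
      using K primitive_diff[OF set_integrable_continuous[OF u] set_integrable_continuous[OF Gc]] by simp
  qed
  have ux: "u x = K + (c * x + integral {0..x} ?H)" if x: "x \<in> {0..l}" for x
  proof -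
    have "continuous_on {0..x} ?H" using x by (intro continuous_on_subset[OF Hc]) auto
    then show ?thesis using uG[OF x] c[OF x] LBINT_continuous[of 0 x ?H] by simp
  qed
  have "(u has_real_derivative c + ?H x) (at x within {0..l})" if x: "x \<in> {0..l}" for x
  proof (rule has_field_derivative_transform_within[where d = 1])
    have "((\<lambda>x. integral {0..x} ?H) has_real_derivative ?H x) (at x within {0..l})"
      by (rule integral_has_real_derivative[OF Hc x])
    then show "((\<lambda>x. K + (c * x + integral {0..x} ?H)) has_real_derivative c + ?H x) (at x within {0..l})"
      by (auto intro!: derivative_eq_intros)
    fix y assume "y \<in> {0..l}"
    then show "K + (c * y + integral {0..y} ?H) = u y" using ux by simp
  qed (use x in auto)
  then show ?thesis by blast
qed

text \<open>The classical content of a weak second derivative \<open>h\<close>: the first derivative \<open>v\<close> is continuous.\<close>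

definition H2_pair :: "real \<Rightarrow> (real \<Rightarrow> real) \<Rightarrow> (real \<Rightarrow> real) \<Rightarrow> (real \<Rightarrow> real) \<Rightarrow> bool" where
  "H2_pair l u v h \<longleftrightarrow> set_integrable lborel {0..l} h \<and>
     (\<forall>x\<in>{0..l}. (u has_real_derivative v x) (at x within {0..l}) \<and> v x = v 0 + (LBINT t:{0..x}. h t))"

lemma H2_pair_cont: assumes "H2_pair l u v h"
  shows "continuous_on {0..l} u" "continuous_on {0..l} v"
proof -
  show "continuous_on {0..l} u" using assms by (intro DERIV_continuous_on) (auto simp: H2_pair_def)
  have "continuous_on {0..l} (\<lambda>x. v 0 + (LBINT t:{0..x}. h t))"
    using assms by (intro continuous_intros primitive_continuous) (auto simp: H2_pair_def)
  then show "continuous_on {0..l} v"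
    by (rule continuous_on_eq) (use assms in \<open>unfold H2_pair_def, metis\<close>)
qed

lemma green_identity:
  assumes l: "0 \<le> l" and u: "H2_pair l u du h"
    and v: "\<And>x. x \<in> {0..l} \<Longrightarrow> (v has_real_derivative dv x) (at x within {0..l})" "continuous_on {0..l} dv"
  shows "(LBINT x:{0..l}. h x * v x) = du l * v l - du 0 * v 0 - (LBINT x:{0..l}. du x * dv x)"
proof -
  have h: "set_integrable lborel {0..l} h" and du: "\<And>x. x \<in> {0..l} \<Longrightarrow> (LBINT t:{0..x}. h t) = du x - du 0"
  proof -
    show "set_integrable lborel {0..l} h" using u by (simp add: H2_pair_def)
    fix x assume "x \<in> {0..l}"
    then have "du x = du 0 + (LBINT t:{0..x}. h t)" using u unfolding H2_pair_def by blast
    then show "(LBINT t:{0..x}. h t) = du x - du 0" by linarith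
  qed
  have "(LBINT x:{0..l}. h x * v x) = v l * (LBINT x:{0..l}. h x) - (LBINT x:{0..l}. (LBINT t:{0..x}. h t) * dv x)"
    by (rule integration_by_parts[OF h l v])
  also have "(LBINT x:{0..l}. h x) = du l - du 0" using du l by simp
  also have "(LBINT x:{0..l}. (LBINT t:{0..x}. h t) * dv x) = (LBINT x:{0..l}. du x * dv x - du 0 * dv x)"
    by (rule LBINT_cong) (simp add: du left_diff_distrib)
  also have "\<dots> = (LBINT x:{0..l}. du x * dv x) - (LBINT x:{0..l}. du 0 * dv x)"
    using H2_pair_cont[OF u] v(2) by (intro set_integral_diff(2) set_integrable_continuous continuous_intros)
  also have "(LBINT x:{0..l}. du 0 * dv x) = du 0 * (v l - v 0)"
    using LBINT_derivative[OF l v] by simp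
  finally show ?thesis by (simp add: algebra_simps)
qed

lemma Cauchy_Schwarz_interval:
  fixes f :: "real \<Rightarrow> real"
  assumes ab: "a \<le> b" and f: "continuous_on {a..b} f"
  shows "(integral {a..b} f)\<^sup>2 \<le> (b - a) * integral {a..b} (\<lambda>x. (f x)\<^sup>2)"
proof (cases "a = b")
  case False
  define m where "m = integral {a..b} f / (b - a)"
  have i: "f integrable_on {a..b}" "(\<lambda>x. (f x)\<^sup>2) integrable_on {a..b}"
    by (intro integrable_continuous_real continuous_intros f)+
  have "0 \<le> integral {a..b} (\<lambda>x. (f x - m)\<^sup>2)" by (intro integral_nonneg integrable_continuous_real continuous_intros f) auto
  also have "\<dots> = integral {a..b} (\<lambda>x. (f x)\<^sup>2 - 2 * m * f x + m\<^sup>2)"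
    by (simp add: power2_diff algebra_simps)
  also have "\<dots> = integral {a..b} (\<lambda>x. (f x)\<^sup>2) - 2 * m * integral {a..b} f + m\<^sup>2 * (b - a)"
  proof (rule integral_unique)
    have "((\<lambda>x. m\<^sup>2) has_integral m\<^sup>2 * (b - a)) {a..b}"
      using has_integral_const_real[of "m\<^sup>2" a b] ab by (simp add: mult.commute)
    then show "((\<lambda>x. (f x)\<^sup>2 - 2 * m * f x + m\<^sup>2) has_integral
        integral {a..b} (\<lambda>x. (f x)\<^sup>2) - 2 * m * integral {a..b} f + m\<^sup>2 * (b - a)) {a..b}"
      by (intro has_integral_add has_integral_diff has_integral_mult_right integrable_integral i)
  qed
  finally have "0 \<le> (b - a) * (integral {a..b} (\<lambda>x. (f x)\<^sup>2) - 2 * m * integral {a..b} f + m\<^sup>2 * (b - a))"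
    using ab by (simp add: zero_le_mult_iff)
  moreover have I: "integral {a..b} f = m * (b - a)" using False ab by (simp add: m_def)
  moreover have "(b - a) * (J - 2 * m * (m * (b - a)) + m\<^sup>2 * (b - a)) = (b - a) * J - (m * (b - a))\<^sup>2" for J
    by (simp add: power2_eq_square algebra_simps)
  ultimately show ?thesis by simp
qed simp

lemma integral_sq_mono:
  fixes f :: "real \<Rightarrow> real"
  assumes "continuous_on {a..b} f" "{c..d} \<subseteq> {a..b}"
  shows "integral {c..d} (\<lambda>x. (f x)\<^sup>2) \<le> integral {a..b} (\<lambda>x. (f x)\<^sup>2)"
  using assms by (intro integral_subset_le integrable_continuous_real continuous_intros continuous_on_subset[OF assms(1)]) auto

lemma increment_bound:
  fixes u v :: "real \<Rightarrow> real"
  assumes d: "\<And>x. x \<in> {a..b} \<Longrightarrow> (u has_real_derivative v x) (at x within {a..b})" and v: "continuous_on {a..b} v"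
    and xy: "x \<in> {a..b}" "y \<in> {a..b}"
  shows "(u x - u y)\<^sup>2 \<le> \<bar>x - y\<bar> * integral {a..b} (\<lambda>x. (v x)\<^sup>2)"
proof -
  have *: "(u y - u x)\<^sup>2 \<le> (y - x) * integral {a..b} (\<lambda>x. (v x)\<^sup>2)" if "x \<le> y" "x \<in> {a..b}" "y \<in> {a..b}" for x y
  proof -
    have s: "{x..y} \<subseteq> {a..b}" using that by auto
    have "u y - u x = integral {x..y} v"
    proof (intro integral_unique[symmetric] fundamental_theorem_of_calculus that(1))
      fix z assume z: "z \<in> {x..y}"
      have "(u has_real_derivative v z) (at z within {x..y})"
        using z s by (intro DERIV_subset[OF d s]) auto
      then show "(u has_vector_derivative v z) (at z within {x..y})"
        by (simp add: has_real_derivative_iff_has_vector_derivative)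
    qed
    then have "(u y - u x)\<^sup>2 \<le> (y - x) * integral {x..y} (\<lambda>x. (v x)\<^sup>2)"
      using Cauchy_Schwarz_interval[OF that(1) continuous_on_subset[OF v s]] by simp
    also have "\<dots> \<le> (y - x) * integral {a..b} (\<lambda>x. (v x)\<^sup>2)"
      using that(1) by (intro mult_left_mono integral_sq_mono v s) auto
    finally show ?thesis .
  qed
  show ?thesis
  proof (cases "x \<le> y")
    case True
    then show ?thesis using *[OF True xy] by (simp add: power2_commute)
  next
    case False
    then show ?thesis using *[of y x] xy by simp
  qed
qed

text \<open>
  Compare \<open>u x\<close> with \<open>u y\<close> for \<open>y\<close> in an interval of length \<open>\<delta>\<close> around \<open>x\<close> inside \<open>[0, l]\<close> and average over \<open>y\<close>.
\<close>

lemma value_le_integrals: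
  fixes u v :: "real \<Rightarrow> real"
  assumes d: "\<And>x. x \<in> {0..l} \<Longrightarrow> (u has_real_derivative v x) (at x within {0..l})" and v: "continuous_on {0..l} v"
    and x: "x \<in> {0..l}" and \<delta>: "0 < \<delta>" "\<delta> \<le> l"
  shows "(u x)\<^sup>2 \<le> 2 / \<delta> * integral {0..l} (\<lambda>x. (u x)\<^sup>2) + 2 * \<delta> * integral {0..l} (\<lambda>x. (v x)\<^sup>2)"
proof -
  have uc: "continuous_on {0..l} u" using d by (intro DERIV_continuous_on)
  define c where "c = min x (l - \<delta>)"
  have c: "0 \<le> c" "c + \<delta> \<le> l" "x \<in> {c..c + \<delta>}" using x \<delta> by (auto simp: c_def)
  have s: "{c..c + \<delta>} \<subseteq> {0..l}" using c by auto
  let ?V = "integral {0..l} (\<lambda>x. (v x)\<^sup>2)"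
  have V: "?V \<ge> 0" by (intro integral_nonneg integrable_continuous_real continuous_intros v) auto
  have pt: "(u x)\<^sup>2 \<le> 2 * (u y)\<^sup>2 + 2 * \<delta> * ?V" if y: "y \<in> {c..c + \<delta>}" for y
  proof -
    have "(u x - u y)\<^sup>2 \<le> \<bar>x - y\<bar> * ?V" using increment_bound[OF d v x] y s by blast
    also have "\<dots> \<le> \<delta> * ?V" using c y V by (intro mult_right_mono) auto
    finally have 1: "(u x - u y)\<^sup>2 \<le> \<delta> * ?V" .
    have "(u x)\<^sup>2 + (u x - 2 * u y)\<^sup>2 = 2 * (u y)\<^sup>2 + 2 * (u x - u y)\<^sup>2" by (simp add: power2_eq_square algebra_simps)
    then have "(u x)\<^sup>2 \<le> 2 * (u y)\<^sup>2 + 2 * (u x - u y)\<^sup>2" by (metis le_add_same_cancel1 zero_le_power2)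
    then show ?thesis using 1 by linarith
  qed
  have ic: "(\<lambda>y. (u y)\<^sup>2) integrable_on {c..c + \<delta>}"
    by (intro integrable_continuous_real continuous_intros continuous_on_subset[OF uc s])
  have "integral {c..c + \<delta>} (\<lambda>y. (u x)\<^sup>2) \<le> integral {c..c + \<delta>} (\<lambda>y. 2 * (u y)\<^sup>2 + 2 * \<delta> * ?V)"
    using pt ic by (intro integral_le integrable_add integrable_on_mult_right) auto
  also have "\<dots> = 2 * integral {c..c + \<delta>} (\<lambda>y. (u y)\<^sup>2) + \<delta> * (2 * \<delta> * ?V)"
  proof (rule integral_unique)
    have "((\<lambda>y. 2 * \<delta> * ?V) has_integral \<delta> * (2 * \<delta> * ?V)) {c..c + \<delta>}"
      using has_integral_const_real[of "2 * \<delta> * ?V" c "c + \<delta>"] \<delta> by simp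
    then show "((\<lambda>y. 2 * (u y)\<^sup>2 + 2 * \<delta> * ?V) has_integral
        2 * integral {c..c + \<delta>} (\<lambda>y. (u y)\<^sup>2) + \<delta> * (2 * \<delta> * ?V)) {c..c + \<delta>}"
      by (intro has_integral_add has_integral_mult_right integrable_integral ic)
  qed
  also have "\<dots> \<le> 2 * integral {0..l} (\<lambda>y. (u y)\<^sup>2) + \<delta> * (2 * \<delta> * ?V)"
    using integral_sq_mono[OF uc s] by simp
  finally have "(u x)\<^sup>2 * \<delta> \<le> 2 * integral {0..l} (\<lambda>y. (u y)\<^sup>2) + (2 * \<delta> * ?V) * \<delta>"
    using \<delta> by (simp add: mult.commute)
  then have "(u x)\<^sup>2 \<le> (2 * integral {0..l} (\<lambda>y. (u y)\<^sup>2) + (2 * \<delta> * ?V) * \<delta>) / \<delta>"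
    using \<delta>(1) by (simp only: pos_le_divide_eq)
  then show ?thesis using \<delta>(1) by (simp add: add_divide_distrib)
qed


section \<open>Square integrable functions on a metric graph\<close>

instantiation "fun" :: (type, real_vector) real_vector
begin
definition scaleR_fun :: "real \<Rightarrow> ('a \<Rightarrow> 'b) \<Rightarrow> 'a \<Rightarrow> 'b" where "scaleR_fun r f = (\<lambda>x. r *\<^sub>R f x)"
instance by standard (simp_all add: scaleR_fun_def fun_eq_iff scaleR_add_right scaleR_add_left)
end

lemma scaleR_fun_apply [simp]: "(r *\<^sub>R f) x = r *\<^sub>R f x"
  by (simp add: scaleR_fun_def)

lemma linear_evaluation: "linear (\<lambda>u :: 'e graph_fun. u e x)"
  by (rule linearI) auto

lemma L2_interval_mult:
  assumes "u \<in> L2_interval l" "v \<in> L2_interval l"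
  shows "set_integrable lborel {0..l} (\<lambda>x. u x * v x)"
proof -
  have u: "set_borel_measurable lborel {0..l} u" "set_integrable lborel {0..l} (\<lambda>x. (u x)\<^sup>2)"
    and v: "set_borel_measurable lborel {0..l} v" "set_integrable lborel {0..l} (\<lambda>x. (v x)\<^sup>2)"
    using assms by (auto simp: L2_interval_def)
  show ?thesis
  proof (rule set_integrable_bound[OF set_integral_add(1)[OF u(2) v(2)] set_borel_measurable_mult[OF u(1) v(1)]], intro AE_I2 impI)
    fix x
    have "0 \<le> (\<bar>u x\<bar> - \<bar>v x\<bar>)\<^sup>2" by simp
    then have "2 * \<bar>u x * v x\<bar> \<le> (u x)\<^sup>2 + (v x)\<^sup>2" by (simp add: power2_diff abs_mult)
    moreover have "0 \<le> \<bar>u x * v x\<bar>" by simp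
    ultimately have "\<bar>u x * v x\<bar> \<le> (u x)\<^sup>2 + (v x)\<^sup>2" by linarith
    then show "norm (u x * v x) \<le> norm ((u x)\<^sup>2 + (v x)\<^sup>2)" by simp
  qed
qed

lemma set_borel_measurable_plus:
  fixes f g :: "real \<Rightarrow> real"
  assumes "set_borel_measurable M A f" "set_borel_measurable M A g"
  shows "set_borel_measurable M A (\<lambda>x. f x + g x)"
  using assms unfolding set_borel_measurable_def by (simp add: distrib_left)

lemma L2_interval_add: assumes "u \<in> L2_interval l" "v \<in> L2_interval l" shows "(\<lambda>x. u x + v x) \<in> L2_interval l"
proof -
  have "set_integrable lborel {0..l} (\<lambda>x. (u x)\<^sup>2 + (v x)\<^sup>2 + 2 * (u x * v x))"
    using assms L2_interval_mult[OF assms] by (intro set_integral_add) (auto simp: L2_interval_def)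
  then show ?thesis using assms by (auto simp: L2_interval_def power2_sum set_borel_measurable_plus algebra_simps)
qed

lemma L2_interval_scale: assumes "u \<in> L2_interval l" shows "(\<lambda>x. r * u x) \<in> L2_interval l"
proof -
  have "set_integrable lborel {0..l} (\<lambda>x. r\<^sup>2 * (u x)\<^sup>2)" using assms by (auto simp: L2_interval_def)
  moreover have "set_borel_measurable lborel {0..l} (\<lambda>x. r * u x)"
    using assms by (auto simp: L2_interval_def set_borel_measurable_def mult.left_commute[of _ r])
  ultimately show ?thesis by (auto simp: L2_interval_def power_mult_distrib)
qed

lemma L2_interval_bounded:
  assumes m: "set_borel_measurable lborel {0..l} u" and b: "\<And>x. x \<in> {0..l} \<Longrightarrow> \<bar>u x\<bar> \<le> B"
  shows "u \<in> L2_interval l"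
proof -
  have "set_integrable lborel {0..l} (\<lambda>x. B\<^sup>2)" by (intro set_integrable_continuous continuous_intros)
  then have "set_integrable lborel {0..l} (\<lambda>x. (u x)\<^sup>2)"
  proof (rule set_integrable_bound, goal_cases)
    case 1
    show ?case using set_borel_measurable_mult[OF m m] by (simp add: power2_eq_square)
  next
    case 2
    show ?case using power_mono[OF b, of _ 2] by (intro AE_I2) auto
  qed
  then show ?thesis using m by (simp add: L2_interval_def)
qed

lemma L2_interval_continuous: assumes "continuous_on {0..l} u" shows "u \<in> L2_interval l"
proof -
  have "set_integrable lborel {0..l} (\<lambda>x. (u x)\<^sup>2)" by (intro set_integrable_continuous continuous_intros assms)
  then show ?thesis using set_integrable_imp_measurable[OF set_integrable_continuous[OF assms]] by (simp add: L2_interval_def)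
qed

lemma L2_interval_integrable: "u \<in> L2_interval l \<Longrightarrow> set_integrable lborel {0..l} u"
  using L2_interval_mult[of u l "\<lambda>_. 1"] L2_interval_continuous[of l "\<lambda>_. 1"] by simp

lemma AE_continuous_eq:
  fixes f g :: "real \<Rightarrow> real"
  assumes l: "0 < l" and c: "continuous_on {0..l} f" "continuous_on {0..l} g"
    and ae: "AE x\<in>{0..l} in lborel. f x = g x" and x: "x \<in> {0..l}"
  shows "f x = g x"
proof -
  have c2: "continuous_on {0..l} (\<lambda>x. (f x - g x)\<^sup>2)" by (intro continuous_intros c)
  have "(LBINT x:{0..l}. (f x - g x)\<^sup>2) = 0"
    unfolding set_lebesgue_integral_def
    by (rule integral_eq_zero_AE) (use ae in \<open>auto simp: indicator_def elim!: AE_mp\<close>)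
  then have "integral {0..l} (\<lambda>x. (f x - g x)\<^sup>2) = 0" using LBINT_continuous[OF c2] by simp
  then show ?thesis using integral_eq_0_iff[OF c2 l] x by simp
qed

lemma set_integral_nonneg_eq_0:
  assumes i: "set_integrable M A (f :: real \<Rightarrow> real)" and nn: "\<And>x. 0 \<le> f x"
  shows "(LINT x:A|M. f x) = 0 \<longleftrightarrow> (AE x\<in>A in M. f x = 0)"
proof -
  have "(LINT x:A|M. f x) = 0 \<longleftrightarrow> (AE x in M. indicator A x *\<^sub>R f x = 0)"
    unfolding set_lebesgue_integral_def using i nn
    by (intro integral_nonneg_eq_0_iff_AE) (auto simp: set_integrable_def)
  also have "\<dots> \<longleftrightarrow> (AE x\<in>A in M. f x = 0)" by (rule AE_cong) (auto simp: indicator_def)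
  finally show ?thesis .
qed

locale metric_graph =
  fixes G :: "('v, 'e) pre_digraph" and len :: "'e \<Rightarrow> real"
  assumes graph: "compact_metric_graph G len"
begin

abbreviation "H \<equiv> L2_graph G len"
abbreviation "ip \<equiv> L2_inner G len"

lemma finite_arcs [simp]: "finite (arcs G)"
  using graph by (simp add: compact_metric_graph_def fin_digraph.finite_arcs)
lemma arcs_nonempty: "arcs G \<noteq> {}" and len_pos: "e \<in> arcs G \<Longrightarrow> 0 < len e"
  using graph by (auto simp: compact_metric_graph_def)

sublocale semi_inner H ip
proof
  show "subspace H"
    unfolding subspace_def
  proof (intro conjI ballI allI)
    show "0 \<in> H" by (auto simp: L2_graph_def intro!: L2_interval_continuous)
    fix u v :: "'e graph_fun" and r :: real
    assume u: "u \<in> H"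
    show "r *\<^sub>R u \<in> H"
      using u L2_interval_scale[of "u _" _ r] by (auto simp: L2_graph_def scaleR_fun_def)
    assume "v \<in> H"
    then show "u + v \<in> H" using u L2_interval_add by (auto simp: L2_graph_def plus_fun_def)
  qed
  fix u v w :: "'e graph_fun" and r :: real
  assume uv: "u \<in> H" "v \<in> H"
  show "ip (r *\<^sub>R u) v = r * ip u v"
    by (simp add: L2_inner_def sum_distrib_left mult.assoc)
  show "ip u v = ip v u" by (simp add: L2_inner_def mult.commute)
  show "0 \<le> ip u u"
    unfolding L2_inner_def set_lebesgue_integral_def by (intro sum_nonneg integral_nonneg) auto
  assume "w \<in> H"
  then show "ip (u + v) w = ip u w + ip v w"
    unfolding L2_inner_def sum.distrib[symmetric] using uv
    by (intro sum.cong refl) (simp add: distrib_right L2_interval_mult L2_graph_def)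
qed

lemma L2_norm_eq_nrm: "L2_norm G len u = nrm u"
  by (simp add: L2_norm_def nrm_def)

lemma ip_eq_0_iff: assumes "u \<in> H" shows "ip u u = 0 \<longleftrightarrow> ae_equal G len u (\<lambda>e x. 0)"
proof -
  have i: "set_integrable lborel {0..len e} (\<lambda>x. u e x * u e x)" if "e \<in> arcs G" for e
    using assms that by (auto simp: L2_graph_def intro: L2_interval_mult)
  have "ip u u = 0 \<longleftrightarrow> (\<forall>e\<in>arcs G. (LBINT x:{0..len e}. u e x * u e x) = 0)"
    unfolding L2_inner_def
    by (intro sum_nonneg_eq_0_iff) (auto simp: set_lebesgue_integral_def intro!: integral_nonneg)
  also have "\<dots> \<longleftrightarrow> (\<forall>e\<in>arcs G. AE x\<in>{0..len e} in lborel. u e x = 0)"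
    by (intro ball_cong refl) (subst set_integral_nonneg_eq_0[OF i], auto)
  finally show ?thesis by (simp add: ae_equal_def ae_on_graph_def)
qed

lemma ae_equal_iff: assumes "u \<in> H" "v \<in> H" shows "ae_equal G len u v \<longleftrightarrow> ip (u - v) (u - v) = 0"
  using ip_eq_0_iff[of "u - v"] assms by (simp add: ae_equal_def)

text \<open>
  Normalised indicator functions of \<open>n\<close> disjoint intervals of equal length on one edge.
\<close>

lemma orthonormal_indicators: "\<exists>\<psi>. orthonormal \<psi> n"
proof (cases "n = 0")
  case True
  then show ?thesis by (simp add: orthonormal_def)
next
  case False
  obtain e0 where e0: "e0 \<in> arcs G" using arcs_nonempty by blast
  define l where "l = len e0"
  have l: "l > 0" using len_pos e0 by (simp add: l_def)
  define J where "J i = {l * i / n <.. l * Suc i / n}" for i :: nat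
  define \<psi> where "\<psi> i e x = (if e = e0 then sqrt (n / l) * indicator (J i) x else 0)" for i e x
  have J: "J i \<subseteq> {0..l}" if "i < n" for i
  proof -
    have "l * Suc i / n \<le> l * n / n" using that l by (intro divide_right_mono mult_left_mono) auto
    then have "l * Suc i / n \<le> l" using False by simp
    moreover have "0 \<le> l * i / n" using l by simp
    ultimately show ?thesis unfolding J_def by (intro subsetI) (simp only: greaterThanAtMost_iff atLeastAtMost_iff, linarith)
  qed
  have disj: "J i \<inter> J j = {}" if "i < j" for i j
  proof -
    have "l * Suc i / n \<le> l * j / n" using that l by (intro divide_right_mono mult_left_mono) auto
    then show ?thesis unfolding J_def by auto
  qed
  have psiH: "\<psi> i \<in> H" for i
    unfolding L2_graph_def
  proof (intro CollectI ballI)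
    fix e assume "e \<in> arcs G"
    show "\<psi> i e \<in> L2_interval (len e)"
    proof (rule L2_interval_bounded)
      show "set_borel_measurable lborel {0..len e} (\<psi> i e)"
        unfolding set_borel_measurable_def \<psi>_def J_def by measurable
      show "\<bar>\<psi> i e x\<bar> \<le> sqrt (n / l)" for x using l by (auto simp: \<psi>_def indicator_def)
    qed
  qed
  have ipe: "ip (\<psi> i) (\<psi> j) = (LBINT x:{0..l}. (sqrt (n / l) * indicator (J i) x) * (sqrt (n / l) * indicator (J j) x))" for i j
  proof -
    have "ip (\<psi> i) (\<psi> j) = (\<Sum>e\<in>arcs G. if e = e0 then LBINT x:{0..l}. (sqrt (n / l) * indicator (J i) x) * (sqrt (n / l) * indicator (J j) x) else 0)"
      unfolding L2_inner_def by (intro sum.cong) (auto simp: \<psi>_def l_def)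
    then show ?thesis using e0 by simp
  qed
  have "ip (\<psi> i) (\<psi> j) = (if i = j then 1 else 0)" if ij: "i < n" "j < n" for i j
  proof (cases "i = j")
    case False
    then have "J i \<inter> J j = {}" using disj[of i j] disj[of j i] by (cases i j rule: linorder_cases) auto
    then have "indicator (J i) x * indicator (J j) x = (0::real)" for x by (auto simp: indicator_def)
    then have z: "(sqrt (n / l) * indicator (J i) x) * (sqrt (n / l) * indicator (J j) x) = 0" for x
      by (metis mult.assoc mult.left_commute mult_zero_right)
    show ?thesis using False unfolding ipe z by simp
  next
    case True
    have s: "sqrt (n / l) * sqrt (n / l) = n / l" using l by simp
    have "ip (\<psi> i) (\<psi> j) = (LBINT x. n / l * indicator (J i) x)"
      unfolding ipe set_lebesgue_integral_def using J[OF ij(1)] True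
      by (intro Bochner_Integration.integral_cong refl) (auto simp: indicator_def s mult.assoc[symmetric])
    also have "\<dots> = n / l * measure lborel (J i)" by simp
    also have "measure lborel (J i) = l / n" using l False \<open>n \<noteq> 0\<close> by (simp add: J_def field_simps)
    finally show ?thesis using True l \<open>n \<noteq> 0\<close> by simp
  qed
  then show ?thesis using psiH unfolding orthonormal_def by blast
qed

end


section \<open>Self-adjoint realisations on continuous representatives\<close>

locale sa_graph = metric_graph G len for G :: "('v, 'e) pre_digraph" and len :: "'e \<Rightarrow> real" +
  fixes D :: "'e graph_fun set" and A :: "'e graph_fun \<Rightarrow> 'e graph_fun"
  assumes realisation: "selfadjoint_laplacian G len D A"
begin

lemma D_H: "u \<in> D \<Longrightarrow> u \<in> H" and A_H: "u \<in> D \<Longrightarrow> A u \<in> H"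
  and D_dense: "v \<in> H \<Longrightarrow> 0 < \<epsilon> \<Longrightarrow> \<exists>u\<in>D. nrm (u - v) < \<epsilon>"
  and adjoint: "v \<in> H \<Longrightarrow> w \<in> H \<Longrightarrow> (\<forall>u\<in>D. ip (A u) v = ip u w) \<longleftrightarrow> (\<exists>u\<in>D. ae_equal G len u v \<and> ae_equal G len (A u) w)"
  using realisation unfolding selfadjoint_laplacian_def selfadjoint_operator_def L2_norm_eq_nrm fun_diff_def
  by blast+

lemma D_H2: "u \<in> D \<Longrightarrow> u \<in> H2_graph G len"
  and A_weak: "u \<in> D \<Longrightarrow> e \<in> arcs G \<Longrightarrow> weak_deriv2 (len e) (u e) (\<lambda>x. - A u e x)"
  using realisation unfolding selfadjoint_laplacian_def vertex_conditions_domain_def by blast+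

lemma D_continuous: "u \<in> D \<Longrightarrow> e \<in> arcs G \<Longrightarrow> continuous_on {0..len e} (u e)"
  using D_H2 unfolding H2_graph_def H2_interval_def by blast

lemma ae_equal_refl: "ae_equal G len u u" by (simp add: ae_equal_def ae_on_graph_def)

lemma A_symmetric: "u \<in> D \<Longrightarrow> v \<in> D \<Longrightarrow> ip (A u) v = ip u (A v)"
  using adjoint[of v "A v"] D_H A_H ae_equal_refl by blast

definition continuous_on_edges :: "'e graph_fun \<Rightarrow> bool" where
  "continuous_on_edges v \<longleftrightarrow> (\<forall>e\<in>arcs G. continuous_on {0..len e} (v e))"

lemma continuous_H: "continuous_on_edges v \<Longrightarrow> v \<in> H"
  by (auto simp: continuous_on_edges_def L2_graph_def intro: L2_interval_continuous)

text \<open>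
  The domain of the adjoint, restricted to functions that are continuous on the edges. Its elements agree on the edges
  with elements of \<open>D\<close> (\<open>D_cont_representative\<close>), but unlike membership in \<open>D\<close> the defining condition is visibly linear.
\<close>

definition D_cont :: "'e graph_fun set" where
  "D_cont = {v. continuous_on_edges v \<and> (\<exists>w\<in>H. \<forall>u\<in>D. ip (A u) v = ip u w)}"

text \<open>
  The adjoint on \<open>D_cont\<close>. Its values are determined up to null vectors, and on \<open>D\<close> they are those of \<open>A\<close>.
\<close>

definition A_cont :: "'e graph_fun \<Rightarrow> 'e graph_fun" where
  "A_cont v = (if v \<in> D then A v else (SOME w. w \<in> H \<and> (\<forall>u\<in>D. ip (A u) v = ip u w)))"

lemma D_D_cont: "u \<in> D \<Longrightarrow> u \<in> D_cont"
  unfolding D_cont_def continuous_on_edges_def using D_continuous A_symmetric A_H by blast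

lemma D_cont_H [simp]: "v \<in> D_cont \<Longrightarrow> v \<in> H"
  unfolding D_cont_def using continuous_H by blast

lemma D_cont_continuous: "v \<in> D_cont \<Longrightarrow> e \<in> arcs G \<Longrightarrow> continuous_on {0..len e} (v e)"
  unfolding D_cont_def continuous_on_edges_def by blast

lemma A_cont: assumes "v \<in> D_cont"
  shows A_cont_H: "A_cont v \<in> H" and A_cont_adjoint: "u \<in> D \<Longrightarrow> ip (A u) v = ip u (A_cont v)"
proof -
  have "A_cont v \<in> H \<and> (\<forall>u\<in>D. ip (A u) v = ip u (A_cont v))"
  proof (cases "v \<in> D")
    case True
    then show ?thesis using A_H A_symmetric by (simp add: A_cont_def)
  next
    case False
    then have eq: "A_cont v = (SOME w. w \<in> H \<and> (\<forall>u\<in>D. ip (A u) v = ip u w))" by (simp add: A_cont_def)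
    have "\<exists>w. w \<in> H \<and> (\<forall>u\<in>D. ip (A u) v = ip u w)" using assms unfolding D_cont_def by blast
    then show ?thesis unfolding eq by (rule someI_ex)
  qed
  then show "A_cont v \<in> H" "u \<in> D \<Longrightarrow> ip (A u) v = ip u (A_cont v)" by blast+
qed

lemma ae_equal_continuous:
  assumes "continuous_on_edges u" "continuous_on_edges v" "ae_equal G len u v" "e \<in> arcs G" "x \<in> {0..len e}"
  shows "u e x = v e x"
  using assms(3)
  by (intro AE_continuous_eq[OF len_pos[OF assms(4)] _ _ _ assms(5)])
     (use assms in \<open>auto simp: continuous_on_edges_def ae_equal_def ae_on_graph_def\<close>)

text \<open>
  Self-adjointness enters here: elements of the domain of the adjoint are represented in \<open>D\<close>, and continuous functions that
  agree almost everywhere agree.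
\<close>

lemma D_cont_representative: assumes "v \<in> D_cont"
  obtains u where "u \<in> D" "ae_equal G len u v" "ae_equal G len (A u) (A_cont v)"
    "\<And>e x. e \<in> arcs G \<Longrightarrow> x \<in> {0..len e} \<Longrightarrow> u e x = v e x"
proof -
  obtain u where u: "u \<in> D" "ae_equal G len u v" "ae_equal G len (A u) (A_cont v)"
    using adjoint[of v "A_cont v"] A_cont[OF assms] assms by auto
  have "continuous_on_edges u" "continuous_on_edges v"
    using D_continuous[OF u(1)] D_cont_continuous[OF assms] by (auto simp: continuous_on_edges_def)
  then show ?thesis using that u ae_equal_continuous by blast
qed

lemma D_cont_subspace: "subspace D_cont"
  unfolding subspace_def
proof (intro conjI ballI allI)
  show "0 \<in> D_cont"
    unfolding D_cont_def mem_Collect_eq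
  proof (intro conjI bexI[of _ 0] ballI)
    show "continuous_on_edges 0" by (simp add: continuous_on_edges_def zero_fun_def)
    show "ip (A y) 0 = ip y 0" if "y \<in> D" for y using that A_H D_H by simp
  qed simp
  fix u v :: "'e graph_fun" and r :: real
  assume u: "u \<in> D_cont"
  show "r *\<^sub>R u \<in> D_cont"
    unfolding D_cont_def mem_Collect_eq
  proof (intro conjI bexI[of _ "r *\<^sub>R A_cont u"] ballI)
    show "continuous_on_edges (r *\<^sub>R u)"
      unfolding continuous_on_edges_def scaleR_fun_def using D_cont_continuous[OF u] by (intro ballI continuous_intros)
    show "ip (A y) (r *\<^sub>R u) = ip y (r *\<^sub>R A_cont u)" if "y \<in> D" for y
      using that u A_cont[OF u] D_H A_H by (simp add: ip_scale_right)
  qed (use A_cont_H[OF u] in simp)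
  assume v: "v \<in> D_cont"
  show "u + v \<in> D_cont"
    unfolding D_cont_def mem_Collect_eq
  proof (intro conjI bexI[of _ "A_cont u + A_cont v"] ballI)
    show "continuous_on_edges (u + v)"
      unfolding continuous_on_edges_def plus_fun_def using D_cont_continuous[OF u] D_cont_continuous[OF v]
      by (intro ballI continuous_intros)
    show "ip (A y) (u + v) = ip y (A_cont u + A_cont v)" if "y \<in> D" for y
      using that u v A_cont[OF u] A_cont[OF v] D_H A_H by (simp add: ip_add_right)
  qed (use A_cont_H[OF u] A_cont_H[OF v] in simp)
qed

lemma D_cont_simps [simp]: "u \<in> D_cont \<Longrightarrow> v \<in> D_cont \<Longrightarrow> u + v \<in> D_cont" "u \<in> D_cont \<Longrightarrow> v \<in> D_cont \<Longrightarrow> u - v \<in> D_cont" "u \<in> D_cont \<Longrightarrow> r *\<^sub>R u \<in> D_cont"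
  using D_cont_subspace by (simp_all add: subspace_add subspace_diff subspace_scale)

lemma D_cont_sum [simp]: "(\<And>i. i \<in> I \<Longrightarrow> f i \<in> D_cont) \<Longrightarrow> (\<Sum>i\<in>I. f i) \<in> D_cont"
  using D_cont_subspace by (simp add: subspace_sum)

lemma ip_ae_cong: "u \<in> H \<Longrightarrow> v \<in> H \<Longrightarrow> w \<in> H \<Longrightarrow> ae_equal G len u v \<Longrightarrow> ip u w = ip v w"
  using null_diff_ip[of u v w] ae_equal_iff[of u v] by simp

lemma A_cont_symmetric: assumes "u \<in> D_cont" "v \<in> D_cont" shows "ip (A_cont u) v = ip u (A_cont v)"
proof -
  obtain y where y: "y \<in> D" "ae_equal G len y u" "ae_equal G len (A y) (A_cont u)"
    using D_cont_representative[OF assms(1)] by metis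
  have "ip (A_cont u) v = ip (A y) v" using y assms A_cont_H A_H by (intro ip_ae_cong[symmetric]) auto
  also have "\<dots> = ip y (A_cont v)" using A_cont_adjoint[OF assms(2) y(1)] .
  also have "\<dots> = ip u (A_cont v)" using y assms A_cont_H D_H by (intro ip_ae_cong) auto
  finally show ?thesis .
qed

lemma A_cont_closed:
  assumes v: "v \<in> H" and w: "w \<in> H" and a: "\<And>u. u \<in> D_cont \<Longrightarrow> ip (A_cont u) v = ip u w"
  shows "\<exists>u\<in>D. ip (u - v) (u - v) = 0 \<and> ip (A u - w) (A u - w) = 0"
proof -
  have "\<forall>u\<in>D. ip (A u) v = ip u w" using a D_D_cont unfolding A_cont_def by force
  then obtain u where "u \<in> D" "ae_equal G len u v" "ae_equal G len (A u) w" using adjoint[OF v w] by blast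
  then show ?thesis using ae_equal_iff v w D_H A_H by blast
qed

definition edge_deriv :: "'e graph_fun \<Rightarrow> 'e graph_fun" where
  "edge_deriv v e x = vector_derivative (v e) (at x within {0..len e})"

lemma edge_deriv_eqI:
  assumes "e \<in> arcs G" "x \<in> {0..len e}" "(v e has_real_derivative d) (at x within {0..len e})"
  shows "edge_deriv v e x = d"
  unfolding edge_deriv_def using assms len_pos[OF assms(1)]
  by (intro vector_derivative_within_closed_interval)
     (auto simp: has_real_derivative_iff_has_vector_derivative)

lemma D_cont_H2_pair: assumes v: "v \<in> D_cont" and u: "u \<in> D" and eq: "\<And>e x. e \<in> arcs G \<Longrightarrow> x \<in> {0..len e} \<Longrightarrow> u e x = v e x"
  and e: "e \<in> arcs G"
  shows "H2_pair (len e) (v e) (edge_deriv v e) (\<lambda>x. - A u e x)"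
proof -
  have l: "0 < len e" using len_pos e .
  let ?h = "\<lambda>x. - A u e x"
  have "A u e \<in> L2_interval (len e)" using A_H[OF u] e by (auto simp: L2_graph_def)
  then have h: "set_integrable lborel {0..len e} ?h"
    using L2_interval_integrable[OF L2_interval_scale[of "A u e" "len e" "-1"]] by simp
  obtain c where c: "\<And>x. x \<in> {0..len e} \<Longrightarrow> (u e has_real_derivative c + (LBINT t:{0..x}. ?h t)) (at x within {0..len e})"
    using H2_regularity[OF l D_continuous[OF u e] A_weak[OF u e] h L2_interval_integrable] by blast
  have d: "(v e has_real_derivative c + (LBINT t:{0..x}. ?h t)) (at x within {0..len e})" if x: "x \<in> {0..len e}" for x
    by (rule has_field_derivative_transform_within[OF c[OF x], of 1]) (use x eq[OF e] in auto)
  have edge_deriv: "edge_deriv v e x = c + (LBINT t:{0..x}. ?h t)" if x: "x \<in> {0..len e}" for x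
    by (rule edge_deriv_eqI[where v = v, OF e x d[OF x]])
  have edge_deriv0: "edge_deriv v e 0 = c" using edge_deriv[of 0] primitive_at_0[OF l h] l by simp
  show ?thesis
    unfolding H2_pair_def
  proof (intro conjI ballI h)
    fix x assume x: "x \<in> {0..len e}"
    show "(v e has_real_derivative edge_deriv v e x) (at x within {0..len e})" using d[OF x] edge_deriv[OF x] by simp
    show "edge_deriv v e x = edge_deriv v e 0 + (LBINT t:{0..x}. ?h t)" using edge_deriv[OF x] edge_deriv0 by simp
  qed
qed

lemma edge_deriv: assumes "v \<in> D_cont" "e \<in> arcs G"
  shows edge_deriv_deriv: "x \<in> {0..len e} \<Longrightarrow> (v e has_real_derivative edge_deriv v e x) (at x within {0..len e})"
    and edge_deriv_continuous: "continuous_on {0..len e} (edge_deriv v e)"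
proof -
  obtain u where u: "u \<in> D" "\<And>e x. e \<in> arcs G \<Longrightarrow> x \<in> {0..len e} \<Longrightarrow> u e x = v e x"
    using D_cont_representative[OF assms(1)] by metis
  from D_cont_H2_pair[OF assms(1) u assms(2)]
  have p: "H2_pair (len e) (v e) (edge_deriv v e) (\<lambda>x. - A u e x)" .
  show "continuous_on {0..len e} (edge_deriv v e)" using H2_pair_cont(2)[OF p] .
  show "x \<in> {0..len e} \<Longrightarrow> (v e has_real_derivative edge_deriv v e x) (at x within {0..len e})"
    using p unfolding H2_pair_def by blast
qed

definition energy :: "'e graph_fun \<Rightarrow> 'e graph_fun \<Rightarrow> real" where
  "energy u v = (\<Sum>e\<in>arcs G. LBINT x:{0..len e}. edge_deriv u e x * edge_deriv v e x)"

text \<open>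
  What integration by parts leaves over at the edge ends. The definition makes symmetry evident, while \<open>boundary_form_ends\<close>
  shows that the values at the ends are all that matters.
\<close>

definition boundary_form :: "'e graph_fun \<Rightarrow> 'e graph_fun \<Rightarrow> real" where
  "boundary_form u v = ip (A_cont u) v - energy u v"

lemma boundary_form_ends: assumes v: "v \<in> D_cont" and w: "w \<in> D_cont"
  shows "boundary_form v w = (\<Sum>e\<in>arcs G. edge_deriv v e 0 * w e 0 - edge_deriv v e (len e) * w e (len e))"
proof -
  obtain u where u: "u \<in> D" "ae_equal G len (A u) (A_cont v)" "\<And>e x. e \<in> arcs G \<Longrightarrow> x \<in> {0..len e} \<Longrightarrow> u e x = v e x"
    using D_cont_representative[OF v] by metis
  have "ip (A_cont v) w = ip (A u) w" using u A_H A_cont_H[OF v] w by (intro ip_ae_cong[symmetric]) auto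
  also have "\<dots> = (\<Sum>e\<in>arcs G. LBINT x:{0..len e}. edge_deriv v e x * edge_deriv w e x) +
     (\<Sum>e\<in>arcs G. edge_deriv v e 0 * w e 0 - edge_deriv v e (len e) * w e (len e))"
    unfolding L2_inner_def sum.distrib[symmetric]
  proof (rule sum.cong[OF refl])
    fix e assume e: "e \<in> arcs G"
    have "(LBINT x:{0..len e}. - A u e x * w e x) =
      edge_deriv v e (len e) * w e (len e) - edge_deriv v e 0 * w e 0 - (LBINT x:{0..len e}. edge_deriv v e x * edge_deriv w e x)"
      using len_pos[OF e] edge_deriv[OF w e] by (intro green_identity[OF _ D_cont_H2_pair[OF v u(1,3) e]]) auto
    moreover have "(LBINT x:{0..len e}. - A u e x * w e x) = - (LBINT x:{0..len e}. A u e x * w e x)"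
      by (simp add: set_lebesgue_integral_def)
    ultimately show "(LBINT x:{0..len e}. A u e x * w e x) =
       (LBINT x:{0..len e}. edge_deriv v e x * edge_deriv w e x) + (edge_deriv v e 0 * w e 0 - edge_deriv v e (len e) * w e (len e))"
      by simp
  qed
  finally show ?thesis by (simp add: boundary_form_def energy_def)
qed

lemma boundary_form_sym: "u \<in> D_cont \<Longrightarrow> v \<in> D_cont \<Longrightarrow> boundary_form u v = boundary_form v u"
  unfolding boundary_form_def energy_def by (simp add: A_cont_symmetric ip_sym[of u "A_cont v"] A_cont_H mult.commute)

lemma boundary_form_add_right: "u \<in> D_cont \<Longrightarrow> v \<in> D_cont \<Longrightarrow> w \<in> D_cont \<Longrightarrow> boundary_form u (v + w) = boundary_form u v + boundary_form u w"
  by (simp add: boundary_form_ends algebra_simps sum.distrib[symmetric])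

lemma boundary_form_scale_right: "u \<in> D_cont \<Longrightarrow> v \<in> D_cont \<Longrightarrow> boundary_form u (r *\<^sub>R v) = r * boundary_form u v"
  by (simp add: boundary_form_ends sum_distrib_left algebra_simps)

lemma boundary_form_sum_right: "u \<in> D_cont \<Longrightarrow> (\<And>i. i \<in> I \<Longrightarrow> f i \<in> D_cont) \<Longrightarrow> boundary_form u (\<Sum>i\<in>I. f i) = (\<Sum>i\<in>I. boundary_form u (f i))"
proof (induction I rule: infinite_finite_induct)
  case empty
  have "boundary_form u 0 = 0" using boundary_form_scale_right[of u u 0] empty by (simp only: scaleR_zero_left mult_zero_left)
  then show ?case by (simp only: sum.empty)
next
  case (infinite I)
  have "boundary_form u 0 = 0" using boundary_form_scale_right[of u u 0] infinite by (simp only: scaleR_zero_left mult_zero_left)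
  then show ?case using infinite by (simp only: sum.infinite if_False simp_thms)
qed (simp add: boundary_form_add_right)

definition ends :: "('e graph_fun \<Rightarrow> real) set" where
  "ends = (\<lambda>e u. u e 0) ` arcs G \<union> (\<lambda>e u. u e (len e)) ` arcs G"

lemma boundary_form_vanish: assumes "u \<in> D_cont" "w \<in> D_cont" "\<And>l. l \<in> ends \<Longrightarrow> l w = 0" shows "boundary_form u w = 0"
proof -
  have "w e 0 = 0" "w e (len e) = 0" if "e \<in> arcs G" for e
    using assms(3) that unfolding ends_def by auto
  then show ?thesis by (simp add: boundary_form_ends[OF assms(1,2)])
qed

text \<open>
  By symmetry and \<open>boundary_form_vanish\<close> the form depends on both arguments only through the finitely many end
  values, so it can be evaluated on the vectors dual to them.
\<close>

lemma boundary_form_bound: "\<exists>M\<ge>0. \<forall>v\<in>D_cont. \<forall>t. (\<forall>l\<in>ends. (l v)\<^sup>2 \<le> t) \<longrightarrow> \<bar>boundary_form v v\<bar> \<le> M * t"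
proof -
  have fin: "finite ends" by (simp add: ends_def)
  have lin: "linear l" if "l \<in> ends" for l using that unfolding ends_def by (auto intro: linear_evaluation)
  obtain E where E: "\<And>l. l \<in> ends \<Longrightarrow> E l \<in> D_cont"
    and k: "\<And>u k. u \<in> D_cont \<Longrightarrow> k \<in> ends \<Longrightarrow> k (u - (\<Sum>l\<in>ends. l u *\<^sub>R E l)) = 0"
    using dual_vectors[OF fin D_cont_subspace lin] by blast
  define M where "M = (\<Sum>l\<in>ends. \<Sum>k\<in>ends. \<bar>boundary_form (E l) (E k)\<bar>)"
  have "\<bar>boundary_form v v\<bar> \<le> M * t" if v: "v \<in> D_cont" and t: "\<And>l. l \<in> ends \<Longrightarrow> (l v)\<^sup>2 \<le> t" for v t
  proof -
    define s where "s = (\<Sum>l\<in>ends. l v *\<^sub>R E l)"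
    have s: "s \<in> D_cont" unfolding s_def using E by simp
    have w: "v - s \<in> D_cont" using v s by simp
    have van: "boundary_form u (v - s) = 0" if "u \<in> D_cont" for u
      using that w k[OF v] unfolding s_def by (intro boundary_form_vanish) auto
    have "boundary_form v v = boundary_form v s" using boundary_form_add_right[OF v w s] van[OF v] by simp
    also have "\<dots> = boundary_form s s" using boundary_form_add_right[OF s w s] van[OF s] boundary_form_sym[OF v s] by simp
    also have "\<dots> = (\<Sum>l\<in>ends. l v * boundary_form s (E l))"
      by (subst (2) s_def) (simp add: boundary_form_sum_right s E boundary_form_scale_right)
    also have "\<dots> = (\<Sum>l\<in>ends. \<Sum>k\<in>ends. l v * k v * boundary_form (E l) (E k))"
    proof (rule sum.cong[OF refl])
      fix l assume l: "l \<in> ends"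
      have "boundary_form s (E l) = boundary_form (E l) s" by (rule boundary_form_sym[OF s E[OF l]])
      also have "\<dots> = (\<Sum>k\<in>ends. k v * boundary_form (E l) (E k))"
        unfolding s_def using E l by (simp add: boundary_form_sum_right boundary_form_scale_right)
      finally show "l v * boundary_form s (E l) = (\<Sum>k\<in>ends. l v * k v * boundary_form (E l) (E k))"
        by (simp add: sum_distrib_left mult.assoc)
    qed
    finally have "\<bar>boundary_form v v\<bar> \<le> (\<Sum>l\<in>ends. \<Sum>k\<in>ends. \<bar>l v * k v * boundary_form (E l) (E k)\<bar>)"
      by (simp add: order_trans[OF sum_abs] sum_mono)
    also have "\<dots> \<le> (\<Sum>l\<in>ends. \<Sum>k\<in>ends. t * \<bar>boundary_form (E l) (E k)\<bar>)"
    proof (intro sum_mono)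
      fix l k assume lk: "l \<in> ends" "k \<in> ends"
      have "0 \<le> (\<bar>l v\<bar> - \<bar>k v\<bar>)\<^sup>2" by simp
      then have "\<bar>l v * k v\<bar> \<le> t" using t[OF lk(1)] t[OF lk(2)] by (simp add: power2_diff abs_mult)
      then show "\<bar>l v * k v * boundary_form (E l) (E k)\<bar> \<le> t * \<bar>boundary_form (E l) (E k)\<bar>"
        by (simp add: abs_mult mult_right_mono)
    qed
    also have "\<dots> = M * t" unfolding M_def by (simp add: sum_distrib_left sum_distrib_right mult.commute)
    finally show ?thesis .
  qed
  moreover have "M \<ge> 0" unfolding M_def by (intro sum_nonneg) simp
  ultimately show ?thesis by blast
qed

end


section \<open>The quadratic form: lower bound, compactness and Weyl estimate\<close>

text \<open>
  On each cell of the grid \<open>u\<close> vanishes at the left end point, so \<open>(u x)\<^sup>2\<close> is at most \<open>h\<close> times the integral of \<open>v\<^sup>2\<close> over the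
  same cell. Keeping the cells separate gives the factor \<open>h\<^sup>2\<close>.
\<close>

lemma poincare_grid:
  fixes u v :: "real \<Rightarrow> real"
  assumes d: "\<And>x. x \<in> {0..h * real m} \<Longrightarrow> (u has_real_derivative v x) (at x within {0..h * real m})"
    and v: "continuous_on {0..h * real m} v" and h: "0 \<le> h"
    and z: "\<And>j. j \<le> m \<Longrightarrow> u (h * real j) = 0"
  shows "integral {0..h * real m} (\<lambda>x. (u x)\<^sup>2) \<le> h\<^sup>2 * integral {0..h * real m} (\<lambda>x. (v x)\<^sup>2)"
proof -
  have u: "continuous_on {0..h * real m} u" using d by (intro DERIV_continuous_on)
  have "integral {0..h * real k} (\<lambda>x. (u x)\<^sup>2) \<le> h\<^sup>2 * integral {0..h * real k} (\<lambda>x. (v x)\<^sup>2)" if "k \<le> m" for k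
    using that
  proof (induction k)
    case (Suc k)
    let ?a = "h * real k" and ?b = "h * real (Suc k)"
    have a0: "0 \<le> ?a" and ab: "?a \<le> ?b" and bm: "?b \<le> h * real m"
      using h Suc.prems by (auto intro!: mult_left_mono)
    have s: "{?a..?b} \<subseteq> {0..h * real m}" "{0..?b} \<subseteq> {0..h * real m}" using a0 ab bm by auto
    have i: "(\<lambda>x. (f x)\<^sup>2) integrable_on {?a..?b}" "(\<lambda>x. (f x)\<^sup>2) integrable_on {0..?b}"
      if "continuous_on {0..h * real m} f" for f :: "real \<Rightarrow> real"
      by (intro integrable_continuous_real continuous_intros continuous_on_subset[OF that] s)+
    let ?V = "integral {?a..?b} (\<lambda>x. (v x)\<^sup>2)"
    have V0: "0 \<le> ?V" by (intro integral_nonneg i v) auto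
    have "(u x)\<^sup>2 \<le> h * ?V" if x: "x \<in> {?a..?b}" for x
    proof -
      have "(u x - u ?a)\<^sup>2 \<le> \<bar>x - ?a\<bar> * ?V"
        using x ab by (intro increment_bound DERIV_subset[OF d] continuous_on_subset[OF v s(1)]) (use s in auto)
      also have "\<dots> \<le> h * ?V" using x V0 by (intro mult_right_mono) (auto simp: algebra_simps)
      finally show ?thesis using z[of k] Suc.prems by simp
    qed
    then have "integral {?a..?b} (\<lambda>x. (u x)\<^sup>2) \<le> integral {?a..?b} (\<lambda>x. h * ?V)"
      by (intro integral_le i u) auto
    also have "\<dots> = h\<^sup>2 * ?V" using h ab by (simp add: algebra_simps power2_eq_square)
    finally have 1: "integral {?a..?b} (\<lambda>x. (u x)\<^sup>2) \<le> h\<^sup>2 * ?V" .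
    have "integral {0..?b} (\<lambda>x. (u x)\<^sup>2) = integral {0..?a} (\<lambda>x. (u x)\<^sup>2) + integral {?a..?b} (\<lambda>x. (u x)\<^sup>2)"
      by (rule Henstock_Kurzweil_Integration.integral_combine[symmetric, OF a0 ab i(2)[OF u]])
    moreover have "integral {0..?b} (\<lambda>x. (v x)\<^sup>2) = integral {0..?a} (\<lambda>x. (v x)\<^sup>2) + ?V"
      by (rule Henstock_Kurzweil_Integration.integral_combine[symmetric, OF a0 ab i(2)[OF v]])
    ultimately show ?case using 1 Suc by (simp add: distrib_left)
  qed simp
  then show ?thesis by simp
qed

context sa_graph
begin

lemma integral_le_ip: assumes "v \<in> D_cont" "e \<in> arcs G"
  shows "integral {0..len e} (\<lambda>x. (v e x)\<^sup>2) \<le> ip v v" "0 \<le> integral {0..len e} (\<lambda>x. (v e x)\<^sup>2)"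
proof -
  have c: "continuous_on {0..len e} (\<lambda>x. v e x * v e x)" if "e \<in> arcs G" for e
    by (intro continuous_intros D_cont_continuous assms that)
  have eq: "(LBINT x:{0..len e}. v e x * v e x) = integral {0..len e} (\<lambda>x. (v e x)\<^sup>2)" if "e \<in> arcs G" for e
    using LBINT_continuous[OF c[OF that]] by (simp add: power2_eq_square)
  have nn: "0 \<le> integral {0..len e} (\<lambda>x. (v e x)\<^sup>2)" if "e \<in> arcs G" for e
    using c[OF that] by (intro integral_nonneg integrable_continuous_real) (auto simp: power2_eq_square)
  have "ip v v = (\<Sum>e\<in>arcs G. integral {0..len e} (\<lambda>x. (v e x)\<^sup>2))"
    unfolding L2_inner_def by (intro sum.cong refl eq)
  then show "integral {0..len e} (\<lambda>x. (v e x)\<^sup>2) \<le> ip v v"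
    using member_le_sum[of e "arcs G" "\<lambda>e. integral {0..len e} (\<lambda>x. (v e x)\<^sup>2)"] nn assms(2) by simp
  show "0 \<le> integral {0..len e} (\<lambda>x. (v e x)\<^sup>2)" using nn assms(2) .
qed

lemma energy_eq: assumes "v \<in> D_cont"
  shows "energy v v = (\<Sum>e\<in>arcs G. integral {0..len e} (\<lambda>x. (edge_deriv v e x)\<^sup>2))"
  unfolding energy_def
proof (rule sum.cong[OF refl])
  fix e assume e: "e \<in> arcs G"
  have "continuous_on {0..len e} (\<lambda>x. edge_deriv v e x * edge_deriv v e x)"
    by (intro continuous_intros edge_deriv_continuous assms e)
  from LBINT_continuous[OF this]
  show "(LBINT x:{0..len e}. edge_deriv v e x * edge_deriv v e x) = integral {0..len e} (\<lambda>x. (edge_deriv v e x)\<^sup>2)"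
    by (simp add: power2_eq_square)
qed

lemma energy_edge: assumes "v \<in> D_cont" "e \<in> arcs G"
  shows "integral {0..len e} (\<lambda>x. (edge_deriv v e x)\<^sup>2) \<le> energy v v" "0 \<le> energy v v"
proof -
  have nn: "0 \<le> integral {0..len e} (\<lambda>x. (edge_deriv v e x)\<^sup>2)" if "e \<in> arcs G" for e
    by (intro integral_nonneg integrable_continuous_real continuous_intros edge_deriv_continuous assms that) auto
  then show "integral {0..len e} (\<lambda>x. (edge_deriv v e x)\<^sup>2) \<le> energy v v"
    unfolding energy_eq[OF assms(1)] using assms(2) by (intro member_le_sum) auto
  show "0 \<le> energy v v" unfolding energy_eq[OF assms(1)] using nn by (intro sum_nonneg) auto
qed

lemma pointwise_bound:
  assumes v: "v \<in> D_cont" and e: "e \<in> arcs G" and x: "x \<in> {0..len e}" and \<delta>: "0 < \<delta>" "\<delta> \<le> len e"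
  shows "(v e x)\<^sup>2 \<le> 2 / \<delta> * ip v v + 2 * \<delta> * energy v v"
proof -
  have "(v e x)\<^sup>2 \<le> 2 / \<delta> * integral {0..len e} (\<lambda>x. (v e x)\<^sup>2) + 2 * \<delta> * integral {0..len e} (\<lambda>x. (edge_deriv v e x)\<^sup>2)"
    by (rule value_le_integrals[OF edge_deriv[OF v e] x \<delta>])
  also have "\<dots> \<le> 2 / \<delta> * ip v v + 2 * \<delta> * energy v v"
    using integral_le_ip(1)[OF v e] energy_edge(1)[OF v e] \<delta> by (intro add_mono mult_left_mono) auto
  finally show ?thesis .
qed

definition "min_len = Min (len ` arcs G)"

lemma min_len: "0 < min_len" "e \<in> arcs G \<Longrightarrow> min_len \<le> len e"
  using len_pos arcs_nonempty by (auto simp: min_len_def)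

text \<open>
  End values are controlled by \<open>pointwise_bound\<close> with an arbitrarily small share \<open>\<delta>\<close> of the energy, so for small \<open>\<delta>\<close> the boundary
  form is absorbed.
\<close>

lemma form_lower_bound: "\<exists>C\<ge>0. \<forall>v\<in>D_cont. energy v v / 2 - C * ip v v \<le> ip (A_cont v) v"
proof -
  obtain M where M: "M \<ge> 0" "\<And>v t. v \<in> D_cont \<Longrightarrow> (\<And>l. l \<in> ends \<Longrightarrow> (l v)\<^sup>2 \<le> t) \<Longrightarrow> \<bar>boundary_form v v\<bar> \<le> M * t"
    using boundary_form_bound by blast
  define \<delta> where "\<delta> = min min_len (1 / (4 * M + 4))"
  have d: "0 < \<delta>" "\<And>e. e \<in> arcs G \<Longrightarrow> \<delta> \<le> len e" "\<delta> \<le> 1 / (4 * M + 4)"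
    using min_len M(1) by (auto simp: \<delta>_def min_le_iff_disj)
  \<comment> \<open>The second bound in the choice of \<open>\<delta>\<close> makes the boundary form cost at most half of the energy.\<close>
  have Md: "M * (2 * \<delta>) \<le> 1 / 2"
  proof -
    have "M * (2 * \<delta>) \<le> M * (2 * (1 / (4 * M + 4)))" using d(3) M(1) by (intro mult_left_mono) auto
    also have "\<dots> \<le> 1 / 2" using M(1) by (simp add: field_simps)
    finally show ?thesis .
  qed
  have "energy v v / 2 - M * (2 / \<delta>) * ip v v \<le> ip (A_cont v) v" if v: "v \<in> D_cont" for v
  proof -
    obtain e0 where e0: "e0 \<in> arcs G" using arcs_nonempty by blast
    have "(l v)\<^sup>2 \<le> 2 / \<delta> * ip v v + 2 * \<delta> * energy v v" if l: "l \<in> ends" for l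
    proof -
      obtain e where e: "e \<in> arcs G" "l = (\<lambda>u. u e 0) \<or> l = (\<lambda>u. u e (len e))" using l by (auto simp: ends_def)
      then show ?thesis using pointwise_bound[OF v e(1) _ d(1) d(2)[OF e(1)]] len_pos[OF e(1)] by auto
    qed
    from M(2)[OF v, of "2 / \<delta> * ip v v + 2 * \<delta> * energy v v"] this have "\<bar>boundary_form v v\<bar> \<le> M * (2 / \<delta> * ip v v + 2 * \<delta> * energy v v)" .
    also have "\<dots> = M * (2 / \<delta>) * ip v v + M * (2 * \<delta>) * energy v v" by (simp add: algebra_simps)
    also have "M * (2 * \<delta>) * energy v v \<le> 1 / 2 * energy v v"
      by (rule mult_right_mono[OF Md energy_edge(2)[OF v e0]])
    finally show ?thesis unfolding boundary_form_def by linarith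
  qed
  moreover have "0 \<le> M * (2 / \<delta>)" using M(1) d(1) by simp
  ultimately show ?thesis by blast
qed

definition "form_const = (SOME C. C \<ge> 0 \<and> (\<forall>v\<in>D_cont. energy v v / 2 - C * ip v v \<le> ip (A_cont v) v))"

lemma form_const: "form_const \<ge> 0" "v \<in> D_cont \<Longrightarrow> energy v v / 2 - form_const * ip v v \<le> ip (A_cont v) v"
proof -
  have "\<exists>C. C \<ge> 0 \<and> (\<forall>v\<in>D_cont. energy v v / 2 - C * ip v v \<le> ip (A_cont v) v)" using form_lower_bound by blast
  from someI_ex[OF this, folded form_const_def] show "form_const \<ge> 0" "v \<in> D_cont \<Longrightarrow> energy v v / 2 - form_const * ip v v \<le> ip (A_cont v) v" by blast+
qed

lemma nrm_le_sup:
  assumes w: "w \<in> H" and b: "\<And>e x. e \<in> arcs G \<Longrightarrow> x \<in> {0..len e} \<Longrightarrow> \<bar>w e x\<bar> \<le> \<eta>" and \<eta>: "0 \<le> \<eta>"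
  shows "nrm w \<le> sqrt (\<Sum>e\<in>arcs G. len e) * \<eta>"
proof -
  have "ip w w \<le> (\<Sum>e\<in>arcs G. len e * \<eta>\<^sup>2)"
    unfolding L2_inner_def
  proof (rule sum_mono)
    fix e assume e: "e \<in> arcs G"
    have c: "continuous_on {0..len e} (\<lambda>x. \<eta>\<^sup>2)" by simp
    have "(LBINT x:{0..len e}. w e x * w e x) \<le> (LBINT x:{0..len e}. \<eta>\<^sup>2)"
    proof (rule set_integral_mono)
      show "set_integrable lborel {0..len e} (\<lambda>x. w e x * w e x)"
        using w e by (auto simp: L2_graph_def intro: L2_interval_mult)
      show "set_integrable lborel {0..len e} (\<lambda>x. \<eta>\<^sup>2)" by (rule set_integrable_continuous[OF c])
      show "w e x * w e x \<le> \<eta>\<^sup>2" if "x \<in> {0..len e}" for x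
        using power_mono[OF b[OF e that], of 2] by (simp add: power2_eq_square)
    qed
    also have "\<dots> = len e * \<eta>\<^sup>2" unfolding LBINT_continuous[OF c] using len_pos[OF e] by simp
    finally show "(LBINT x:{0..len e}. w e x * w e x) \<le> len e * \<eta>\<^sup>2" .
  qed
  also have "\<dots> = (\<Sum>e\<in>arcs G. len e) * \<eta>\<^sup>2" by (simp add: sum_distrib_right)
  finally have "nrm w \<le> sqrt ((\<Sum>e\<in>arcs G. len e) * \<eta>\<^sup>2)" unfolding nrm_def by (rule real_sqrt_le_mono)
  then show ?thesis using \<eta> by (simp add: real_sqrt_mult)
qed

text \<open>
  Bounded energy gives uniform bounds and a uniform Hoelder estimate, so the theorem of Arzela and Ascoli applies on each
  edge; subsequences are extracted edge by edge.
\<close>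

lemma A_cont_compact:
  assumes x: "\<And>k::nat. x k \<in> D_cont" and K: "\<And>k. ip (x k) (x k) \<le> K" "\<And>k. ip (A_cont (x k)) (x k) \<le> K"
  shows "\<exists>r v. strict_mono r \<and> v \<in> H \<and> (\<lambda>k. nrm (x (r k) - v)) \<longlonglongrightarrow> 0"
proof -
  define M where "M = 2 * (K + form_const * K)"
  obtain e0 where e0: "e0 \<in> arcs G" using arcs_nonempty by blast
  have en: "energy (x k) (x k) \<le> M" for k
  proof -
    have "form_const * ip (x k) (x k) \<le> form_const * K" using form_const(1) K(1) by (intro mult_left_mono)
    then show ?thesis using form_const(2)[OF x, of k] K(2)[of k] unfolding M_def by simp
  qed
  have M0: "0 \<le> M" using energy_edge(2)[OF x e0] en order_trans by blast
  define B where "B = 2 / min_len * K + 2 * min_len * M"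
  have bd: "(x k e y)\<^sup>2 \<le> B" if "e \<in> arcs G" "y \<in> {0..len e}" for k e y
  proof -
    have "(x k e y)\<^sup>2 \<le> 2 / min_len * ip (x k) (x k) + 2 * min_len * energy (x k) (x k)"
      by (rule pointwise_bound[OF x that min_len(1) min_len(2)[OF that(1)]])
    also have "\<dots> \<le> B" unfolding B_def using K(1) en min_len(1) by (intro add_mono mult_left_mono) auto
    finally show ?thesis .
  qed
  have hoelder: "(x k e y - x k e z)\<^sup>2 \<le> \<bar>y - z\<bar> * M" if "e \<in> arcs G" "y \<in> {0..len e}" "z \<in> {0..len e}" for k e y z
  proof -
    have "(x k e y - x k e z)\<^sup>2 \<le> \<bar>y - z\<bar> * integral {0..len e} (\<lambda>t. (edge_deriv (x k) e t)\<^sup>2)"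
      by (rule increment_bound[OF edge_deriv[OF x that(1)] that(2,3)])
    also have "\<dots> \<le> \<bar>y - z\<bar> * M"
      using energy_edge(1)[OF x that(1), of k] en[of k] by (intro mult_left_mono) auto
    finally show ?thesis .
  qed
  have edge: "\<exists>g r. continuous_on {0..len e} g \<and> strict_mono (r::nat\<Rightarrow>nat) \<and>
      uniform_limit {0..len e} (\<lambda>k. x (s (r k)) e) g sequentially" if e: "e \<in> arcs G" for e and s :: "nat \<Rightarrow> nat"
  proof (rule Arzela_Ascoli[of "{0..len e}" "\<lambda>k. x (s k) e" "sqrt B"])
    show "norm (x (s k) e y) \<le> sqrt B" if "y \<in> {0..len e}" for k y
      using real_sqrt_le_mono[OF bd[OF e that, of "s k"]] by simp
    show "\<exists>d>0. \<forall>n z. z \<in> {0..len e} \<and> norm (y - z) < d \<longrightarrow> norm (x (s n) e y - x (s n) e z) < \<epsilon>"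
      if y: "y \<in> {0..len e}" and \<epsilon>: "0 < \<epsilon>" for y \<epsilon>
    proof (intro exI[of _ "\<epsilon>\<^sup>2 / (M + 1)"] conjI allI impI)
      show "0 < \<epsilon>\<^sup>2 / (M + 1)" using \<epsilon> M0 by simp
      fix n z assume z: "z \<in> {0..len e} \<and> norm (y - z) < \<epsilon>\<^sup>2 / (M + 1)"
      then have "\<bar>y - z\<bar> * (M + 1) < \<epsilon>\<^sup>2" using M0 by (simp add: field_simps)
      moreover have "\<bar>y - z\<bar> * M \<le> \<bar>y - z\<bar> * (M + 1)" by (intro mult_left_mono) auto
      ultimately have "(x (s n) e y - x (s n) e z)\<^sup>2 < \<epsilon>\<^sup>2" using hoelder[OF e y, of z "s n"] z by linarith
      then have "\<bar>x (s n) e y - x (s n) e z\<bar>\<^sup>2 < \<epsilon>\<^sup>2" by simp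
      then show "norm (x (s n) e y - x (s n) e z) < \<epsilon>" using \<epsilon> power2_less_imp_less[of "\<bar>x (s n) e y - x (s n) e z\<bar>" \<epsilon>] by simp
    qed
    fix g r assume g: "continuous_on {0..len e} g" "strict_mono (r :: nat \<Rightarrow> nat)"
      and lim: "\<And>\<epsilon>. 0 < \<epsilon> \<Longrightarrow> \<exists>N. \<forall>n y. N \<le> n \<and> y \<in> {0..len e} \<longrightarrow> norm (x (s (r n)) e y - g y) < \<epsilon>"
    have "uniform_limit {0..len e} (\<lambda>k. x (s (r k)) e) g sequentially"
      unfolding uniform_limit_iff eventually_sequentially dist_norm using lim by blast
    then show ?thesis using g by blast
  qed simp
  have "\<exists>r v. strict_mono (r :: nat \<Rightarrow> nat) \<and> (\<forall>e\<in>S. continuous_on {0..len e} (v e) \<and>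
      uniform_limit {0..len e} (\<lambda>k. x (r k) e) (v e) sequentially)" if "finite S" "S \<subseteq> arcs G" for S
    using that
  proof (induction S)
    case empty
    show ?case using strict_mono_id by blast
  next
    case (insert e S)
    then obtain r v where r: "strict_mono (r :: nat \<Rightarrow> nat)"
      and v: "\<And>e. e \<in> S \<Longrightarrow> continuous_on {0..len e} (v e)"
        "\<And>e. e \<in> S \<Longrightarrow> uniform_limit {0..len e} (\<lambda>k. x (r k) e) (v e) sequentially" by blast
    obtain g q where g: "continuous_on {0..len e} g" and q: "strict_mono (q :: nat \<Rightarrow> nat)"
      and lim: "uniform_limit {0..len e} (\<lambda>k. x (r (q k)) e) g sequentially"
      using edge[of e r] insert.prems by blast
    have "strict_mono (r \<circ> q)" using r q by (rule strict_mono_o)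
    moreover have "uniform_limit {0..len d} (\<lambda>k. x ((r \<circ> q) k) d) (v d) sequentially" if "d \<in> S" for d
      using v(2)[OF that] eventually_subseq[OF q] unfolding uniform_limit_iff by (auto simp: o_def)
    ultimately show ?case using insert.hyps v(1) g lim
      by (intro exI[of _ "r \<circ> q"] exI[of _ "v(e := g)"]) (auto simp: o_def)
  qed
  from this[OF finite_arcs subset_refl]
  obtain r v where r: "strict_mono (r :: nat \<Rightarrow> nat)"
    and v: "\<And>e. e \<in> arcs G \<Longrightarrow> continuous_on {0..len e} (v e)"
      "\<And>e. e \<in> arcs G \<Longrightarrow> uniform_limit {0..len e} (\<lambda>k. x (r k) e) (v e) sequentially" by blast
  have vH: "v \<in> H" using v(1) by (intro continuous_H) (simp add: continuous_on_edges_def)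
  have "(\<lambda>k. nrm (x (r k) - v)) \<longlonglongrightarrow> 0"
  proof (rule tendstoI)
    fix \<epsilon> :: real assume \<epsilon>: "0 < \<epsilon>"
    define L where "L = sqrt (\<Sum>e\<in>arcs G. len e)"
    have L: "0 \<le> L" unfolding L_def by (auto intro!: sum_nonneg simp: less_imp_le[OF len_pos])
    define \<eta> where "\<eta> = \<epsilon> / (L + 1)"
    have \<eta>: "0 < \<eta>" using \<epsilon> L by (simp add: \<eta>_def)
    have "eventually (\<lambda>k. \<forall>e\<in>arcs G. \<forall>y\<in>{0..len e}. dist (x (r k) e y) (v e y) < \<eta>) sequentially"
      using v(2) \<eta> by (intro eventually_ball_finite) (auto simp: uniform_limit_iff)
    then show "eventually (\<lambda>k. dist (nrm (x (r k) - v)) 0 < \<epsilon>) sequentially"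
    proof eventually_elim
      case (elim k)
      have w: "x (r k) - v \<in> H" using x vH by simp
      have "nrm (x (r k) - v) \<le> L * \<eta>"
        unfolding L_def using elim \<eta> by (intro nrm_le_sup w) (auto simp: dist_real_def intro: less_imp_le)
      also have "\<dots> < \<epsilon>" using \<epsilon> L by (simp add: \<eta>_def field_simps)
      finally show ?case using nrm_nonneg[OF w] by (simp add: dist_real_def)
    qed
  qed
  then show ?thesis using r vH by blast
qed

definition "max_len = Max (len ` arcs G)"

lemma max_len: "0 < max_len" "e \<in> arcs G \<Longrightarrow> len e \<le> max_len"
proof -
  show le: "len e \<le> max_len" if "e \<in> arcs G" for e using that by (simp add: max_len_def)
  obtain e where "e \<in> arcs G" using arcs_nonempty by blast
  then show "0 < max_len" using le len_pos less_le_trans by blast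
qed

text \<open>
  The linear conditions are the values at the points of a grid with \<open>m\<close> steps on every edge.
\<close>

lemma A_cont_weyl: assumes m: "m > 0"
  shows "\<exists>F. finite F \<and> card F \<le> 2 * card (arcs G) * m \<and> (\<forall>l\<in>F. linear l) \<and>
       (\<forall>u\<in>D_cont. (\<forall>l\<in>F. l u = (0::real)) \<longrightarrow> (1 / (2 * max_len\<^sup>2) * (real m)\<^sup>2 - form_const) * ip u u \<le> ip (A_cont u) u)"
proof -
  define F where "F = (\<lambda>(e, j) (u :: 'e graph_fun). u e (len e / real m * real j)) ` (arcs G \<times> {..m})"
  have "finite F" unfolding F_def by simp
  moreover have "card F \<le> 2 * card (arcs G) * m"
  proof -
    have "card F \<le> card (arcs G \<times> {..m})" unfolding F_def by (intro card_image_le) simp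
    also have "\<dots> = card (arcs G) * Suc m" by (simp add: card_cartesian_product)
    also have "\<dots> \<le> card (arcs G) * (2 * m)" using m by (intro mult_left_mono) auto
    finally show ?thesis by simp
  qed
  moreover have "linear l" if "l \<in> F" for l using that unfolding F_def by (auto intro: linear_evaluation)
  moreover have "(1 / (2 * max_len\<^sup>2) * (real m)\<^sup>2 - form_const) * ip u u \<le> ip (A_cont u) u"
    if u: "u \<in> D_cont" and z: "\<forall>l\<in>F. l u = 0" for u
  proof -
    have "ip u u \<le> (\<Sum>e\<in>arcs G. (max_len / m)\<^sup>2 * integral {0..len e} (\<lambda>x. (edge_deriv u e x)\<^sup>2))"
      unfolding L2_inner_def
    proof (rule sum_mono)
      fix e assume e: "e \<in> arcs G"
      let ?h = "len e / real m"
      have hm: "?h * real m = len e" using m by simp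
      have c: "continuous_on {0..len e} (\<lambda>x. u e x * u e x)" by (intro continuous_intros D_cont_continuous u e)
      have zero: "u e (?h * real j) = 0" if "j \<le> m" for j
      proof -
        have "(\<lambda>u. u e (?h * real j)) \<in> F" unfolding F_def using e that by force
        from bspec[OF z this] show ?thesis .
      qed
      have "(LBINT x:{0..len e}. u e x * u e x) = integral {0..len e} (\<lambda>x. (u e x)\<^sup>2)"
        using LBINT_continuous[OF c] by (simp add: power2_eq_square)
      also have "\<dots> \<le> ?h\<^sup>2 * integral {0..len e} (\<lambda>x. (edge_deriv u e x)\<^sup>2)"
        using poincare_grid[of ?h m "u e" "edge_deriv u e"] edge_deriv[OF u e] zero len_pos[OF e] unfolding hm by simp
      also have "\<dots> \<le> (max_len / m)\<^sup>2 * integral {0..len e} (\<lambda>x. (edge_deriv u e x)\<^sup>2)"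
        using max_len(2)[OF e] len_pos[OF e]
        by (intro mult_right_mono power_mono divide_right_mono integral_nonneg integrable_continuous_real
            continuous_intros edge_deriv_continuous u e) auto
      finally show "(LBINT x:{0..len e}. u e x * u e x) \<le> (max_len / m)\<^sup>2 * integral {0..len e} (\<lambda>x. (edge_deriv u e x)\<^sup>2)" .
    qed
    also have "\<dots> = (max_len / m)\<^sup>2 * energy u u" by (simp add: energy_eq[OF u] sum_distrib_left)
    finally have "ip u u \<le> (max_len / m)\<^sup>2 * energy u u" .
    then have "(real m)\<^sup>2 * ip u u \<le> max_len\<^sup>2 * energy u u"
      using m by (simp add: power_divide field_simps)
    then have "1 / (2 * max_len\<^sup>2) * (real m)\<^sup>2 * ip u u \<le> energy u u / 2"
      using max_len(1) by (simp add: field_simps)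
    moreover have "(1 / (2 * max_len\<^sup>2) * (real m)\<^sup>2 - form_const) * ip u u = 1 / (2 * max_len\<^sup>2) * (real m)\<^sup>2 * ip u u - form_const * ip u u"
      by (simp only: left_diff_distrib)
    ultimately show ?thesis using form_const(2)[OF u] by linarith
  qed
  ultimately show ?thesis by blast
qed

sublocale disc: discrete_sa_operator H ip D_cont A_cont form_const "2 * card (arcs G)" "1 / (2 * max_len\<^sup>2)" form_const
proof
  show "subspace D_cont" by (rule D_cont_subspace)
  show "D_cont \<subseteq> H" using D_cont_H by blast
  show "A_cont u \<in> H" if "u \<in> D_cont" for u using A_cont_H[OF that] .
  show "ip (A_cont u) v = ip u (A_cont v)" if "u \<in> D_cont" "v \<in> D_cont" for u v using A_cont_symmetric[OF that] .
  show "\<exists>u\<in>D_cont. ip (u - v) (u - v) = 0 \<and> ip (A_cont u - w) (A_cont u - w) = 0"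
    if "v \<in> H" "w \<in> H" "\<And>u. u \<in> D_cont \<Longrightarrow> ip (A_cont u) v = ip u w" for v w
    using A_cont_closed[OF that] D_D_cont unfolding A_cont_def by force
  show "\<exists>u\<in>D_cont. nrm (u - v) < \<epsilon>" if "v \<in> H" "0 < \<epsilon>" for v \<epsilon> using D_dense[OF that] D_D_cont by blast
  show "\<exists>r v. strict_mono r \<and> v \<in> H \<and> (\<lambda>k. nrm (x (r k) - v)) \<longlonglongrightarrow> 0"
    if "\<And>k. x k \<in> D_cont" "\<And>k. ip (x k) (x k) \<le> K" "\<And>k. ip (A_cont (x k)) (x k) \<le> K" for x :: "nat \<Rightarrow> 'e graph_fun" and K
    using A_cont_compact[of x K] that by blast
  show "- form_const * ip u u \<le> ip (A_cont u) u" if "u \<in> D_cont" for u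
  proof -
    obtain e where e: "e \<in> arcs G" using arcs_nonempty by blast
    show ?thesis using form_const(2)[OF that] energy_edge(2)[OF that e] by simp
  qed
  show "form_const \<ge> 0" by (rule form_const(1))
  show "\<exists>\<psi>. orthonormal \<psi> n" for n by (rule orthonormal_indicators)
  show "0 < 1 / (2 * max_len\<^sup>2)" using max_len(1) by simp
  show "\<exists>F. finite F \<and> card F \<le> 2 * card (arcs G) * m \<and> (\<forall>l\<in>F. linear l) \<and>
       (\<forall>u\<in>D_cont. (\<forall>l\<in>F. l u = (0::real)) \<longrightarrow> (1 / (2 * max_len\<^sup>2) * (real m)\<^sup>2 - form_const) * ip u u \<le> ip (A_cont u) u)"
    if "m > 0" for m :: nat by (rule A_cont_weyl[OF that])
qed

end


section \<open>Bounded increasing nonlinearities\<close>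

locale bounded_nonlinearity = sa_graph G len D A for G :: "('v, 'e) pre_digraph" and len :: "'e \<Rightarrow> real" and D A +
  fixes g F :: "real \<Rightarrow> real" and B :: real
  assumes g_mono: "mono g" and g_ucont: "uniformly_continuous_on UNIV g" and g_le: "\<And>s. \<bar>g s\<bar> \<le> B"
    and F_deriv: "\<And>s. (F has_real_derivative g s) (at s)" and F_0: "F 0 = 0"
begin

lemma B_nonneg: "0 \<le> B" using g_le[of 0] by linarith

lemma g_measurable [measurable]: "g \<in> borel_measurable borel"
  by (intro borel_measurable_continuous_onI uniformly_continuous_imp_continuous g_ucont)

lemma F_measurable [measurable]: "F \<in> borel_measurable borel"
  by (intro borel_measurable_continuous_onI DERIV_continuous_on[of _ _ g] has_field_derivative_at_within[OF F_deriv])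

lemma F_convex: "F s + g s * (t - s) \<le> F t"
proof (cases s t rule: linorder_cases)
  case less
  then obtain z where z: "s < z" "F t - F s = (t - s) * g z" using MVT2[of s t F g] F_deriv by blast
  then have "(t - s) * g s \<le> (t - s) * g z" using less g_mono by (intro mult_left_mono) (auto simp: mono_def)
  then show ?thesis using z by (simp add: mult.commute)
next
  case greater
  then obtain z where z: "z < s" "F s - F t = (s - t) * g z" using MVT2[of t s F g] F_deriv by blast
  then have "(s - t) * g z \<le> (s - t) * g s" using greater g_mono by (intro mult_left_mono) (auto simp: mono_def)
  moreover have "g s * (t - s) = - ((s - t) * g s)" by (simp add: algebra_simps)
  ultimately show ?thesis using z by linarith
qed simp

lemma F_bound: "\<bar>F s\<bar> \<le> B * \<bar>s\<bar>"
proof -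
  have "F s \<le> - (g s * (0 - s))" using F_convex[of s 0] F_0 by simp
  also have "\<dots> \<le> \<bar>g s\<bar> * \<bar>s\<bar>" using abs_ge_self[of "g s * s"] by (simp add: abs_mult)
  also have "\<dots> \<le> B * \<bar>s\<bar>" by (intro mult_right_mono g_le) auto
  finally have 1: "F s \<le> B * \<bar>s\<bar>" .
  have "- F s \<le> - (g 0 * (s - 0))" using F_convex[of 0 s] F_0 by simp
  also have "\<dots> \<le> \<bar>g 0\<bar> * \<bar>s\<bar>" using abs_ge_minus_self[of "g 0 * s"] by (simp add: abs_mult)
  also have "\<dots> \<le> B * \<bar>s\<bar>" by (intro mult_right_mono g_le) auto
  finally show ?thesis using 1 by linarith
qed

definition \<gamma> :: "'e graph_fun \<Rightarrow> 'e graph_fun" where "\<gamma> u = (\<lambda>e x. g (u e x))"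

definition \<Gamma> :: "'e graph_fun \<Rightarrow> real" where "\<Gamma> u = (\<Sum>e\<in>arcs G. LBINT x:{0..len e}. F (u e x))"

lemma compose_measurable:
  assumes [measurable]: "h \<in> borel_measurable borel" and u: "set_borel_measurable lborel {0..l} u"
  shows "set_borel_measurable lborel {0..l} (\<lambda>x::real. (h :: real \<Rightarrow> real) (u x))"
proof -
  have "(\<lambda>x. indicator {0..l} x *\<^sub>R h (indicator {0..l} x *\<^sub>R u x)) \<in> borel_measurable lborel"
    using u unfolding set_borel_measurable_def by measurable
  also have "(\<lambda>x. indicator {0..l} x *\<^sub>R h (indicator {0..l} x *\<^sub>R u x)) = (\<lambda>x. indicator {0..l} x *\<^sub>R h (u x))"
    by (rule ext) (simp add: indicator_def)
  finally show ?thesis by (simp add: set_borel_measurable_def)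
qed

lemma H_measurable: "u \<in> H \<Longrightarrow> e \<in> arcs G \<Longrightarrow> set_borel_measurable lborel {0..len e} (u e)"
  by (auto simp: L2_graph_def L2_interval_def)

lemma gamma_H: assumes "u \<in> H" shows "\<gamma> u \<in> H"
proof -
  have "\<gamma> u e \<in> L2_interval (len e)" if "e \<in> arcs G" for e
    unfolding \<gamma>_def
    by (rule L2_interval_bounded[OF compose_measurable[OF g_measurable H_measurable[OF assms that]] g_le])
  then show ?thesis by (simp add: L2_graph_def)
qed

lemma F_integrable: "u \<in> H \<Longrightarrow> e \<in> arcs G \<Longrightarrow> set_integrable lborel {0..len e} (\<lambda>x. F (u e x))"
proof -
  assume u: "u \<in> H" and e: "e \<in> arcs G"
  have "set_integrable lborel {0..len e} (\<lambda>x. B * u e x)"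
    using u e by (auto simp: L2_graph_def intro: L2_interval_integrable)
  then show ?thesis
    by (rule set_integrable_bound[OF _ compose_measurable[OF F_measurable H_measurable[OF u e]]])
       (use F_bound B_nonneg in \<open>auto simp: abs_mult\<close>)
qed

lemma nrm_mono:
  assumes "u \<in> H" "v \<in> H" "\<And>e x. e \<in> arcs G \<Longrightarrow> x \<in> {0..len e} \<Longrightarrow> \<bar>u e x\<bar> \<le> \<bar>v e x\<bar>"
  shows "nrm u \<le> nrm v"
proof -
  have "ip u u \<le> ip v v"
    unfolding L2_inner_def
  proof (intro sum_mono set_integral_mono)
    fix e x assume e: "e \<in> arcs G"
    show "set_integrable lborel {0..len e} (\<lambda>x. u e x * u e x)" "set_integrable lborel {0..len e} (\<lambda>x. v e x * v e x)"
      using assms(1,2) e by (auto simp: L2_graph_def intro: L2_interval_mult)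
    assume "x \<in> {0..len e}"
    from assms(3)[OF e this] show "u e x * u e x \<le> v e x * v e x"
      using abs_le_square_iff[of "u e x" "v e x"] by (simp add: power2_eq_square)
  qed
  then show ?thesis unfolding nrm_def by (rule real_sqrt_le_mono)
qed

lemma gamma_convex: assumes u: "u \<in> H" and v: "v \<in> H" shows "\<Gamma> u + ip (\<gamma> u) (v - u) \<le> \<Gamma> v"
  unfolding \<Gamma>_def L2_inner_def sum.distrib[symmetric]
proof (rule sum_mono)
  fix e assume e: "e \<in> arcs G"
  have w: "v - u \<in> H" using u v by simp
  have i: "set_integrable lborel {0..len e} (\<lambda>x. \<gamma> u e x * (v - u) e x)"
  proof (rule L2_interval_mult)
    show "\<gamma> u e \<in> L2_interval (len e)" using gamma_H[OF u] e unfolding L2_graph_def by blast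
    show "(v - u) e \<in> L2_interval (len e)" using w e unfolding L2_graph_def by blast
  qed
  have "(LBINT x:{0..len e}. F (u e x)) + (LBINT x:{0..len e}. \<gamma> u e x * (v - u) e x) =
     (LBINT x:{0..len e}. F (u e x) + \<gamma> u e x * (v - u) e x)"
    by (rule set_integral_add(2)[symmetric, OF F_integrable[OF u e] i])
  also have "\<dots> \<le> (LBINT x:{0..len e}. F (v e x))"
    using F_convex by (intro set_integral_mono set_integral_add(1) F_integrable u v e i) (simp add: \<gamma>_def)
  finally show "(LBINT x:{0..len e}. F (u e x)) + (LBINT x:{0..len e}. \<gamma> u e x * (v - u) e x) \<le> (LBINT x:{0..len e}. F (v e x))" .
qed

definition "sqrt_length = sqrt (\<Sum>e\<in>arcs G. len e)"

lemma sqrt_length_nonneg: "0 \<le> sqrt_length"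
  unfolding sqrt_length_def by (auto intro!: sum_nonneg simp: less_imp_le[OF len_pos])

text \<open>
  Increments of \<open>g\<close> are at most \<open>\<epsilon>\<close> when \<open>s\<close> and \<open>t\<close> are close, and otherwise the bound \<open>2 * B\<close> is a
  multiple of the distance.
\<close>

lemma g_almost_lipschitz: assumes "0 < \<epsilon>" shows "\<exists>M\<ge>0. \<forall>s t. \<bar>g s - g t\<bar> \<le> \<epsilon> + M * \<bar>s - t\<bar>"
proof -
  obtain d where d: "d > 0" "\<And>s t. \<bar>s - t\<bar> < d \<Longrightarrow> \<bar>g s - g t\<bar> < \<epsilon>"
    using g_ucont assms unfolding uniformly_continuous_on_def dist_real_def by (metis UNIV_I)
  have "\<bar>g s - g t\<bar> \<le> \<epsilon> + 2 * B / d * \<bar>s - t\<bar>" for s t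
  proof (cases "\<bar>s - t\<bar> < d")
    case True
    have "0 \<le> 2 * B / d * \<bar>s - t\<bar>" using d(1) B_nonneg by simp
    then show ?thesis using d(2)[OF True] by linarith
  next
    case False
    have "2 * B = 2 * B / d * d" using d(1) by simp
    also have "\<dots> \<le> 2 * B / d * \<bar>s - t\<bar>" using False d(1) B_nonneg by (intro mult_left_mono) auto
    finally show ?thesis using g_le[of s] g_le[of t] assms by linarith
  qed
  moreover have "0 \<le> 2 * B / d" using d(1) B_nonneg by simp
  ultimately show ?thesis by blast
qed

lemma gamma_continuous: assumes \<epsilon>: "0 < \<epsilon>"
  shows "\<exists>M. \<forall>u\<in>H. \<forall>v\<in>H. nrm (\<gamma> u - \<gamma> v) \<le> \<epsilon> + M * nrm (u - v)"
proof -
  define \<eta> where "\<eta> = \<epsilon> / (sqrt_length + 1)"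
  have \<eta>: "0 < \<eta>" using \<epsilon> sqrt_length_nonneg by (simp add: \<eta>_def)
  have te: "sqrt_length * \<eta> \<le> \<epsilon>" using \<epsilon> sqrt_length_nonneg by (simp add: \<eta>_def field_simps)
  obtain M where M: "M \<ge> 0" "\<And>s t. \<bar>g s - g t\<bar> \<le> \<eta> + M * \<bar>s - t\<bar>" using g_almost_lipschitz[OF \<eta>] by blast
  have "nrm (\<gamma> u - \<gamma> v) \<le> \<epsilon> + M * nrm (u - v)" if u: "u \<in> H" and v: "v \<in> H" for u v
  proof -
    let ?c = "(\<lambda>e x. \<eta>) :: 'e graph_fun"
    define w where "w = (\<lambda>e x. \<bar>u e x - v e x\<bar>)"
    have uv: "u - v \<in> H" using u v by simp
    have wH: "w \<in> H"
      unfolding L2_graph_def w_def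
    proof (intro CollectI ballI)
      fix e assume e: "e \<in> arcs G"
      have "(u - v) e \<in> L2_interval (len e)" using uv e by (auto simp: L2_graph_def)
      then have "set_borel_measurable lborel {0..len e} (\<lambda>x. \<bar>(u - v) e x\<bar>)" "set_integrable lborel {0..len e} (\<lambda>x. \<bar>(u - v) e x\<bar>\<^sup>2)"
        using compose_measurable[of abs, OF _ H_measurable[OF uv e]] by (simp_all add: L2_interval_def)
      then show "(\<lambda>x. \<bar>u e x - v e x\<bar>) \<in> L2_interval (len e)" by (simp add: L2_interval_def)
    qed
    have cH: "?c \<in> H" by (rule continuous_H) (simp add: continuous_on_edges_def)
    have "nrm (\<gamma> u - \<gamma> v) \<le> nrm (?c + M *\<^sub>R w)"
    proof (rule nrm_mono)
      fix e x
      show "\<bar>(\<gamma> u - \<gamma> v) e x\<bar> \<le> \<bar>(?c + M *\<^sub>R w) e x\<bar>"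
        using M(2)[of "u e x" "v e x"] by (simp add: \<gamma>_def w_def)
    qed (use u v cH wH gamma_H in auto)
    moreover have "nrm (?c + M *\<^sub>R w) \<le> nrm ?c + nrm (M *\<^sub>R w)" using cH wH by (intro nrm_triangle) auto
    moreover have "nrm ?c \<le> sqrt_length * \<eta>" unfolding sqrt_length_def using cH \<eta> by (intro nrm_le_sup) auto
    moreover have "nrm (M *\<^sub>R w) = M * nrm w" using nrm_scale[OF wH] M(1) by simp
    moreover have "M * nrm w \<le> M * nrm (u - v)"
      using wH uv M(1) by (intro mult_left_mono nrm_mono) (auto simp: w_def)
    ultimately show ?thesis using te by linarith
  qed
  then show ?thesis by blast
qed

sublocale prob: semilinear_problem H ip D_cont A_cont form_const "2 * card (arcs G)" "1 / (2 * max_len\<^sup>2)" form_const \<Gamma> \<gamma> "sqrt_length * B"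
proof
  show "\<gamma> x \<in> H" if "x \<in> H" for x using gamma_H[OF that] .
  show "nrm (\<gamma> x) \<le> sqrt_length * B" if "x \<in> H" for x
    unfolding sqrt_length_def using gamma_H[OF that] g_le B_nonneg by (intro nrm_le_sup) (auto simp: \<gamma>_def)
  show "\<Gamma> x + ip (\<gamma> x) (y - x) \<le> \<Gamma> y" if "x \<in> H" "y \<in> H" for x y using gamma_convex[OF that] .
  show "\<exists>M. \<forall>x\<in>H. \<forall>y\<in>H. nrm (\<gamma> x - \<gamma> y) \<le> \<epsilon> + M * nrm (x - y)" if "0 < \<epsilon>" for \<epsilon>
    using gamma_continuous[OF that] .
qed

text \<open>
  The multiplier exceeds the upper end of the gap minus a constant, and large gaps occur at arbitrarily high
  eigenvalues.
\<close>

theorem large_solutions: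
  assumes mu: "\<mu> > 0"
  shows "\<exists>u\<in>D. \<exists>\<nu>\<ge>k. ip u u = \<mu> \<and> ae_equal G len (A u) (\<lambda>e x. \<nu> * u e x + g (u e x))"
proof -
  obtain n where n: "disc.eigval (Suc n) - disc.eigval n > 8 * (sqrt_length * B) / sqrt \<mu>"
    "disc.eigval (Suc n) \<ge> k + 2 * (sqrt_length * B) / sqrt \<mu>"
    using disc.large_gap by blast
  obtain v \<nu> where v: "v \<in> D_cont" "ip v v = \<mu>" and nu: "\<nu> \<ge> disc.eigval (Suc n) - 2 * (sqrt_length * B) / sqrt \<mu>"
    and eq: "\<And>y. y \<in> H \<Longrightarrow> ip (A_cont v) y = \<nu> * ip v y + ip (\<gamma> v) y"
    using prob.solution_above_gap[OF mu n(1)] by blast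
  have vH: "v \<in> H" "A_cont v \<in> H" "\<gamma> v \<in> H" using v A_cont_H gamma_H by auto
  let ?w = "\<nu> *\<^sub>R v + \<gamma> v"
  have wH: "?w \<in> H" using vH by simp
  have "ip (A_cont v - ?w) (A_cont v - ?w) = 0"
  proof -
    have z: "A_cont v - ?w \<in> H" using vH wH by simp
    then show ?thesis using eq[OF z] vH wH by (simp add: ip_diff ip_add ip_scale)
  qed
  then have 1: "ae_equal G len (A_cont v) ?w" using ae_equal_iff[OF vH(2) wH] by simp
  obtain u where u: "u \<in> D" "ae_equal G len u v" "ae_equal G len (A u) (A_cont v)"
    using D_cont_representative[OF v(1)] by metis
  have "ae_equal G len (A u) (\<lambda>e x. \<nu> * u e x + g (u e x))"
    unfolding ae_equal_def ae_on_graph_def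
  proof
    fix e assume e: "e \<in> arcs G"
    have "AE x\<in>{0..len e} in lborel. A u e x = A_cont v e x" "AE x\<in>{0..len e} in lborel. A_cont v e x = ?w e x"
      "AE x\<in>{0..len e} in lborel. u e x = v e x"
      using u(2,3) 1 e by (auto simp: ae_equal_def ae_on_graph_def)
    then show "AE x\<in>{0..len e} in lborel. A u e x = \<nu> * u e x + g (u e x)"
      by eventually_elim (auto simp: \<gamma>_def)
  qed
  moreover have "ip u u = \<mu>"
  proof -
    have uH: "u \<in> H" using D_H u(1) .
    have "ip u u = ip v u" by (rule ip_ae_cong[OF uH vH(1) uH u(2)])
    also have "\<dots> = ip u v" by (rule ip_sym[OF vH(1) uH])
    also have "\<dots> = ip v v" by (rule ip_ae_cong[OF uH vH(1) vH(1) u(2)])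
    finally show ?thesis using v(2) by simp
  qed
  moreover have "\<nu> \<ge> k" using nu n(2) by linarith
  ultimately show ?thesis using u(1) by blast
qed

end


section \<open>A priori bound for solutions with large parameter\<close>

text \<open>
  Let \<open>X\<close> be the maximum of \<open>\<bar>u\<bar>\<close> and suppose \<open>X > M\<close>. Then \<open>B * X\<close>, which bounds \<open>\<bar>F(u)\<bar>\<close>, is a small fraction of
  \<open>k * X\<^sup>2\<close>, so the conserved energy \<open>c\<close> is at least about \<open>k * X\<^sup>2\<close>. Integrating the conservation law shows that \<open>l * c\<close>
  is about \<open>\<integral> v\<^sup>2 + k * \<integral> u\<^sup>2\<close>. Integration by parts turns \<open>\<integral> v\<^sup>2\<close> into \<open>k * \<integral> u\<^sup>2\<close> up to a boundary
  term of size \<open>c / sqrt k\<close>. Altogether \<open>l * k * X\<^sup>2 \<le> 4 * k * \<mu>\<close>, contrary to the choice of \<open>M\<close>.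
\<close>

lemma ode_sup_bound:
  fixes u v g F :: "real \<Rightarrow> real"
  assumes l: "0 < l" and u: "\<And>x. x \<in> {0..l} \<Longrightarrow> (u has_real_derivative v x) (at x within {0..l})"
    and v: "\<And>x. x \<in> {0..l} \<Longrightarrow> (v has_real_derivative - (k * u x + g (u x))) (at x within {0..l})"
    and g: "continuous_on UNIV g" and g_le: "\<And>s. \<bar>g s\<bar> \<le> B"
    and F: "\<And>s. (F has_real_derivative g s) (at s)" and F_le: "\<And>s. \<bar>F s\<bar> \<le> B * \<bar>s\<bar>"
    and mass: "integral {0..l} (\<lambda>x. (u x)\<^sup>2) \<le> \<mu>"
    and M: "0 < M" "4 * \<mu> < l * M\<^sup>2" and k: "0 < k" "16 / l\<^sup>2 \<le> k" "20 * B / M \<le> k"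
    and x: "x \<in> {0..l}"
  shows "\<bar>u x\<bar> \<le> M"
proof (rule ccontr)
  assume big: "\<not> \<bar>u x\<bar> \<le> M"
  have uc: "continuous_on {0..l} u" and vc: "continuous_on {0..l} v"
    by (rule DERIV_continuous_on[OF u], assumption) (rule DERIV_continuous_on[OF v])
  have gc: "continuous_on {0..l} (\<lambda>x. g (u x))" by (rule continuous_on_compose2[OF g uc]) auto
  have B: "0 \<le> B" using g_le[of 0] by linarith
  obtain x0 where x0: "x0 \<in> {0..l}" "\<And>y. y \<in> {0..l} \<Longrightarrow> \<bar>u y\<bar> \<le> \<bar>u x0\<bar>"
    using continuous_attains_sup[OF compact_Icc _ continuous_on_rabs[OF uc]] l by auto
  define X where "X = \<bar>u x0\<bar>"
  have X: "M < X" using big x0(2)[OF x] by (simp add: X_def)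
  have uX: "\<bar>u y\<bar> \<le> X" if "y \<in> {0..l}" for y using x0(2)[OF that] by (simp add: X_def)
  define E where "E y = (v y)\<^sup>2 + k * (u y)\<^sup>2 + 2 * F (u y)" for y
  have "\<exists>c. \<forall>y\<in>{0..l}. E y = c"
  proof (rule has_field_derivative_zero_constant)
    fix y assume y: "y \<in> {0..l}"
    have Fu: "((\<lambda>y. F (u y)) has_real_derivative g (u y) * v y) (at y within {0..l})"
      by (rule DERIV_chain2[OF F u[OF y]])
    show "(E has_real_derivative 0) (at y within {0..l})"
      unfolding E_def
      by (rule derivative_eq_intros u[OF y] v[OF y] Fu refl)+ (simp add: algebra_simps)
  qed simp
  then obtain c where c: "\<And>y. y \<in> {0..l} \<Longrightarrow> (v y)\<^sup>2 + k * (u y)\<^sup>2 + 2 * F (u y) = c" unfolding E_def by blast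
  have FX: "\<bar>F (u y)\<bar> \<le> B * X" if "y \<in> {0..l}" for y
    using F_le[of "u y"] mult_left_mono[OF uX[OF that] B] by linarith
  have BX: "20 * (B * X) \<le> k * X\<^sup>2"
  proof -
    have "20 * B \<le> k * M" using k(3) M(1) by (simp add: field_simps)
    also have "\<dots> \<le> k * X" using k(1) X by (intro mult_left_mono) auto
    finally have "20 * B * X \<le> k * X * X" using X M(1) by (intro mult_right_mono) auto
    then show ?thesis by (simp add: power2_eq_square mult.assoc)
  qed
  have c_ge: "k * X\<^sup>2 - 2 * (B * X) \<le> c"
  proof -
    have "k * (u x0)\<^sup>2 = k * X\<^sup>2" by (simp add: X_def)
    then show ?thesis using c[OF x0(1)] FX[OF x0(1)] zero_le_power2[of "v x0"] by linarith
  qed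
  have up: "(v y)\<^sup>2 + k * (u y)\<^sup>2 \<le> c + 2 * (B * X)" and lo: "c - 2 * (B * X) \<le> (v y)\<^sup>2 + k * (u y)\<^sup>2"
    if "y \<in> {0..l}" for y
    using c[OF that] FX[OF that] by linarith+
  define \<kappa> where "\<kappa> = sqrt k"
  have kappa: "0 < \<kappa>" "\<kappa>\<^sup>2 = k" using k(1) by (auto simp: \<kappa>_def)
  \<comment> \<open>The hypothesis \<open>16 / l\<^sup>2 \<le> k\<close> makes the boundary terms of the integration by parts small.\<close>
  have kl: "4 \<le> \<kappa> * l"
  proof -
    have "4\<^sup>2 \<le> (\<kappa> * l)\<^sup>2" using k(2) l by (simp add: power_mult_distrib kappa(2) field_simps)
    then show ?thesis using kappa(1) l by (intro power2_le_imp_le[of 4]) auto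
  qed
  have uv: "4 * \<bar>u y * v y\<bar> \<le> l * (c + 2 * (B * X)) / 2" if y: "y \<in> {0..l}" for y
  proof -
    have "0 \<le> (\<bar>v y\<bar> - \<kappa> * \<bar>u y\<bar>)\<^sup>2" by simp
    then have "2 * \<kappa> * \<bar>u y * v y\<bar> \<le> (v y)\<^sup>2 + k * (u y)\<^sup>2"
      by (simp add: power2_diff power_mult_distrib kappa(2) abs_mult mult_ac)
    then have 1: "2 * \<kappa> * \<bar>u y * v y\<bar> \<le> c + 2 * (B * X)" using up[OF y] by linarith
    have "8 * \<bar>u y * v y\<bar> \<le> 2 * (\<kappa> * l) * \<bar>u y * v y\<bar>" using kl by (intro mult_right_mono) auto
    also have "\<dots> = l * (2 * \<kappa> * \<bar>u y * v y\<bar>)" by simp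
    also have "\<dots> \<le> l * (c + 2 * (B * X))" using 1 l by (intro mult_left_mono) auto
    finally show ?thesis by simp
  qed
  define Su where "Su = integral {0..l} (\<lambda>y. (u y)\<^sup>2)"
  define Sv where "Sv = integral {0..l} (\<lambda>y. (v y)\<^sup>2)"
  define Sg where "Sg = integral {0..l} (\<lambda>y. g (u y) * u y)"
  have iu: "((\<lambda>y. (u y)\<^sup>2) has_integral Su) {0..l}" and iv: "((\<lambda>y. (v y)\<^sup>2) has_integral Sv) {0..l}"
    and ig: "((\<lambda>y. g (u y) * u y) has_integral Sg) {0..l}"
    unfolding Su_def Sv_def Sg_def
    by (intro integrable_integral integrable_continuous_real continuous_intros uc vc gc)+
  have "((\<lambda>y. (v y)\<^sup>2 - (k * (u y)\<^sup>2 + g (u y) * u y)) has_integral u l * v l - u 0 * v 0) {0..l}"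
  proof (rule fundamental_theorem_of_calculus)
    fix y assume y: "y \<in> {0..l}"
    have "((\<lambda>y. u y * v y) has_real_derivative (v y)\<^sup>2 - (k * (u y)\<^sup>2 + g (u y) * u y)) (at y within {0..l})"
      by (rule derivative_eq_intros u[OF y] v[OF y] refl)+ (simp add: power2_eq_square algebra_simps)
    then show "((\<lambda>y. u y * v y) has_vector_derivative (v y)\<^sup>2 - (k * (u y)\<^sup>2 + g (u y) * u y)) (at y within {0..l})"
      by (simp add: has_real_derivative_iff_has_vector_derivative)
  qed (use l in simp)
  then have parts: "Sv = k * Su + Sg + (u l * v l - u 0 * v 0)"
    using has_integral_unique[OF _ has_integral_diff[OF iv has_integral_add[OF has_integral_mult_right[OF iu, of k] ig]]] by fastforce
  have Sg: "Sg \<le> l * (B * X)"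
  proof (rule has_integral_le[OF ig])
    show "((\<lambda>y. B * X) has_integral l * (B * X)) {0..l}"
      using has_integral_const_real[of "B * X" 0 l] l by simp
    fix y assume y: "y \<in> {0..l}"
    have "g (u y) * u y \<le> \<bar>g (u y)\<bar> * \<bar>u y\<bar>" using abs_ge_self[of "g (u y) * u y"] by (simp add: abs_mult)
    also have "\<dots> \<le> B * X" using g_le uX[OF y] B by (intro mult_mono) auto
    finally show "g (u y) * u y \<le> B * X" .
  qed
  have tot: "l * (c - 2 * (B * X)) \<le> Sv + k * Su"
  proof (rule has_integral_le[OF _ has_integral_add[OF iv has_integral_mult_right[OF iu, of k]]])
    show "((\<lambda>y. c - 2 * (B * X)) has_integral l * (c - 2 * (B * X))) {0..l}"
      using has_integral_const_real[of "c - 2 * (B * X)" 0 l] l by simp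
  qed (rule lo)
  have "u l * v l - u 0 * v 0 \<le> \<bar>u l * v l\<bar> + \<bar>u 0 * v 0\<bar>" by linarith
  then have "u l * v l - u 0 * v 0 \<le> l * (c + 2 * (B * X)) / 4"
    using uv[of l] uv[of 0] l by simp
  then have "l * (c - 2 * (B * X)) \<le> 2 * (k * Su) + l * (B * X) + l * (c + 2 * (B * X)) / 4"
    using tot parts Sg by linarith
  moreover have "k * Su \<le> k * \<mu>" using mass k(1) by (simp add: Su_def)
  moreover have "l * (c - 2 * (B * X)) = l * c - 2 * (l * (B * X))"
    "l * (c + 2 * (B * X)) / 4 = 1 / 4 * (l * c) + 1 / 2 * (l * (B * X))"
    "l * (3 * c / 4 - 7 / 2 * (B * X)) = 3 / 4 * (l * c) - 7 / 2 * (l * (B * X))"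
    by (simp_all add: algebra_simps add_divide_distrib)
  ultimately have "l * (3 * c / 4 - 7 / 2 * (B * X)) \<le> 2 * (k * \<mu>)" by linarith
  moreover have "l * (k * X\<^sup>2 / 2) \<le> l * (3 * c / 4 - 7 / 2 * (B * X))"
    using c_ge BX l by (intro mult_left_mono) auto
  moreover have "k * (l * X\<^sup>2) = 2 * (l * (k * X\<^sup>2 / 2))" by simp
  ultimately have "k * (l * X\<^sup>2) \<le> k * (4 * \<mu>)" by linarith
  then have "l * X\<^sup>2 \<le> 4 * \<mu>" using k(1) by simp
  moreover have "l * M\<^sup>2 \<le> l * X\<^sup>2" using X M(1) l by (intro mult_left_mono power_mono) auto
  ultimately show False using M(2) by linarith
qed

context bounded_nonlinearity
begin

lemma solution_sup_bound:
  assumes u: "u \<in> D" and eq: "ae_equal G len (A u) (\<lambda>e x. k * u e x + g (u e x))"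
    and mass: "ip u u \<le> \<mu>" and M: "0 < M" "4 * \<mu> < min_len * M\<^sup>2"
    and k: "0 < k" "16 / min_len\<^sup>2 \<le> k" "20 * B / M \<le> k"
    and e: "e \<in> arcs G" and x: "x \<in> {0..len e}"
  shows "\<bar>u e x\<bar> \<le> M"
proof -
  have uD: "u \<in> D_cont" by (rule D_D_cont[OF u])
  have uc: "continuous_on {0..len e} (u e)" by (rule D_cont_continuous[OF uD e])
  have gc: "continuous_on UNIV g" by (intro uniformly_continuous_imp_continuous g_ucont)
  let ?h = "\<lambda>x. - (k * u e x + g (u e x))"
  have hc: "continuous_on {0..len e} ?h"
    by (intro continuous_intros uc continuous_on_compose2[OF gc uc]) auto
  have p: "H2_pair (len e) (u e) (edge_deriv u e) (\<lambda>x. - A u e x)" by (rule D_cont_H2_pair[OF uD u refl e])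
  have edge_deriv_eq: "edge_deriv u e y = edge_deriv u e 0 + integral {0..y} ?h" if y: "y \<in> {0..len e}" for y
  proof -
    have "edge_deriv u e y = edge_deriv u e 0 + (LBINT t:{0..y}. - A u e t)" using p y unfolding H2_pair_def by blast
    also have "(LBINT t:{0..y}. - A u e t) = (LBINT t:{0..y}. ?h t)"
    proof -
      have "AE t in lborel. indicator {0..y} t *\<^sub>R (- A u e t) = indicator {0..y} t *\<^sub>R ?h t"
        using eq e y unfolding ae_equal_def ae_on_graph_def by (auto simp: indicator_def elim!: ballE[of _ _ e] AE_mp)
      moreover have "(\<lambda>t. indicator {0..y} t *\<^sub>R (- A u e t)) \<in> borel_measurable lborel"
        using p y set_integrable_subset[of lborel "{0..len e}" "\<lambda>t. - A u e t" "{0..y}"]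
        unfolding H2_pair_def by (auto simp: set_integrable_def dest!: borel_measurable_integrable)
      moreover have "(\<lambda>t. indicator {0..y} t *\<^sub>R ?h t) \<in> borel_measurable lborel"
        using set_integrable_continuous[OF continuous_on_subset[OF hc], of 0 y] y
        by (auto simp: set_integrable_def dest!: borel_measurable_integrable)
      ultimately show ?thesis unfolding set_lebesgue_integral_def by (intro integral_cong_AE) auto
    qed
    also have "\<dots> = integral {0..y} ?h" using y by (intro LBINT_continuous continuous_on_subset[OF hc]) auto
    finally show ?thesis .
  qed
  have dv: "(edge_deriv u e has_real_derivative ?h y) (at y within {0..len e})" if y: "y \<in> {0..len e}" for y
  proof (rule has_field_derivative_transform_within[where d = 1])
    show "((\<lambda>y. edge_deriv u e 0 + integral {0..y} ?h) has_real_derivative ?h y) (at y within {0..len e})"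
      using integral_has_real_derivative[OF hc y] by (auto intro!: derivative_eq_intros)
    fix z assume "z \<in> {0..len e}"
    then show "edge_deriv u e 0 + integral {0..z} ?h = edge_deriv u e z" by (rule edge_deriv_eq[symmetric])
  qed (use y in auto)
  have "len e \<ge> min_len" by (rule min_len(2)[OF e])
  have M': "4 * \<mu> < len e * M\<^sup>2"
  proof -
    have "min_len * M\<^sup>2 \<le> len e * M\<^sup>2" using \<open>len e \<ge> min_len\<close> by (intro mult_right_mono) auto
    then show ?thesis using M(2) by linarith
  qed
  have "16 / (len e)\<^sup>2 \<le> 16 / min_len\<^sup>2" using min_len(1) \<open>len e \<ge> min_len\<close> by (intro divide_left_mono power_mono) auto
  then have k': "16 / (len e)\<^sup>2 \<le> k" using k(2) by linarith
  have m: "integral {0..len e} (\<lambda>x. (u e x)\<^sup>2) \<le> \<mu>" using integral_le_ip(1)[OF uD e] mass by linarith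
  show ?thesis
    by (rule ode_sup_bound[OF len_pos[OF e] edge_deriv_deriv[OF uD e] dv gc g_le F_deriv F_bound m M(1) M' k(1) k' k(3) x])
qed

end


section \<open>Sign changes and truncation of the nonlinearity\<close>

lemma (in metric_graph) pairing_with_positive:
  assumes u: "u \<in> H" and p: "\<phi> \<in> H"
    and u0: "ae_on_graph G len (\<lambda>e x. 0 \<le> u e x)" and p0: "ae_on_graph G len (\<lambda>e x. 0 < \<phi> e x)"
  shows "0 \<le> ip u \<phi>" "ip u \<phi> = 0 \<Longrightarrow> ae_equal G len u (\<lambda>e x. 0)"
proof -
  have i: "integrable lborel (\<lambda>x. indicator {0..len e} x *\<^sub>R (u e x * \<phi> e x))" if e: "e \<in> arcs G" for e
    using L2_interval_mult[of "u e" "len e" "\<phi> e"] u p e by (auto simp: L2_graph_def set_integrable_def)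
  have nn: "AE x in lborel. 0 \<le> indicator {0..len e} x *\<^sub>R (u e x * \<phi> e x)" if e: "e \<in> arcs G" for e
  proof -
    have "AE x\<in>{0..len e} in lborel. 0 \<le> u e x" "AE x\<in>{0..len e} in lborel. 0 < \<phi> e x"
      using u0 p0 e by (auto simp: ae_on_graph_def)
    then show ?thesis by eventually_elim (auto simp: indicator_def)
  qed
  have ge: "0 \<le> (LBINT x:{0..len e}. u e x * \<phi> e x)" if e: "e \<in> arcs G" for e
    unfolding set_lebesgue_integral_def by (rule integral_nonneg_AE[OF nn[OF e]])
  then show "0 \<le> ip u \<phi>" unfolding L2_inner_def by (rule sum_nonneg)
  assume "ip u \<phi> = 0"
  then have z: "\<forall>e\<in>arcs G. (LBINT x:{0..len e}. u e x * \<phi> e x) = 0"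
    unfolding L2_inner_def using ge by (subst (asm) sum_nonneg_eq_0_iff) auto
  show "ae_equal G len u (\<lambda>e x. 0)"
    unfolding ae_equal_def ae_on_graph_def
  proof
    fix e assume e: "e \<in> arcs G"
    have "AE x in lborel. indicator {0..len e} x *\<^sub>R (u e x * \<phi> e x) = 0"
      using z e integral_nonneg_eq_0_iff_AE[OF i[OF e] nn[OF e]] by (simp add: set_lebesgue_integral_def)
    moreover have "AE x\<in>{0..len e} in lborel. 0 < \<phi> e x" using p0 e by (simp add: ae_on_graph_def)
    ultimately show "AE x\<in>{0..len e} in lborel. u e x = 0" by eventually_elim (auto simp: indicator_def)
  qed
qed

text \<open>
  The quotient \<open>f s / \<bar>s\<bar>\<close> increases and vanishes in the limit at \<open>0\<close>, so it has the sign of \<open>s\<close>. On each side of \<open>0\<close>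
  both factors of \<open>f s = (f s / \<bar>s\<bar>) * \<bar>s\<bar>\<close> then act in the same direction.
\<close>

lemma monotone_nonlinearity:
  fixes f :: "real \<Rightarrow> real"
  assumes cont: "continuous_on UNIV f" and m: "strict_mono_on (UNIV - {0}) (\<lambda>s. f s / \<bar>s\<bar>)"
    and z: "((\<lambda>s. f s / \<bar>s\<bar>) \<longlongrightarrow> 0) (at 0)"
  shows "f 0 = 0" "mono f"
proof -
  let ?q = "\<lambda>s. f s / \<bar>s\<bar>"
  have q: "f s = ?q s * \<bar>s\<bar>" if "s \<noteq> 0" for s using that by simp
  have qm: "?q s \<le> ?q t" if "s \<le> t" "s \<noteq> 0" "t \<noteq> 0" for s t
    using m that unfolding strict_mono_on_def by (cases "s = t") (auto simp: less_le)
  show f0: "f 0 = 0"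
  proof (rule tendsto_unique[of "at (0::real)"])
    show "(f \<longlongrightarrow> f 0) (at 0)" using cont by (simp add: continuous_on_eq_continuous_at isCont_def)
    have "((\<lambda>s. ?q s * \<bar>s\<bar>) \<longlongrightarrow> 0 * \<bar>0\<bar>) (at 0)" by (intro tendsto_mult z tendsto_rabs tendsto_ident_at)
    moreover have "\<forall>\<^sub>F s in at 0. ?q s * \<bar>s\<bar> = f s" by (auto simp: eventually_at_filter)
    ultimately show "(f \<longlongrightarrow> 0) (at 0)" by (simp add: tendsto_cong)
  qed simp
  have pos: "0 \<le> ?q s" if s: "0 < s" for s
  proof (rule tendsto_upperbound[where F = "at_right 0" and f = ?q])
    show "(?q \<longlongrightarrow> 0) (at_right 0)" using z by (rule tendsto_within_subset) simp
    show "\<forall>\<^sub>F t in at_right 0. ?q t \<le> ?q s"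
      using eventually_at_right_real[OF s] by eventually_elim (use s in \<open>intro qm, auto\<close>)
  qed simp
  have neg: "?q s \<le> 0" if s: "s < 0" for s
  proof (rule tendsto_lowerbound[where F = "at_left 0" and f = ?q])
    show "(?q \<longlongrightarrow> 0) (at_left 0)" using z by (rule tendsto_within_subset) simp
    show "\<forall>\<^sub>F t in at_left 0. ?q s \<le> ?q t"
      using eventually_at_left_real[OF s] by eventually_elim (use s in \<open>intro qm, auto\<close>)
  qed simp
  have fpos: "0 \<le> f s" if "0 \<le> s" for s
    using pos[of s] q[of s] f0 that by (cases "s = 0") (auto simp: zero_le_divide_iff)
  have fneg: "f s \<le> 0" if "s \<le> 0" for s
    using neg[of s] f0 that by (cases "s = 0") (auto simp: divide_le_0_iff zero_le_divide_iff)
  show "mono f"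
  proof (rule monoI)
    fix x y :: real assume xy: "x \<le> y"
    consider "0 < x" | "x \<le> 0" "0 \<le> y" | "y < 0" by linarith
    then show "f x \<le> f y"
    proof cases
      case 1
      have "?q x * \<bar>x\<bar> \<le> ?q y * \<bar>y\<bar>" using 1 xy qm[of x y] pos[of y] by (intro mult_mono) auto
      then show ?thesis using q[of x] q[of y] 1 xy by simp
    next
      case 2
      then show ?thesis using fpos[of y] fneg[of x] by linarith
    next
      case 3
      have "?q x * \<bar>x\<bar> \<le> ?q x * \<bar>y\<bar>" using 3 xy neg[of x] by (intro mult_left_mono_neg) auto
      also have "\<dots> \<le> ?q y * \<bar>y\<bar>" using 3 xy by (intro mult_right_mono qm) auto
      finally show ?thesis using q[of x] q[of y] 3 xy by simp
    qed
  qed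
qed

lemma clamped_uniformly_continuous:
  fixes f :: "real \<Rightarrow> real"
  assumes "continuous_on UNIV f" "0 < M"
  shows "uniformly_continuous_on UNIV (\<lambda>s. f (max (- M) (min M s)))"
proof -
  have uc: "uniformly_continuous_on {-M..M} f"
    by (intro compact_uniformly_continuous continuous_on_subset[OF assms(1)]) auto
  show ?thesis
    unfolding uniformly_continuous_on_def
  proof (intro allI impI)
    fix e :: real assume "0 < e"
    then obtain d where d: "d > 0" "\<And>x y. x \<in> {-M..M} \<Longrightarrow> y \<in> {-M..M} \<Longrightarrow> dist y x < d \<Longrightarrow> dist (f y) (f x) < e"
      using uniformly_continuous_onE[OF uc] by blast
    show "\<exists>d>0. \<forall>x\<in>UNIV. \<forall>y\<in>UNIV. dist y x < d \<longrightarrow>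
        dist (f (max (- M) (min M y))) (f (max (- M) (min M x))) < e"
    proof (intro exI[of _ d] conjI ballI impI d)
      fix x y :: real assume "dist y x < d"
      moreover have "\<bar>max (- M) (min M y) - max (- M) (min M x)\<bar> \<le> \<bar>y - x\<bar>"
        using assms(2) by (simp add: max_def min_def)
      ultimately show "dist (max (- M) (min M y)) (max (- M) (min M x)) < d" by (simp add: dist_real_def)
    qed (use assms(2) in auto)
  qed
qed

lemma antiderivative_exists:
  fixes g :: "real \<Rightarrow> real"
  assumes "continuous_on UNIV g"
  shows "\<exists>F. (\<forall>s. (F has_real_derivative g s) (at s)) \<and> F 0 = 0"
proof -
  have "\<exists>F. \<forall>x. -\<infinity> < ereal x \<longrightarrow> ereal x < \<infinity> \<longrightarrow> (F has_vector_derivative g x) (at x)"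
    using assms by (intro einterval_antiderivative) (auto simp: continuous_on_eq_continuous_at)
  then obtain F where "\<And>x. (F has_vector_derivative g x) (at x)" by auto
  then have "((\<lambda>x. F x - F 0) has_real_derivative g s) (at s)" for s
    by (auto intro!: derivative_eq_intros simp: has_real_derivative_iff_has_vector_derivative)
  then show ?thesis by (intro exI[of _ "\<lambda>x. F x - F 0"]) simp
qed

context bounded_nonlinearity
begin

text \<open>
  Symmetry of \<open>A\<close> gives \<open>(\<nu> - k) * ip u \<phi> = ip (g u) \<phi>\<close>. If \<open>s * u \<ge> 0\<close> for a sign \<open>s\<close>, then \<open>s * g(u) \<ge> 0\<close>, so both sides
  times \<open>s\<close> must vanish, and then \<open>u\<close> vanishes because \<open>\<phi>\<close> is positive.
\<close>

lemma sign_changing_above_positive_eigenvalue: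
  assumes g0: "g 0 = 0"
    and phi: "\<phi> \<in> D" "ae_equal G len (A \<phi>) (\<lambda>e x. \<nu> * \<phi> e x)" "ae_on_graph G len (\<lambda>e x. 0 < \<phi> e x)"
    and u: "u \<in> D" "ae_equal G len (A u) (\<lambda>e x. k * u e x + g (u e x))" and un: "ip u u \<noteq> 0" and k: "\<nu> < k"
  shows "sign_changing G len u"
proof -
  have uH: "u \<in> H" and pH: "\<phi> \<in> H" and AuH: "A u \<in> H" and ApH: "A \<phi> \<in> H" using u phi D_H A_H by auto
  have gH: "\<gamma> u \<in> H" by (rule gamma_H[OF uH])
  have "ae_equal G len (A u) (k *\<^sub>R u + \<gamma> u)" using u(2) by (simp add: ae_equal_def ae_on_graph_def \<gamma>_def)
  then have "ip (A u) \<phi> = k * ip u \<phi> + ip (\<gamma> u) \<phi>"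
    using ip_ae_cong[of "A u" "k *\<^sub>R u + \<gamma> u" \<phi>] uH gH pH AuH by (simp add: ip_add ip_scale)
  moreover have "ip (A u) \<phi> = \<nu> * ip u \<phi>"
  proof -
    have "ae_equal G len (A \<phi>) (\<nu> *\<^sub>R \<phi>)" using phi(2) by (simp add: ae_equal_def ae_on_graph_def)
    then have "ip (A \<phi>) u = \<nu> * ip \<phi> u"
      using ip_ae_cong[of "A \<phi>" "\<nu> *\<^sub>R \<phi>" u] uH pH ApH by (simp add: ip_scale)
    then show ?thesis using A_symmetric[OF u(1) phi(1)] ip_sym[OF uH ApH] ip_sym[OF uH pH] by simp
  qed
  ultimately have key: "(\<nu> - k) * ip u \<phi> = ip (\<gamma> u) \<phi>" by (simp add: algebra_simps)
  have one_sign: "ae_equal G len u (\<lambda>e x. 0)"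
    if s: "s = 1 \<or> s = -1" and su: "ae_on_graph G len (\<lambda>e x. 0 \<le> s * u e x)" for s :: real
  proof -
    have sg: "0 \<le> s * g t" if "0 \<le> s * t" for t
      using s that g_mono g0 unfolding mono_def by (metis minus_mult_commute mult_1 mult_minus1 neg_0_le_iff_le)
    have "ae_on_graph G len (\<lambda>e x. 0 \<le> (s *\<^sub>R u) e x)" using su by simp
    note 1 = pairing_with_positive[where u = "s *\<^sub>R u", OF _ pH this phi(3)]
    have "ae_on_graph G len (\<lambda>e x. 0 \<le> (s *\<^sub>R \<gamma> u) e x)"
      using su sg by (auto simp: ae_on_graph_def \<gamma>_def elim!: ballE AE_mp)
    note 2 = pairing_with_positive(1)[where u = "s *\<^sub>R \<gamma> u", OF _ pH this phi(3)]
    have a: "0 \<le> s * ip u \<phi>" using 1(1) uH pH by (simp add: ip_scale)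
    have "0 \<le> s * ip (\<gamma> u) \<phi>" using 2 gH pH by (simp add: ip_scale)
    then have "0 \<le> (\<nu> - k) * (s * ip u \<phi>)" by (simp add: key[symmetric] mult.left_commute)
    then have "s * ip u \<phi> = 0" using a k by (simp add: zero_le_mult_iff)
    then have "ae_equal G len (s *\<^sub>R u) (\<lambda>e x. 0)" using 1(2) uH pH by (simp add: ip_scale)
    then show ?thesis using s by (auto simp: ae_equal_def ae_on_graph_def)
  qed
  have nz: "\<not> ae_equal G len u (\<lambda>e x. 0)" using ip_eq_0_iff[OF uH] un by simp
  have imp: "ae_on_graph G len Q" if "ae_on_graph G len P" "\<And>e x. P e x \<Longrightarrow> Q e x" for P Q
    using that by (auto simp: ae_on_graph_def elim!: ballE AE_mp)
  have "ae_on_graph G len (\<lambda>e x. 0 \<le> -1 * u e x)" if "ae_equal G len (\<lambda>e x. max (u e x) 0) (\<lambda>e x. 0)"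
    using that unfolding ae_equal_def by (rule imp) (simp add: max_def split: if_splits)
  moreover have "ae_on_graph G len (\<lambda>e x. 0 \<le> 1 * u e x)" if "ae_equal G len (\<lambda>e x. max (- u e x) 0) (\<lambda>e x. 0)"
    using that unfolding ae_equal_def by (rule imp) (simp add: max_def split: if_splits)
  ultimately show ?thesis using one_sign[of "-1"] one_sign[of 1] nz unfolding sign_changing_def by blast
qed

end

theorem theorem1p1:
  fixes G :: "('v, 'e) pre_digraph" and len :: "'e \<Rightarrow> real"
    and D :: "'e graph_fun set" and A :: "'e graph_fun \<Rightarrow> 'e graph_fun"
    and f F :: "real \<Rightarrow> real" and \<mu> :: real
  assumes graph: "compact_metric_graph G len"
    and realisation: "selfadjoint_laplacian G len D A"
    and f_cont: "continuous_on UNIV f"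
    and F_def: "\<And>s. F s = (LBINT t=0..s. f t)"
    and f_mono: "strict_mono_on (UNIV - {0}) (\<lambda>s. f s / \<bar>s\<bar>)"
    and f_zero: "((\<lambda>s. f s / \<bar>s\<bar>) \<longlongrightarrow> 0) (at 0)"
    and f_top: "filterlim (\<lambda>s. f s / \<bar>s\<bar>) at_top at_top"
    and f_bot: "filterlim (\<lambda>s. f s / \<bar>s\<bar>) at_bot at_bot"
    and F_balance: "\<exists>s\<^sub>0>0. \<exists>\<kappa>\<^sub>0>1. \<forall>s\<ge>s\<^sub>0. F (s / \<kappa>\<^sub>0) \<le> F (- s) \<and> F (- s) \<le> F (\<kappa>\<^sub>0 * s)"
    and mass: "\<mu> > 0"
  shows "\<exists>(\<Lambda> :: nat \<Rightarrow> real) (u :: nat \<Rightarrow> 'e graph_fun).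
           filterlim \<Lambda> at_top sequentially \<and>
           (\<forall>j. u j \<in> D \<and>
                ae_equal G len (A (u j)) (\<lambda>e x. \<Lambda> j * u j e x + f (u j e x)) \<and>
                (L2_norm G len (u j))\<^sup>2 = \<mu>) \<and>
           ((\<exists>\<phi>. eigenfunction G len D A \<phi> \<and> ae_on_graph G len (\<lambda>e x. \<phi> e x > 0)) \<longrightarrow>
              eventually (\<lambda>j. sign_changing G len (u j)) sequentially)"
proof -
  interpret sa_graph G len D A using graph realisation by unfold_locales
  note f = monotone_nonlinearity[OF f_cont f_mono f_zero]
  \<comment> \<open>Any constant with \<open>4 * \<mu> < min_len * M\<^sup>2\<close> would serve.\<close>
  define M where "M = 4 * sqrt (\<mu> / min_len)"
  have M: "0 < M" "4 * \<mu> < min_len * M\<^sup>2"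
    using mass min_len(1) by (simp_all add: M_def power_mult_distrib)
  define g where "g s = f (max (- M) (min M s))" for s
  define B where "B = \<bar>f M\<bar> + \<bar>f (- M)\<bar>"
  have g_eq: "g s = f s" if "\<bar>s\<bar> \<le> M" for s using that by (simp add: g_def min_absorb2 max_absorb2 abs_le_iff)
  have g_uc: "uniformly_continuous_on UNIV g"
    using clamped_uniformly_continuous[OF f_cont M(1)] by (simp add: g_def[abs_def])
  obtain F' where F': "\<And>s. (F' has_real_derivative g s) (at s)" "F' 0 = 0"
    using antiderivative_exists[OF uniformly_continuous_imp_continuous[OF g_uc]] by blast
  interpret bounded_nonlinearity G len D A g F' B
  proof
    show "mono g" using f(2) unfolding g_def mono_def by (metis max.mono min.mono order_refl)
    show "uniformly_continuous_on UNIV g" by (rule g_uc)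
    show "\<bar>g s\<bar> \<le> B" for s
    proof -
      have "f (- M) \<le> g s" "g s \<le> f M" using f(2) M(1) unfolding g_def mono_def by auto
      then show ?thesis unfolding B_def by linarith
    qed
    show "(F' has_real_derivative g s) (at s)" for s by (rule F'(1))
    show "F' 0 = 0" by (rule F'(2))
  qed
  have g0: "g 0 = 0" using g_eq[of 0] f(1) M(1) by simp
  \<comment> \<open>Lower bounds for the parameter: divergence, and the thresholds of the a priori bound.\<close>
  define k where "k j = max (real j) (max 1 (max (16 / min_len\<^sup>2) (20 * B / M)))" for j :: nat
  define P where "P j p \<longleftrightarrow> fst p \<in> D \<and> k j \<le> snd p \<and> ip (fst p) (fst p) = \<mu> \<and>
     ae_equal G len (A (fst p)) (\<lambda>e x. snd p * fst p e x + g (fst p e x))" for j and p :: "'e graph_fun \<times> real"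
  have "\<exists>p. P j p" for j
    using large_solutions[OF mass, of "k j"] unfolding P_def by auto
  then obtain p where p: "\<And>j. P j (p j)" by metis
  define u where "u j = fst (p j)" for j
  define \<Lambda> where "\<Lambda> j = snd (p j)" for j
  have u: "u j \<in> D" "ip (u j) (u j) = \<mu>" "ae_equal G len (A (u j)) (\<lambda>e x. \<Lambda> j * u j e x + g (u j e x))"
    and k: "k j \<le> \<Lambda> j" for j
    using p[of j] by (simp_all add: P_def u_def \<Lambda>_def)
  have kj: "real j \<le> \<Lambda> j" "0 < \<Lambda> j" "16 / min_len\<^sup>2 \<le> \<Lambda> j" "20 * B / M \<le> \<Lambda> j" for j
    using k[of j] unfolding k_def by linarith+
  have top: "filterlim \<Lambda> at_top sequentially"
    by (rule filterlim_at_top_mono[OF filterlim_real_sequentially]) (use kj in simp)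
  have bound: "\<bar>u j e x\<bar> \<le> M" if "e \<in> arcs G" "x \<in> {0..len e}" for j e x
    by (rule solution_sup_bound[OF u(1) u(3) _ M kj(2-4) that]) (simp add: u(2))
  have sol: "ae_equal G len (A (u j)) (\<lambda>e x. \<Lambda> j * u j e x + f (u j e x))" for j
    unfolding ae_equal_def ae_on_graph_def
  proof
    fix e assume e: "e \<in> arcs G"
    have "AE x\<in>{0..len e} in lborel. A (u j) e x = \<Lambda> j * u j e x + g (u j e x)"
      using u(3)[of j] e by (simp add: ae_equal_def ae_on_graph_def)
    then show "AE x\<in>{0..len e} in lborel. A (u j) e x = \<Lambda> j * u j e x + f (u j e x)"
      by eventually_elim (use g_eq[OF bound[OF e]] in auto)
  qed
  have norm: "(L2_norm G len (u j))\<^sup>2 = \<mu>" for j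
    using nrm_sq[OF D_H[OF u(1)]] u(2) by (simp add: L2_norm_eq_nrm)
  have "eventually (\<lambda>j. sign_changing G len (u j)) sequentially"
    if phi: "eigenfunction G len D A \<phi>" "ae_on_graph G len (\<lambda>e x. \<phi> e x > 0)" for \<phi>
  proof -
    obtain \<nu> where "\<phi> \<in> D" "ae_equal G len (A \<phi>) (\<lambda>e x. \<nu> * \<phi> e x)"
      using phi(1) by (auto simp: eigenfunction_def)
    note sc = sign_changing_above_positive_eigenvalue[OF g0 this phi(2) u(1,3)]
    have "eventually (\<lambda>j. \<nu> < \<Lambda> j) sequentially" using top by (simp add: filterlim_at_top_dense)
    then show ?thesis by eventually_elim (rule sc, use u(2) mass in auto)
  qed
  then show ?thesis using top u(1) sol norm by blast
qed

end
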